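(* Let $(\mathbb{T},w,x,o)$ be a unimodular Bienaymé-Galton-Watson tree with reproduction law $\pi$, with i.i.d. edge weights of distribution $\omega$ and i.i.d. vertex weights of distribution $\xi$ (all independent), where: (i) $\xi$ is lower bounded, and is either continuous (no atoms) or has its only atom at its minimum $m_\xi\in\mathbb{R}$; (ii) $\omega$ is continuous (no atoms), and its support is locally convex under its maximum $M_\omega\in\mathbb{R}\cup\{+\infty\}$; (iii) $\pi$ has a finite second moment. Let $\mathbb{MD}$ be the almost surely unique optimal monomer-dimer configuration on $(\mathbb{T},w,x,o)$. Let $(G_n,w_n,x_n)_{n\in\mathbb{N}}$ be a sequence of finite weighted random graphs and let $\mathrm{MD}_n$ be any optimal monomer-dimer configuration on $(G_n,w_n,x_n)$. Let $o_n,o_n'$ be two vertices of $G_n$. Assume that: (1) the graph distance between $o_n$ and $o_n'$ goes to infinity as $n\to\infty$; (2) the pair $\big((G_n,w_n,x_n,o_n),(G_n,w_n,x_n,o_n')\big)$ jointly converges locally to two independent copies of $(\mathbb{T},w,x,o)$. Then the pair $$\big((G_n,w_n,x_n,\mathrm{MD}_n,o_n),(G_n,w_n,x_n,\mathrm{MD}_n,o_n')\big)$$ jointly converges locally to two independent copies of $(\mathbb{T},w,x,\mathbb{MD},o)$.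
   Context: Unimodular Bienaymé-Galton-Watson (UBGW) tree with reproduction law $\pi$: $\pi$ is a probability measure on $\mathbb{N}_0=\{0,1,2,\dots\}$ with finite mean $E>0$; $\hat\pi(k)=\frac{(k+1)\pi(k+1)}{E}$ for $k\in\mathbb{N}_0$. The UBGW tree $(\mathbb{T},o)$ is the random rooted tree in which the numbers of children of all vertices are independent, the root $o$ has a number of children distributed as $\pi$, and every non-root vertex has a number of children distributed as $\hat\pi$. "The support of $\omega$ is locally convex under its maximum $M_\omega$" ($M_\omega$ being the supremum of the support) means that the support contains a non-empty open interval with right endpoint $M_\omega$: $(M_\omega-\varepsilon,M_\omega)$ for some $\varepsilon>0$ if $M_\omega<\infty$, or $(A,+\infty)$ for some $A\in\mathbb{R}$ if $M_\omega=+\infty$. A weighted graph $(G,w,x)$ is a locally finite graph with $w:E(G)\to\mathbb{R}$, $x:V(G)\to\mathbb{R}$. A monomer-dimer configuration on $G$ is a set $\mathrm{MD}\subseteq E(G)$ such that every vertex is incident to at most one edge of $\mathrm{MD}$; elements of $\mathrm{MD}$ are dimers, and vertices incident to no edge of $\mathrm{MD}$ are monomers. On a finite weighted graph, $\mathrm{MD}$ is optimal if it maximises $\sum_{e\text{ dimer}}w(e)+\sum_{v\text{ monomer}}x(v)$. Definition of $\mathbb{MD}$: under (i)–(iii) there is almost surely a unique family $Z$ of messages on the directed edges of $\mathbb{T}$ (both orientations of each edge) such that $Z(u,v)=\max\big(x(v),\max_{u'\sim v,\,u'\ne u}(w(v,u')-Z(v,u'))\big)$ for every directed edge $(u,v)$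 (maximum over the empty set being $-\infty$). $\mathbb{MD}$ is the configuration on $\mathbb{T}$ in which $\{u,v\}$ is a dimer if and only if $w(u,v)>Z(u,v)+Z(v,u)$. This is the almost surely unique optimal configuration on $(\mathbb{T},w,x,o)$ in the sense that it is the local limit of the optimal configurations of any finite weighted rooted graphs converging locally to $(\mathbb{T},w,x,o)$. For a rooted graph $(G,o)$ and $H\in\mathbb{N}_0$, $B_H(G,o)$ is the subgraph induced on the vertices at distance at most $H+1$ from $o$, rooted at $o$ (carrying the restricted weights and configuration when present). $\cong$ denotes root-preserving graph isomorphism which also preserves edge weights, vertex weights and membership of edges in the configuration exactly, when present. A sequence of rooted (weighted, decorated) graphs converges locally to a limit if for every $H\in\mathbb{N}_0$ there is $N$ such that for all $n\ge N$ the ball $B_H$ of the $n$-th graph is isomorphic to the ball $B_H$ of the limit. For random graphs, local convergence means that all objects are defined on a common probability space and the convergence holds almost surely; joint local convergence of a pair to two independent copies means that on a common probability space each component converges locally almost surely to a limit, the two limits being independent with the stated law. *)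

theory Defs
  imports "HOL-Probability.Probability"
begin

section \<open>Weighted graphs and monomer-dimer configurations\<close>

text \<open>
  Simple graphs; an edge is a two-element set of vertices. The values of \<open>ew\<close> off the edges and
  of \<open>vw\<close> off the vertices carry no meaning: no notion below depends on them.
\<close>

record 'v wgraph =
  verts :: "'v set"
  edges :: "'v set set"
  ew :: "'v set \<Rightarrow> real"
  vw :: "'v \<Rightarrow> real"

text \<open>
  A rooted weighted graph carrying a set of dimers. A rooted weighted graph without configuration
  is represented by taking the set of dimers empty.
\<close>

record 'v rgraph = "'v wgraph" +
  dimers :: "'v set set"
  root :: 'v

definition rooted :: "'v wgraph \<Rightarrow> 'v set set \<Rightarrow> 'v \<Rightarrow> 'v rgraph" where
  "rooted G D r = \<lparr>verts = verts G, edges = edges G, ew = ew G, vw = vw G, dimers = D, root = r\<rparr>"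

definition locally_finite_graph :: "('v, 'm) wgraph_scheme \<Rightarrow> bool" where
  "locally_finite_graph G \<longleftrightarrow>
     (\<forall>e\<in>edges G. \<exists>u\<in>verts G. \<exists>v\<in>verts G. u \<noteq> v \<and> e = {u, v}) \<and>
     (\<forall>v\<in>verts G. finite {e \<in> edges G. v \<in> e})"

definition finite_graph :: "('v, 'm) wgraph_scheme \<Rightarrow> bool" where
  "finite_graph G \<longleftrightarrow> locally_finite_graph G \<and> finite (verts G)"

definition monomer_dimer :: "('v, 'm) wgraph_scheme \<Rightarrow> 'v set set \<Rightarrow> bool" where
  "monomer_dimer G D \<longleftrightarrow>
     D \<subseteq> edges G \<and> (\<forall>v\<in>verts G. \<forall>e\<in>D. \<forall>e'\<in>D. v \<in> e \<and> v \<in> e' \<longrightarrow> e = e')"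

definition monomers :: "('v, 'm) wgraph_scheme \<Rightarrow> 'v set set \<Rightarrow> 'v set" where
  "monomers G D = {v \<in> verts G. \<forall>e\<in>D. v \<notin> e}"

definition md_weight :: "('v, 'm) wgraph_scheme \<Rightarrow> 'v set set \<Rightarrow> real" where
  "md_weight G D = (\<Sum>e\<in>D. ew G e) + (\<Sum>v\<in>monomers G D. vw G v)"

definition optimal :: "('v, 'm) wgraph_scheme \<Rightarrow> 'v set set \<Rightarrow> bool" where
  "optimal G D \<longleftrightarrow>
     monomer_dimer G D \<and> (\<forall>D'. monomer_dimer G D' \<longrightarrow> md_weight G D' \<le> md_weight G D)"

definition rooted_graph :: "'v rgraph \<Rightarrow> bool" where
  "rooted_graph g \<longleftrightarrow>
     locally_finite_graph g \<and> root g \<in> verts g \<and> monomer_dimer g (dimers g)"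


section \<open>Messages and the configuration they define\<close>

definition darts :: "('v, 'm) wgraph_scheme \<Rightarrow> ('v \<times> 'v) set" where
  "darts G = {(u, v). {u, v} \<in> edges G}"

text \<open>
  The vertex weight \<open>vw G v\<close> belongs to the set maximised over, so the maximum is over a non-empty
  set also when \<open>u\<close> is the only neighbour of \<open>v\<close>. Requiring \<open>extensional\<close> makes \<open>Z\<close> a family
  indexed by the darts only, so that uniqueness of \<open>Z\<close> has its intended meaning.
\<close>

definition messages :: "('v, 'm) wgraph_scheme \<Rightarrow> ('v \<times> 'v \<Rightarrow> real) \<Rightarrow> bool" where
  "messages G Z \<longleftrightarrow> Z \<in> extensional (darts G) \<and>
     (\<forall>(u, v)\<in>darts G.
        Z (u, v) = Max (insert (vw G v)
          {ew G {v, u'} - Z (v, u') | u'. (v, u') \<in> darts G \<and> u' \<noteq> u}))"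

text \<open>
  The empty configuration is a dummy value for graphs on which the messages are not unique.
\<close>

definition MD :: "('v, 'm) wgraph_scheme \<Rightarrow> 'v set set" where
  "MD G = (if \<exists>!Z. messages G Z
     then let Z = (THE Z. messages G Z)
       in {{u, v} | u v. (u, v) \<in> darts G \<and> ew G {u, v} > Z (u, v) + Z (v, u)}
     else {})"


section \<open>Local convergence\<close>

text \<open>The graph distance is \<open>\<infinity>\<close> between different components.\<close>

definition gdist :: "('v, 'm) wgraph_scheme \<Rightarrow> 'v \<Rightarrow> 'v \<Rightarrow> enat" where
  "gdist G u v = (INF k\<in>{k. (u, v) \<in> darts G ^^ k}. enat k)"

definition ball_verts :: "nat \<Rightarrow> 'v rgraph \<Rightarrow> 'v set" where
  "ball_verts H g = {v \<in> verts g. gdist g (root g) v \<le> enat (H + 1)}"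

definition graph_ball :: "nat \<Rightarrow> 'v rgraph \<Rightarrow> 'v rgraph" where
  "graph_ball H g = g
     \<lparr>verts := ball_verts H g,
      edges := {e \<in> edges g. e \<subseteq> ball_verts H g},
      dimers := {e \<in> dimers g. e \<subseteq> ball_verts H g}\<rparr>"

definition graph_iso :: "'v rgraph \<Rightarrow> 'u rgraph \<Rightarrow> bool" where
  "graph_iso g h \<longleftrightarrow> (\<exists>f. bij_betw f (verts g) (verts h) \<and>
     f (root g) = root h \<and>
     (`) f ` edges g = edges h \<and>
     (`) f ` dimers g = dimers h \<and>
     (\<forall>e\<in>edges g. ew h (f ` e) = ew g e) \<and>
     (\<forall>v\<in>verts g. vw h (f v) = vw g v))"

definition converges_locally :: "(nat \<Rightarrow> 'v rgraph) \<Rightarrow> 'u rgraph \<Rightarrow> bool" where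
  "converges_locally g h \<longleftrightarrow>
     (\<forall>H. \<exists>N. \<forall>n\<ge>N. graph_iso (graph_ball H (g n)) (graph_ball H h))"


section \<open>Random graphs\<close>

definition graph_space :: "'v rgraph measure" where
  "graph_space = sigma UNIV
     ({{g. v \<in> verts g \<and> vw g v \<in> B} | v B. B \<in> sets borel} \<union>
      {{g. e \<in> edges g \<and> ew g e \<in> B} | e B. B \<in> sets borel} \<union>
      {{g. e \<in> dimers g} | e. True} \<union>
      {{g. root g = v} | v. True})"

definition random_graph :: "'a measure \<Rightarrow> ('a \<Rightarrow> 'v rgraph) \<Rightarrow> bool" where
  "random_graph M R \<longleftrightarrow> R \<in> M \<rightarrow>\<^sub>M graph_space \<and> (\<forall>p\<in>space M. rooted_graph (R p))"

text \<open>
  Joint local convergence, on the probability space \<open>M\<close>, of the pairs \<open>(A n, B n)\<close> to two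
  independent copies of a random rooted graph of law \<open>L\<close>. The maps \<open>A n\<close> and \<open>B n\<close> need not be
  measurable; thus the notion also applies to graphs decorated with an arbitrarily selected
  optimal configuration.
\<close>

definition jointly_converge_to_independent_copies ::
  "'a measure \<Rightarrow> (nat \<Rightarrow> 'a \<Rightarrow> 'v rgraph) \<Rightarrow> (nat \<Rightarrow> 'a \<Rightarrow> 'v rgraph) \<Rightarrow> 'u rgraph measure \<Rightarrow> bool"
  where
  "jointly_converge_to_independent_copies M A B L \<longleftrightarrow>
     (\<exists>S T. random_graph M S \<and> random_graph M T \<and>
        distr M graph_space S = L \<and> distr M graph_space T = L \<and>
        prob_space.indep_var M graph_space S graph_space T \<and>
        (AE p in M. converges_locally (\<lambda>n. A n p) (S p) \<and>
                    converges_locally (\<lambda>n. B n p) (T p)))"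


section \<open>The unimodular Bienayme-Galton-Watson tree\<close>

definition size_biased :: "nat pmf \<Rightarrow> nat pmf" where
  "size_biased \<pi> =
     embed_pmf (\<lambda>k. real (k + 1) * pmf \<pi> (k + 1) / measure_pmf.expectation \<pi> real)"

text \<open>
  The mark \<open>(N, W, X)\<close> of the word \<open>u\<close> gives the number of children of \<open>u\<close>, the weight of the edge
  between \<open>u\<close> and its parent (unused at the root \<open>[]\<close>), and the vertex weight of \<open>u\<close>.
\<close>

definition ubgw_marks ::
  "nat pmf \<Rightarrow> real measure \<Rightarrow> real measure \<Rightarrow> (nat list \<Rightarrow> nat \<times> real \<times> real) measure" where
  "ubgw_marks \<pi> \<omega> \<xi> =
     PiM UNIV (\<lambda>u. measure_pmf (if u = [] then \<pi> else size_biased \<pi>) \<Otimes>\<^sub>M (\<omega> \<Otimes>\<^sub>M \<xi>))"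

text \<open>
  Ulam-Harris labelling: the children of \<open>u\<close> are \<open>u @ [0], \<dots>, u @ [N - 1]\<close>. In an edge, the longer
  word is the child.
\<close>

definition marked_tree :: "(nat list \<Rightarrow> nat \<times> real \<times> real) \<Rightarrow> nat list wgraph" where
  "marked_tree m =
     (let V = {u. \<forall>i<length u. u ! i < fst (m (take i u))} in
      \<lparr>verts = V,
       edges = {{u, u @ [k]} | u k. u @ [k] \<in> V},
       ew = (\<lambda>e. fst (snd (m (arg_max_on length e)))),
       vw = (\<lambda>u. snd (snd (m u)))\<rparr>)"

text \<open>Laws of \<open>(T, w, x, o)\<close> and of \<open>(T, w, x, MD, o)\<close>.\<close>

definition ubgw_law :: "nat pmf \<Rightarrow> real measure \<Rightarrow> real measure \<Rightarrow> nat list rgraph measure" where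
  "ubgw_law \<pi> \<omega> \<xi> =
     distr (ubgw_marks \<pi> \<omega> \<xi>) graph_space (\<lambda>m. rooted (marked_tree m) {} [])"

definition ubgw_MD_law :: "nat pmf \<Rightarrow> real measure \<Rightarrow> real measure \<Rightarrow> nat list rgraph measure" where
  "ubgw_MD_law \<pi> \<omega> \<xi> =
     distr (ubgw_marks \<pi> \<omega> \<xi>) graph_space
       (\<lambda>m. rooted (marked_tree m) (MD (marked_tree m)) [])"


section \<open>Conditions on the weight distributions\<close>

definition msupport :: "real measure \<Rightarrow> real set" where
  "msupport \<mu> = {a. \<forall>U. open U \<and> a \<in> U \<longrightarrow> measure \<mu> U > 0}"

definition atoms :: "real measure \<Rightarrow> real set" where
  "atoms \<mu> = {a. measure \<mu> {a} > 0}"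

definition locally_convex_under_max :: "real set \<Rightarrow> bool" where
  "locally_convex_under_max S \<longleftrightarrow>
     (if bdd_above S then \<exists>\<epsilon>>0. {Sup S - \<epsilon><..<Sup S} \<subseteq> S else \<exists>A. {A<..} \<subseteq> S)"

end

theory Submission
  imports Defs "HOL-Library.Sublist"
begin

text \<open>
  Iterating the message recursion from the vertex weights gives a lower and an upper solution, which
  the recursion exchanges; messages are unique exactly if the two agree. Removing a vertex from an
  optimal configuration of a graph that is a tree near the root, or putting it back, costs or gains
  an amount that the iterates bound, by surgery along an alternating path. Hence, if the two
  solutions agree and no edge is tied, a large enough ball determines the optimal configuration
  near the root.

  The two solutions agree almost surely for the following reason. Use the lower solution on one
  class of the bipartition of the tree and the upper one on the other class. Counting dimers from
  either endpoint shows that the root is matched with the same probability whichever class it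
  belongs to. As one of the two events contains the other, they coincide almost surely, and since
  the weight of the root is independent of its branches, the interval between the two solutions
  almost surely contains no value \<open>w - x\<close> with \<open>w\<close>, \<open>x\<close> in the supports of the weights.
  As \<open>supp \<omega>\<close> is an interval near its supremum and \<open>\<xi>\<close> has a least support point, the recursion
  would move any non-empty such interval until it contained one.
\<close>

section \<open>Recursions of maximum-minus type\<close>

text \<open>The balance of the two solutions is a size-biasing identity. Given the root weight
  \<open>x\<close> and \<open>n + 1\<close> children, the root is matched when the largest of
  \<open>n + 1\<close> independent gains exceeds \<open>x\<close>. Decomposing by that largest gain
  leaves \<open>n\<close> other children and a factor \<open>n + 1\<close>, which the size-biased
  law absorbs: the probability becomes the mean of \<pi> times the probability of
  \<open>w > Z + Z'\<close>, where \<open>Z\<close> and \<open>Z' = step Z\<close> are messages from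
  the two ends of one edge. As \<open>step\<close> exchanges the two solutions,
  \<open>Z = lo\<close> and \<open>Z = hi\<close> differ only by swapping the ends.

  On the probabilistic side the obstacle is that the two limits are known only in law, while nothing
  is known about measurability of the optimal configurations. Statements about the latter are
  therefore made outcome by outcome, and probability enters only through almost sure properties of a
  single tree. The limiting configuration is rebuilt from marks read off the limit graph, a
  measurable operation, so independence passes to the decorated limits.\<close>

lemma Max_insert_image_le_iff:
  fixes f :: "'j \<Rightarrow> real"
  assumes "finite A"
  shows "Max (insert c (f ` A)) \<le> t \<longleftrightarrow> c \<le> t \<and> (\<forall>j\<in>A. f j \<le> t)"
  using assms by (subst Max_le_iff) auto

lemma tendsto_Max_insert_image:
  fixes f :: "nat \<Rightarrow> 'j \<Rightarrow> real"
  assumes "finite A" "\<And>j. j \<in> A \<Longrightarrow> (\<lambda>n. f n j) \<longlonglongrightarrow> g j"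
  shows "(\<lambda>n. Max (insert c (f n ` A))) \<longlonglongrightarrow> Max (insert c (g ` A))"
  using assms
proof (induction A rule: finite_induct)
  case empty
  then show ?case by simp
next
  case (insert a A)
  have eq: "Max (insert c (h ` insert a A)) = max (h a) (Max (insert c (h ` A)))"
    for h :: "'j \<Rightarrow> real"
    using insert.hyps by (simp add: insert_commute[of c])
  show ?case
    unfolding eq using insert by (intro tendsto_max) auto
qed

text \<open>Abstract in the index type because the recursion is instantiated twice: over the darts
  of a tree, where messages live, and over the mark families of subtrees, where their law can be
  computed.\<close>

locale max_minus =
  fixes c :: "'i \<Rightarrow> real" and w :: "'i \<Rightarrow> real" and A :: "'i \<Rightarrow> 'i set"
  assumes fin: "finite (A i)"
begin

definition step :: "('i \<Rightarrow> real) \<Rightarrow> 'i \<Rightarrow> real" where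
  "step Z i = Max (insert (c i) ((\<lambda>j. w j - Z j) ` A i))"

text \<open>Starting from \<open>c\<close> amounts to cutting the recursion at depth
  \<open>n\<close>, where every index keeps its base value.\<close>

definition iter :: "nat \<Rightarrow> 'i \<Rightarrow> real" where
  "iter n = (step ^^ n) c"

definition lo :: "'i \<Rightarrow> real" where
  "lo i = lim (\<lambda>n. iter (2 * n) i)"

definition hi :: "'i \<Rightarrow> real" where
  "hi i = lim (\<lambda>n. iter (Suc (2 * n)) i)"

lemma iter_0 [simp]: "iter 0 = c"
  by (simp add: iter_def)

lemma iter_Suc [simp]: "iter (Suc n) = step (iter n)"
  by (simp add: iter_def)

lemma step_ge_base: "c i \<le> step Z i"
  using fin[of i] by (simp add: step_def)

lemma step_ge: "j \<in> A i \<Longrightarrow> w j - Z j \<le> step Z i"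
  using fin[of i] by (simp add: step_def)

lemma step_le_iff: "step Z i \<le> t \<longleftrightarrow> c i \<le> t \<and> (\<forall>j\<in>A i. w j - Z j \<le> t)"
  unfolding step_def by (rule Max_insert_image_le_iff[OF fin])

lemma step_less_iff: "step Z i < t \<longleftrightarrow> c i < t \<and> (\<forall>j\<in>A i. w j - Z j < t)"
  unfolding step_def using fin[of i] by (subst Max_less_iff) auto

lemma step_cases: "step Z i = c i \<or> (\<exists>j\<in>A i. step Z i = w j - Z j)"
proof -
  have "step Z i \<in> insert (c i) ((\<lambda>j. w j - Z j) ` A i)"
    unfolding step_def using fin[of i] by (intro Max_in) auto
  then show ?thesis by auto
qed

lemma step_antimono: "(\<And>j. j \<in> A i \<Longrightarrow> Y j \<le> Z j) \<Longrightarrow> step Z i \<le> step Y i"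
  unfolding step_le_iff using step_ge_base[of i Y] step_ge[of _ i Y] by force

lemma step_cong: "(\<And>j. j \<in> A i \<Longrightarrow> Y j = Z j) \<Longrightarrow> step Y i = step Z i"
  by (auto simp: step_def intro!: arg_cong[where f = Max] image_cong)

lemma tendsto_step:
  "(\<And>j. j \<in> A i \<Longrightarrow> (\<lambda>n. Y n j) \<longlonglongrightarrow> Z j) \<Longrightarrow> (\<lambda>n. step (Y n) i) \<longlonglongrightarrow> step Z i"
  unfolding step_def
  by (intro tendsto_Max_insert_image fin tendsto_diff tendsto_const)

lemma base_le_iter: "c i \<le> iter n i"
  by (cases n) (auto simp: step_ge_base)

text \<open>The base \<open>c\<close> lies below every iterate, and each application of the antitone
  \<open>step\<close> reverses an inequality; hence even iterates lie below all later ones and odd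
  iterates above.\<close>

lemma iter_mono:
  "(even n \<longrightarrow> iter n i \<le> iter (n + k) i) \<and> (odd n \<longrightarrow> iter (n + k) i \<le> iter n i)"
  by (induction n arbitrary: i) (auto simp: base_le_iter intro!: step_antimono)

lemma incseq_iter: "incseq (\<lambda>n. iter (2 * n) i)"
  using iter_mono[of "2 * n" i 2 for n]
  by (intro incseq_SucI) simp

lemma decseq_iter: "decseq (\<lambda>n. iter (Suc (2 * n)) i)"
proof (intro decseq_SucI)
  fix n
  show "iter (Suc (2 * Suc n)) i \<le> iter (Suc (2 * n)) i"
    using iter_mono[of "Suc (2 * n)" i 2] by simp
qed

lemma iter_le_iter_1: "iter n i \<le> iter (Suc 0) i"
proof (cases n)
  case 0
  then show ?thesis by (simp add: step_ge_base)
next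
  case (Suc m)
  then show ?thesis using iter_mono[of "Suc 0" i m] by simp
qed

lemma tendsto_lo: "(\<lambda>n. iter (2 * n) i) \<longlonglongrightarrow> lo i"
proof -
  obtain L where "(\<lambda>n. iter (2 * n) i) \<longlonglongrightarrow> L"
    using incseq_convergent[OF incseq_iter[of i], of "iter (Suc 0) i"] iter_le_iter_1 by metis
  then show ?thesis by (simp add: lo_def limI)
qed

lemma tendsto_hi: "(\<lambda>n. iter (Suc (2 * n)) i) \<longlonglongrightarrow> hi i"
proof -
  obtain L where "(\<lambda>n. iter (Suc (2 * n)) i) \<longlonglongrightarrow> L"
    using decseq_convergent[OF decseq_iter[of i], of "c i"] base_le_iter by metis
  then show ?thesis by (simp add: hi_def limI)
qed

text \<open>A maximum over a finite set is continuous, so \<open>step\<close> maps the limit of the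
  even iterates to that of the odd ones.\<close>

lemma step_lo: "step lo i = hi i"
proof -
  have "(\<lambda>n. step (iter (2 * n)) i) \<longlonglongrightarrow> step lo i"
    by (intro tendsto_step tendsto_lo)
  with tendsto_hi[of i] show ?thesis
    unfolding iter_Suc by (rule LIMSEQ_unique[rotated])
qed

lemma step_hi: "step hi i = lo i"
proof -
  have "(\<lambda>n. step (iter (Suc (2 * n))) i) \<longlonglongrightarrow> step hi i"
    by (intro tendsto_step tendsto_hi)
  moreover have "(\<lambda>n. iter (2 * Suc n) i) \<longlonglongrightarrow> lo i"
    by (rule LIMSEQ_Suc[OF tendsto_lo])
  ultimately show ?thesis
    unfolding mult_Suc_right add_2_eq_Suc iter_Suc by (rule LIMSEQ_unique)
qed

lemma lo_le_hi: "lo i \<le> hi i"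
proof (rule LIMSEQ_le[OF tendsto_lo tendsto_hi], intro exI allI impI)
  show "iter (2 * n) i \<le> iter (Suc (2 * n)) i" for n
    using iter_mono[of "2 * n" i 1] by simp
qed

lemma base_le_lo: "c i \<le> lo i"
  by (subst step_hi[symmetric]) (rule step_ge_base)

text \<open>A solution lies above \<open>c\<close>; applying \<open>step\<close> repeatedly to this
  bound traps it between even and odd iterates. A successor-closed \<open>J\<close> is allowed
  because messages obey the recursion on darts only.\<close>

lemma between_lo_hi:
  assumes "\<And>i. i \<in> J \<Longrightarrow> Z i = step Z i" "\<And>i. i \<in> J \<Longrightarrow> A i \<subseteq> J" "i \<in> J"
  shows "lo i \<le> Z i" "Z i \<le> hi i"
proof -
  have *: "\<forall>i\<in>J. (even n \<longrightarrow> iter n i \<le> Z i) \<and> (odd n \<longrightarrow> Z i \<le> iter n i)" for n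
  proof (induction n)
    case 0
    have "c i \<le> Z i" if "i \<in> J" for i
      by (subst assms(1)[OF that]) (rule step_ge_base)
    then show ?case by simp
  next
    case (Suc n)
    show ?case
    proof (intro ballI)
      fix i assume i: "i \<in> J"
      have "odd n \<Longrightarrow> step (iter n) i \<le> step Z i" "even n \<Longrightarrow> step Z i \<le> step (iter n) i"
        using Suc assms(2)[OF i] by (auto intro!: step_antimono)
      then show "(even (Suc n) \<longrightarrow> iter (Suc n) i \<le> Z i) \<and> (odd (Suc n) \<longrightarrow> Z i \<le> iter (Suc n) i)"
        using assms(1)[OF i] by simp
    qed
  qed
  show "lo i \<le> Z i"
    by (rule LIMSEQ_le_const2[OF tendsto_lo]) (use *[of "2 * n" for n] assms(3) in auto)
  show "Z i \<le> hi i"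
    by (rule LIMSEQ_le_const[OF tendsto_hi]) (use *[of "Suc (2 * n)" for n] assms(3) in fastforce)
qed

end

text \<open>\<open>\<phi>\<close> need not be injective on successors: the maximum does not see multiplicities.\<close>

lemma max_minus_iter_transfer:
  assumes "max_minus A" "max_minus A'"
    and c: "\<And>i. i \<in> J \<Longrightarrow> c' (\<phi> i) = c i"
    and w: "\<And>i j. i \<in> J \<Longrightarrow> j \<in> A i \<Longrightarrow> w' (\<phi> j) = w j"
    and A: "\<And>i. i \<in> J \<Longrightarrow> A' (\<phi> i) = \<phi> ` A i"
    and J: "\<And>i. i \<in> J \<Longrightarrow> A i \<subseteq> J"
    and "i \<in> J"
  shows "max_minus.iter c' w' A' n (\<phi> i) = max_minus.iter c w A n i"
proof -
  interpret X: max_minus c w A by fact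
  interpret Y: max_minus c' w' A' by fact
  show ?thesis
    using \<open>i \<in> J\<close>
  proof (induction n arbitrary: i)
    case 0
    then show ?case by (simp add: c)
  next
    case (Suc n)
    have "(\<lambda>j. w' j - Y.iter n j) ` A' (\<phi> i) = (\<lambda>j. w j - X.iter n j) ` A i"
      unfolding A[OF Suc.prems] image_image
      using J[OF Suc.prems] by (intro image_cong) (auto simp: w[OF Suc.prems] Suc.IH)
    then show ?case
      by (simp add: X.step_def Y.step_def c[OF Suc.prems])
  qed
qed

section \<open>The marked tree and its darts\<close>

lemma Nil_in_tree [simp]: "[] \<in> verts (marked_tree m)"
  by (simp add: marked_tree_def)

lemma snoc_in_tree [simp]:
  "u @ [k] \<in> verts (marked_tree m) \<longleftrightarrow> u \<in> verts (marked_tree m) \<and> k < fst (m u)"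
proof -
  have "(\<forall>i<length (u @ [k]). (u @ [k]) ! i < fst (m (take i (u @ [k])))) \<longleftrightarrow>
     (\<forall>i<length u. u ! i < fst (m (take i u))) \<and> k < fst (m u)"
    by (auto simp: less_Suc_eq nth_append)
  then show ?thesis by (simp add: marked_tree_def)
qed

lemma vw_tree [simp]: "vw (marked_tree m) u = snd (snd (m u))"
  by (simp add: marked_tree_def)

lemma edges_tree: "edges (marked_tree m) = {{u, u @ [k]} | u k. u @ [k] \<in> verts (marked_tree m)}"
  by (simp add: marked_tree_def Let_def)

lemma ew_tree: "ew (marked_tree m) {u, u @ [k]} = fst (snd (m (u @ [k])))"
proof -
  have "arg_max_on length {u, u @ [k]} = u @ [k]"
    unfolding arg_max_on_def arg_max_def
    by (rule some_equality) (auto simp: is_arg_max_def)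
  then show ?thesis by (simp add: marked_tree_def)
qed

lemma ew_tree' [simp]:
  "ew (marked_tree m) {u, u @ [k]} = fst (snd (m (u @ [k])))"
  "ew (marked_tree m) {u @ [k], u} = fst (snd (m (u @ [k])))"
  using ew_tree by (simp_all add: insert_commute)

lemma darts_sym: "(u, v) \<in> darts G \<longleftrightarrow> (v, u) \<in> darts G"
  by (simp add: darts_def insert_commute)

lemma darts_tree: "(a, b) \<in> darts (marked_tree m) \<longleftrightarrow>
   (\<exists>k. b = a @ [k] \<and> b \<in> verts (marked_tree m)) \<or> (\<exists>k. a = b @ [k] \<and> a \<in> verts (marked_tree m))"
proof
  assume "(a, b) \<in> darts (marked_tree m)"
  then obtain u k where "{a, b} = {u, u @ [k]}" "u @ [k] \<in> verts (marked_tree m)"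
    unfolding darts_def edges_tree by blast
  then show "(\<exists>k. b = a @ [k] \<and> b \<in> verts (marked_tree m)) \<or>
      (\<exists>k. a = b @ [k] \<and> a \<in> verts (marked_tree m))"
    unfolding doubleton_eq_iff by blast
next
  assume "(\<exists>k. b = a @ [k] \<and> b \<in> verts (marked_tree m)) \<or>
      (\<exists>k. a = b @ [k] \<and> a \<in> verts (marked_tree m))"
  then show "(a, b) \<in> darts (marked_tree m)"
    unfolding darts_def edges_tree by (auto simp del: snoc_in_tree simp: insert_commute)
qed

lemma dart_snoc [simp]:
  "(u, u @ [k]) \<in> darts (marked_tree m) \<longleftrightarrow> u \<in> verts (marked_tree m) \<and> k < fst (m u)"
  "(u @ [k], u) \<in> darts (marked_tree m) \<longleftrightarrow> u \<in> verts (marked_tree m) \<and> k < fst (m u)"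
  by (auto simp: darts_tree)

lemma dart_cases:
  assumes "(a, b) \<in> darts (marked_tree m)"
  obtains (down) k where "b = a @ [k]" "a \<in> verts (marked_tree m)" "k < fst (m a)"
    | (up) k where "a = b @ [k]" "b \<in> verts (marked_tree m)" "k < fst (m b)"
  using assms by (auto simp: darts_tree)

lemma dart_verts:
  "(a, b) \<in> darts (marked_tree m) \<Longrightarrow> a \<in> verts (marked_tree m) \<and> b \<in> verts (marked_tree m)"
  by (auto elim!: dart_cases)

lemma finite_nbrs_tree: "finite {v. (u, v) \<in> darts (marked_tree m)}"
proof (rule finite_subset)
  show "{v. (u, v) \<in> darts (marked_tree m)} \<subseteq> insert (butlast u) ((\<lambda>k. u @ [k]) ` {..<fst (m u)})"
    by (auto simp: darts_tree)
qed auto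

lemma locally_finite_tree: "locally_finite_graph (marked_tree m)"
  unfolding locally_finite_graph_def
proof (intro conjI ballI)
  fix e assume "e \<in> edges (marked_tree m)"
  then show "\<exists>u\<in>verts (marked_tree m). \<exists>v\<in>verts (marked_tree m). u \<noteq> v \<and> e = {u, v}"
  proof -
    obtain u k where "e = {u, u @ [k]}" "u @ [k] \<in> verts (marked_tree m)"
      using \<open>e \<in> edges (marked_tree m)\<close> by (auto simp: edges_tree)
    moreover from this have "u \<in> verts (marked_tree m)" by simp
    ultimately show ?thesis by (metis not_Cons_self2 self_append_conv)
  qed
next
  fix v assume "v \<in> verts (marked_tree m)"
  have "{e \<in> edges (marked_tree m). v \<in> e} \<subseteq> (\<lambda>u. {v, u}) ` {u. (v, u) \<in> darts (marked_tree m)}"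
  proof
    fix e assume "e \<in> {e \<in> edges (marked_tree m). v \<in> e}"
    then obtain a b where e: "e = {a, b}" "{a, b} \<in> edges (marked_tree m)" "v = a \<or> v = b"
      by (auto simp: edges_tree)
    then have "(v, if v = a then b else a) \<in> darts (marked_tree m)" "e = {v, if v = a then b else a}"
      by (auto simp: darts_def insert_commute)
    then show "e \<in> (\<lambda>u. {v, u}) ` {u. (v, u) \<in> darts (marked_tree m)}"
      by blast
  qed
  then show "finite {e \<in> edges (marked_tree m). v \<in> e}"
    by (rule finite_surj[OF finite_nbrs_tree])
qed

section \<open>The message recursion on darts and the uniqueness of its solution\<close>

definition dart_succ :: "('v, 'm) wgraph_scheme \<Rightarrow> 'v \<times> 'v \<Rightarrow> ('v \<times> 'v) set" where
  "dart_succ G = (\<lambda>(u, v). {(v, u') | u'. (v, u') \<in> darts G \<and> u' \<noteq> u})"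

definition dart_base :: "('v, 'm) wgraph_scheme \<Rightarrow> 'v \<times> 'v \<Rightarrow> real" where
  "dart_base G = (\<lambda>(u, v). vw G v)"

definition dart_weight :: "('v, 'm) wgraph_scheme \<Rightarrow> 'v \<times> 'v \<Rightarrow> real" where
  "dart_weight G = (\<lambda>(u, v). ew G {u, v})"

lemma dart_base_simp [simp]: "dart_base G (u, v) = vw G v"
  by (simp add: dart_base_def)

lemma dart_weight_simp [simp]: "dart_weight G (u, v) = ew G {u, v}"
  by (simp add: dart_weight_def)

interpretation tree: max_minus "dart_base (marked_tree m)" "dart_weight (marked_tree m)"
    "dart_succ (marked_tree m)" for m
proof
  fix d :: "nat list \<times> nat list"
  have "dart_succ (marked_tree m) d \<subseteq> Pair (snd d) ` {v. (snd d, v) \<in> darts (marked_tree m)}"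
    by (auto simp: dart_succ_def split: prod.splits)
  then show "finite (dart_succ (marked_tree m) d)"
    using finite_nbrs_tree finite_surj by blast
qed

lemma messages_tree_iff:
  "messages (marked_tree m) Z \<longleftrightarrow> Z \<in> extensional (darts (marked_tree m)) \<and>
     (\<forall>d\<in>darts (marked_tree m). Z d = tree.step m Z d)"
proof -
  have "(\<lambda>j. dart_weight (marked_tree m) j - Z j) ` dart_succ (marked_tree m) (u, v) =
    {ew (marked_tree m) {v, u'} - Z (v, u') | u'. (v, u') \<in> darts (marked_tree m) \<and> u' \<noteq> u}" for u v
    by (force simp: dart_succ_def)
  then have "tree.step m Z (u, v) = Max (insert (vw (marked_tree m) v)
    {ew (marked_tree m) {v, u'} - Z (v, u') | u'. (v, u') \<in> darts (marked_tree m) \<and> u' \<noteq> u})" for u v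
    by (simp add: tree.step_def)
  then show ?thesis
    unfolding messages_def by (auto simp del: vw_tree split: prod.splits)
qed

lemma in_dart_succ: "j \<in> dart_succ G (u, v) \<longleftrightarrow> fst j = v \<and> j \<in> darts G \<and> snd j \<noteq> u"
  by (cases j) (auto simp: dart_succ_def)

lemma dart_succ_subset: "dart_succ G d \<subseteq> darts G"
  by (auto simp: dart_succ_def split: prod.splits)

definition rigid :: "(nat list \<Rightarrow> nat \<times> real \<times> real) \<Rightarrow> bool" where
  "rigid m \<longleftrightarrow> (\<forall>d\<in>darts (marked_tree m). tree.lo m d = tree.hi m d)"

text \<open>Every family of messages is squeezed between \<open>lo\<close> and \<open>hi\<close>.
  Conversely \<open>step lo = hi\<close>, so equality of the two makes \<open>lo\<close> itself a
  solution.\<close>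

lemma rigid_messages:
  assumes "rigid m"
  shows "messages (marked_tree m) Z \<longleftrightarrow> Z = restrict (tree.lo m) (darts (marked_tree m))"
proof
  assume "messages (marked_tree m) Z"
  then have Z: "Z \<in> extensional (darts (marked_tree m))"
    "\<And>d. d \<in> darts (marked_tree m) \<Longrightarrow> Z d = tree.step m Z d"
    by (auto simp: messages_tree_iff)
  have "Z d = tree.lo m d" if "d \<in> darts (marked_tree m)" for d
    using tree.between_lo_hi[of "darts (marked_tree m)" Z m d, OF Z(2) dart_succ_subset that] assms that
    by (simp add: rigid_def)
  then show "Z = restrict (tree.lo m) (darts (marked_tree m))"
    using Z(1) by (auto simp: restrict_def extensional_def fun_eq_iff)
next
  assume Z: "Z = restrict (tree.lo m) (darts (marked_tree m))"
  have "Z d = tree.step m Z d" if d: "d \<in> darts (marked_tree m)" for d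
  proof -
    have "tree.step m Z d = tree.step m (tree.lo m) d"
      using dart_succ_subset[of "marked_tree m" d] by (intro tree.step_cong) (auto simp: Z)
    then show ?thesis
      using assms d by (simp add: Z tree.step_lo rigid_def)
  qed
  then show "messages (marked_tree m) Z"
    by (simp add: messages_tree_iff) (simp add: Z)
qed

text \<open>
  Taking the lower solution on the darts towards one class of the bipartition and the upper
  solution on the others yields a family of messages, and so does the opposite choice.
\<close>

lemma ex1_messages_iff_rigid: "(\<exists>!Z. messages (marked_tree m) Z) \<longleftrightarrow> rigid m"
proof
  assume "rigid m"
  then show "\<exists>!Z. messages (marked_tree m) Z" by (simp add: rigid_messages)
next
  assume ex1: "\<exists>!Z. messages (marked_tree m) Z"
  define Y where "Y P = restrict (\<lambda>d. if P (length (snd d)) then tree.lo m d else tree.hi m d)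
    (darts (marked_tree m))" for P :: "nat \<Rightarrow> bool"
  have Y: "messages (marked_tree m) (Y P)" if P: "\<And>n. P (Suc n) \<longleftrightarrow> \<not> P n" for P
  proof -
    have "Y P d = tree.step m (Y P) d" if d: "d \<in> darts (marked_tree m)" for d
    proof -
      have "tree.step m (Y P) d = tree.step m (if P (length (snd d)) then tree.hi m else tree.lo m) d"
      proof (intro tree.step_cong)
        fix j assume j: "j \<in> dart_succ (marked_tree m) d"
        then have jd: "j \<in> darts (marked_tree m)" using dart_succ_subset by blast
        obtain v u where [simp]: "j = (v, u)" "snd d = v"
          using j by (auto simp: dart_succ_def split: prod.splits)
        \<comment> \<open>A successor dart ends in the other class of the bipartition, so the choice
          between \<open>lo\<close> and \<open>hi\<close> flips, as \<open>step_lo\<close> and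
          \<open>step_hi\<close> demand.\<close>
        have "length u = Suc (length v) \<or> length v = Suc (length u)"
          using jd by (auto simp: darts_tree)
        then have "P (length u) \<longleftrightarrow> \<not> P (length v)"
          by (auto simp: P)
        then show "Y P j = (if P (length (snd d)) then tree.hi m else tree.lo m) j"
          using jd by (simp add: Y_def)
      qed
      then show ?thesis
        using d by (simp add: Y_def tree.step_lo tree.step_hi)
    qed
    then show ?thesis by (simp add: messages_tree_iff) (simp add: Y_def)
  qed
  have eq: "Y even = Y odd"
    using ex1 Y[of even] Y[of odd] by auto
  show "rigid m"
    unfolding rigid_def
  proof (intro ballI)
    fix d assume "d \<in> darts (marked_tree m)"
    then show "tree.lo m d = tree.hi m d"
      using fun_cong[OF eq, of d] by (auto simp: Y_def split: if_splits)
  qed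
qed

lemma MD_tree: "MD (marked_tree m) =
   (if rigid m then {{u, v} | u v. (u, v) \<in> darts (marked_tree m) \<and>
      tree.lo m (u, v) + tree.lo m (v, u) < ew (marked_tree m) {u, v}} else {})"
proof (cases "rigid m")
  case True
  have the: "(THE Z. messages (marked_tree m) Z) = restrict (tree.lo m) (darts (marked_tree m))"
    by (rule the_equality) (simp_all add: rigid_messages[OF True])
  show ?thesis
    using True darts_sym[of _ _ "marked_tree m"]
    by (auto simp: MD_def ex1_messages_iff_rigid the Let_def)
qed (simp add: MD_def ex1_messages_iff_rigid)

lemma pair_in_MD_tree: "{u, v} \<in> MD (marked_tree m) \<longleftrightarrow> rigid m \<and> (u, v) \<in> darts (marked_tree m) \<and>
      tree.lo m (u, v) + tree.lo m (v, u) < ew (marked_tree m) {u, v}"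
proof -
  have "ew (marked_tree m) {u, v} = ew (marked_tree m) {v, u}"
    by (simp add: insert_commute)
  then show ?thesis
    using darts_sym[of u v "marked_tree m"]
    unfolding MD_tree by (cases "rigid m") (fastforce simp: doubleton_eq_iff add.commute)+
qed

text \<open>Two dimers at \<open>v\<close>, towards \<open>a\<close> and \<open>b\<close>, would
  give \<open>lo (b, v) < lo (a, v)\<close> as well as the reverse: the gain from either edge is
  bounded by the message towards \<open>v\<close> along the other.\<close>

lemma monomer_dimer_MD_tree: "monomer_dimer (marked_tree m) (MD (marked_tree m))"
  unfolding monomer_dimer_def
proof (intro conjI ballI impI)
  show "MD (marked_tree m) \<subseteq> edges (marked_tree m)"
    by (auto simp: MD_tree darts_def)
next
  fix v e e' assume v: "v \<in> verts (marked_tree m)"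
    and e: "e \<in> MD (marked_tree m)" and e': "e' \<in> MD (marked_tree m)" and "v \<in> e \<and> v \<in> e'"
  have *: "\<exists>u. e = {v, u}" if "e \<in> MD (marked_tree m)" "v \<in> e" for e
  proof -
    from that obtain a b where "e = {a, b}" by (auto simp: MD_tree split: if_splits)
    then show ?thesis using that(2) by auto
  qed
  obtain u u' where u: "e = {v, u}" "e' = {v, u'}"
    using * e e' \<open>v \<in> e \<and> v \<in> e'\<close> by meson
  have le: "ew (marked_tree m) {v, b} - tree.lo m (v, b) \<le> tree.lo m (a, v)"
    if "rigid m" "(v, a) \<in> darts (marked_tree m)" "(v, b) \<in> darts (marked_tree m)" "a \<noteq> b" for a b
  proof -
    have "(v, b) \<in> dart_succ (marked_tree m) (a, v)"
      using that by (auto simp: dart_succ_def)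
    from tree.step_ge[OF this, of "tree.lo m"] show ?thesis
      using that by (simp add: tree.step_lo rigid_def darts_sym[of v a])
  qed
  show "e = e'"
  proof (rule ccontr)
    assume "e \<noteq> e'"
    then have "u \<noteq> u'" by (auto simp: u)
    then show False
      using e e' le[of u u'] le[of u' u] unfolding u pair_in_MD_tree by force
  qed
qed

section \<open>Configurations with holes\<close>

text \<open>
  Vertices in the set \<open>U\<close> of holes are treated as absent: no dimer touches them and their
  vertex weights are not counted.
\<close>

definition holed_md :: "('v, 'm) wgraph_scheme \<Rightarrow> 'v set \<Rightarrow> 'v set set \<Rightarrow> 'v set \<Rightarrow> bool" where
  "holed_md G B E U \<longleftrightarrow> E \<subseteq> edges G \<and> (\<forall>e\<in>E. e \<subseteq> B - U) \<and>
     (\<forall>e\<in>E. \<forall>e'\<in>E. e \<inter> e' \<noteq> {} \<longrightarrow> e = e')"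

definition holed_weight :: "('v, 'm) wgraph_scheme \<Rightarrow> 'v set \<Rightarrow> 'v set set \<Rightarrow> 'v set \<Rightarrow> real" where
  "holed_weight G B E U = (\<Sum>e\<in>E. ew G e) + (\<Sum>v\<in>B - U - \<Union>E. vw G v)"

lemma holed_md_finite: "finite B \<Longrightarrow> holed_md G B E U \<Longrightarrow> finite E"
  by (rule finite_subset[of E "Pow B"]) (auto simp: holed_md_def)

lemma holed_add_edge:
  assumes "finite B" "holed_md G B E (insert a (insert b U))" "{a, b} \<in> edges G"
    "a \<in> B" "b \<in> B" "a \<notin> U" "b \<notin> U"
  shows "holed_md G B (insert {a, b} E) U"
    "holed_weight G B (insert {a, b} E) U = holed_weight G B E (insert a (insert b U)) + ew G {a, b}"
proof -
  show "holed_md G B (insert {a, b} E) U"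
    using assms(2-) unfolding holed_md_def by (simp add: subset_eq) fast
  have "{a, b} \<notin> E"
    using assms(2) by (auto simp: holed_md_def)
  moreover have "B - U - \<Union>(insert {a, b} E) = B - insert a (insert b U) - \<Union>E"
    by auto
  ultimately show "holed_weight G B (insert {a, b} E) U =
      holed_weight G B E (insert a (insert b U)) + ew G {a, b}"
    using holed_md_finite[OF assms(1,2)] by (simp add: holed_weight_def)
qed

lemma holed_remove_edge:
  assumes "finite B" "holed_md G B E U" "{a, b} \<in> E"
  shows "holed_md G B (E - {{a, b}}) (insert a (insert b U))"
    "holed_weight G B (E - {{a, b}}) (insert a (insert b U)) = holed_weight G B E U - ew G {a, b}"
proof -
  show *: "holed_md G B (E - {{a, b}}) (insert a (insert b U))"
    unfolding holed_md_def
  proof (intro conjI ballI)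
    fix e assume e: "e \<in> E - {{a, b}}"
    then have "e \<inter> {a, b} \<noteq> {} \<longrightarrow> e = {a, b}"
      using assms(2,3) unfolding holed_md_def by (metis DiffD1)
    then have "e \<inter> {a, b} = {}"
      using e by blast
    then show "e \<subseteq> B - insert a (insert b U)"
      using assms(2) e unfolding holed_md_def by blast
  qed (use assms(2) in \<open>auto simp: holed_md_def\<close>)
  have "{a, b} \<in> edges G" "a \<in> B" "b \<in> B" "a \<notin> U" "b \<notin> U"
    using assms(2,3) by (auto simp: holed_md_def)
  from holed_add_edge(2)[OF assms(1) * this] assms(3)
  show "holed_weight G B (E - {{a, b}}) (insert a (insert b U)) = holed_weight G B E U - ew G {a, b}"
    by (simp add: insert_absorb)
qed

lemma holed_monomer:
  assumes "finite B" "v \<in> B" "v \<notin> U" "v \<notin> \<Union>E"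
  shows "holed_md G B E (insert v U) \<longleftrightarrow> holed_md G B E U"
    "holed_weight G B E U = holed_weight G B E (insert v U) + vw G v"
proof -
  show "holed_md G B E (insert v U) \<longleftrightarrow> holed_md G B E U"
    using assms(4) by (auto simp: holed_md_def)
  have "B - U - \<Union>E = insert v (B - insert v U - \<Union>E)"
    using assms by auto
  then show "holed_weight G B E U = holed_weight G B E (insert v U) + vw G v"
    using assms(1) by (simp add: holed_weight_def)
qed

section \<open>Alternating surgery in the marked tree\<close>

text \<open>The component of \<open>v\<close> once the edge between \<open>u\<close> and
  \<open>v\<close> is cut, described through prefixes. It ranges over all words, so no membership in
  the tree has to be carried along.\<close>

definition branch :: "nat list \<Rightarrow> nat list \<Rightarrow> nat list set" where
  "branch u v = (if length u < length v then {w. prefix v w} else {w. \<not> prefix u w})"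

lemma branch_snoc [simp]:
  "branch u (u @ [k]) = {w. prefix (u @ [k]) w}" "branch (u @ [k]) u = {w. \<not> prefix (u @ [k]) w}"
  by (auto simp: branch_def)

lemma branch_ends:
  assumes "(u, v) \<in> darts (marked_tree m)"
  shows "v \<in> branch u v" "u \<notin> branch u v" "branch u v \<inter> branch v u = {}"
  using assms by (auto elim!: dart_cases)

text \<open>This nesting confines all later changes along an alternating path to the part of the
  tree behind the dart.\<close>

lemma branch_succ:
  assumes "(u, v) \<in> darts (marked_tree m)" "(v, u') \<in> darts (marked_tree m)" "u' \<noteq> u"
  shows "branch v u' \<subseteq> branch u v"
proof
  fix w assume w: "w \<in> branch v u'"
  from assms(1) show "w \<in> branch u v"
  proof (cases rule: dart_cases)
    case (down k)
    with assms(2,3) obtain j where "u' = v @ [j]"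
      by (auto simp: darts_tree)
    with w have "prefix (v @ [j]) w" by simp
    then have "prefix v w" by (rule append_prefixD)
    with down show ?thesis by simp
  next
    case (up k)
    from assms(2) show ?thesis
    proof (cases rule: dart_cases)
      case (down j)
      have "\<not> prefix (v @ [k]) w" if "prefix (v @ [j]) w" "j \<noteq> k"
        using that by (auto simp: prefix_def)
      then show ?thesis
        using w up down assms(3) by auto
    next
      case (up j)
      with w have "\<not> prefix v w" by simp
      then have "\<not> prefix (v @ [k]) w" using append_prefixD by blast
      with \<open>u = v @ [k]\<close> show ?thesis by simp
    qed
  qed
qed

definition tree_ball :: "(nat list \<Rightarrow> nat \<times> real \<times> real) \<Rightarrow> nat \<Rightarrow> nat list set" where
  "tree_ball m L = {v \<in> verts (marked_tree m). length v \<le> L}"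

lemma finite_tree_ball: "finite (tree_ball m L)"
proof (induction L)
  case 0
  have "tree_ball m 0 \<subseteq> {[]}" by (auto simp: tree_ball_def)
  then show ?case by (rule finite_subset) auto
next
  case (Suc L)
  have "tree_ball m (Suc L) \<subseteq> insert [] (\<Union>u\<in>tree_ball m L. (\<lambda>k. u @ [k]) ` {..<fst (m u)})"
  proof
    fix v assume "v \<in> tree_ball m (Suc L)"
    then show "v \<in> insert [] (\<Union>u\<in>tree_ball m L. (\<lambda>k. u @ [k]) ` {..<fst (m u)})"
      by (cases v rule: rev_cases) (auto simp: tree_ball_def)
  qed
  then show ?case
    by (rule finite_subset) (use Suc in auto)
qed

text \<open>
  \<open>fillable\<close>: an absent vertex can be put back with a gain of at least the \<open>n\<close>-th iterate;
  \<open>freeable\<close>: a vertex not matched backwards can be removed at a cost of at most the \<open>n\<close>-th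
  iterate. In both cases nothing changes outside the branch the dart points to.
\<close>

definition fillable ::
  "(nat list \<Rightarrow> nat \<times> real \<times> real) \<Rightarrow> nat \<Rightarrow> nat \<Rightarrow> nat list \<Rightarrow> nat list \<Rightarrow> bool" where
  "fillable m L n u v \<longleftrightarrow> (\<forall>E U. length v + n < L \<longrightarrow>
     holed_md (marked_tree m) (tree_ball m L) E U \<longrightarrow>
     v \<in> U \<longrightarrow> (\<forall>x\<in>U \<inter> branch u v. length x < L \<longrightarrow> x = v) \<longrightarrow>
     (\<exists>E'. holed_md (marked_tree m) (tree_ball m L) E' (U - {v}) \<and>
       (\<forall>e. \<not> e \<subseteq> branch u v \<longrightarrow> (e \<in> E' \<longleftrightarrow> e \<in> E)) \<and>
       holed_weight (marked_tree m) (tree_ball m L) E U + tree.iter m n (u, v)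
         \<le> holed_weight (marked_tree m) (tree_ball m L) E' (U - {v})))"

definition freeable ::
  "(nat list \<Rightarrow> nat \<times> real \<times> real) \<Rightarrow> nat \<Rightarrow> nat \<Rightarrow> nat list \<Rightarrow> nat list \<Rightarrow> bool" where
  "freeable m L n u v \<longleftrightarrow> (\<forall>E U. length v + n < L \<longrightarrow>
     holed_md (marked_tree m) (tree_ball m L) E U \<longrightarrow>
     {u, v} \<notin> E \<longrightarrow> (\<forall>x\<in>U \<inter> branch u v. \<not> length x < L) \<longrightarrow>
     (\<exists>E'. holed_md (marked_tree m) (tree_ball m L) E' (insert v U) \<and>
       (\<forall>e. \<not> e \<subseteq> branch u v \<longrightarrow> (e \<in> E' \<longleftrightarrow> e \<in> E)) \<and>
       holed_weight (marked_tree m) (tree_ball m L) E U - tree.iter m n (u, v)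
         \<le> holed_weight (marked_tree m) (tree_ball m L) E' (insert v U)))"

lemma fillable_monomer:
  assumes "(u, v) \<in> darts (marked_tree m)" "tree.iter m n (u, v) = vw (marked_tree m) v"
  shows "fillable m L n u v"
  unfolding fillable_def
proof (intro allI impI)
  fix E U assume *: "length v + n < L" "holed_md (marked_tree m) (tree_ball m L) E U" "v \<in> U"
  have v: "v \<in> tree_ball m L" "v \<notin> \<Union>E"
    using dart_verts[OF assms(1)] * by (auto simp: tree_ball_def holed_md_def)
  have U: "insert v (U - {v}) = U" using * by auto
  note mono = holed_monomer[OF finite_tree_ball v(1) _ v(2), of "U - {v}" "marked_tree m"]
  have "holed_md (marked_tree m) (tree_ball m L) E (U - {v})"
    using mono(1) * unfolding U by simp
  moreover have "holed_weight (marked_tree m) (tree_ball m L) E U + tree.iter m n (u, v)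
      \<le> holed_weight (marked_tree m) (tree_ball m L) E (U - {v})"
    using mono(2) assms(2) unfolding U by simp
  ultimately show "\<exists>E'. holed_md (marked_tree m) (tree_ball m L) E' (U - {v}) \<and>
       (\<forall>e. \<not> e \<subseteq> branch u v \<longrightarrow> (e \<in> E' \<longleftrightarrow> e \<in> E)) \<and>
       holed_weight (marked_tree m) (tree_ball m L) E U + tree.iter m n (u, v)
         \<le> holed_weight (marked_tree m) (tree_ball m L) E' (U - {v})"
    by blast
qed

text \<open>The term attaining the maximum says how to put \<open>v\<close> back: as a monomer, or
  by freeing some \<open>u'\<close> at cost at most \<open>iter n\<close> and matching
  \<open>v\<close> with it.\<close>

lemma fillable_Suc:
  assumes d: "(u, v) \<in> darts (marked_tree m)"
    and free: "\<And>u'. (v, u') \<in> darts (marked_tree m) \<Longrightarrow> u' \<noteq> u \<Longrightarrow> freeable m L n v u'"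
  shows "fillable m L (Suc n) u v"
proof -
  consider (mono) "tree.iter m (Suc n) (u, v) = vw (marked_tree m) v"
    | (edge) u' where "(v, u') \<in> darts (marked_tree m)" "u' \<noteq> u"
        "tree.iter m (Suc n) (u, v) = ew (marked_tree m) {v, u'} - tree.iter m n (v, u')"
    using tree.step_cases[of m "tree.iter m n" "(u, v)"] by (auto simp: in_dart_succ)
  then show ?thesis
  proof cases
    case mono
    with d show ?thesis by (rule fillable_monomer)
  next
    case edge
    let ?h = "holed_md (marked_tree m) (tree_ball m L)"
    let ?w = "holed_weight (marked_tree m) (tree_ball m L)"
    show ?thesis
      unfolding fillable_def
    proof (intro allI impI)
      fix E U assume *: "length v + Suc n < L" "?h E U" "v \<in> U"
        and U: "\<forall>x\<in>U \<inter> branch u v. length x < L \<longrightarrow> x = v"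
      have len: "length u' \<le> Suc (length v)"
        using edge(1) by (auto elim!: dart_cases)
      note sub = branch_succ[OF d edge(1,2)]
      have vu': "v \<noteq> u'" "u' \<in> branch u v" "v \<in> tree_ball m L" "u' \<in> tree_ball m L"
        using sub branch_ends[OF edge(1)] dart_verts[OF edge(1)] len *(1) by (auto simp: tree_ball_def)
      have "u' \<notin> U"
        using U vu' len *(1) by force
      have "{v, u'} \<notin> E"
        using * by (auto simp: holed_md_def)
      \<comment> \<open>The only hole of length below \<open>L\<close> in the larger branch is
        \<open>v\<close>, which lies outside \<open>branch v u'\<close>.\<close>
      moreover have "\<forall>x\<in>U \<inter> branch v u'. \<not> length x < L"
        using U sub branch_ends[OF edge(1)] by blast
      moreover have "length u' + n < L" using len * by simp
      ultimately obtain E1 where E1: "?h E1 (insert u' U)"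
        "\<And>e. \<not> e \<subseteq> branch v u' \<Longrightarrow> e \<in> E1 \<longleftrightarrow> e \<in> E"
        "?w E U - tree.iter m n (v, u') \<le> ?w E1 (insert u' U)"
        using free[OF edge(1,2)] *(2) unfolding freeable_def by blast
      have eq: "insert u' U = insert v (insert u' (U - {v}))"
        using *(3) by auto
      have e: "{v, u'} \<in> edges (marked_tree m)" using edge(1) by (simp add: darts_def)
      note add = holed_add_edge[OF finite_tree_ball E1(1)[unfolded eq] e vu'(3,4)]
      show "\<exists>E'. ?h E' (U - {v}) \<and> (\<forall>e. \<not> e \<subseteq> branch u v \<longrightarrow> (e \<in> E' \<longleftrightarrow> e \<in> E)) \<and>
         ?w E U + tree.iter m (Suc n) (u, v) \<le> ?w E' (U - {v})"
      proof (intro exI conjI allI impI)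
        show "?h (insert {v, u'} E1) (U - {v})"
          using add(1) \<open>u' \<notin> U\<close> by simp
        show "e \<in> insert {v, u'} E1 \<longleftrightarrow> e \<in> E" if "\<not> e \<subseteq> branch u v" for e
          using that E1(2)[of e] sub vu'(2) branch_ends(1)[OF d] by auto
        show "?w E U + tree.iter m (Suc n) (u, v) \<le> ?w (insert {v, u'} E1) (U - {v})"
          using add(2) \<open>u' \<notin> U\<close> E1(3) edge(3) unfolding eq by simp
      qed
    qed
  qed
qed

text \<open>Here the given configuration decides: \<open>v\<close> is a monomer, whose weight is
  lost, or matched with some \<open>u'\<close>, which is filled again once the dimer is removed.
  Either loss is one of the terms of the maximum, hence at most the maximum.\<close>

lemma freeable_Suc:
  assumes d: "(u, v) \<in> darts (marked_tree m)"
    and fill: "\<And>u'. (v, u') \<in> darts (marked_tree m) \<Longrightarrow> u' \<noteq> u \<Longrightarrow> fillable m L n v u'"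
  shows "freeable m L (Suc n) u v"
  unfolding freeable_def
proof (intro allI impI)
  let ?h = "holed_md (marked_tree m) (tree_ball m L)"
  let ?w = "holed_weight (marked_tree m) (tree_ball m L)"
  fix E U assume *: "length v + Suc n < L" "?h E U" "{u, v} \<notin> E"
    and U: "\<forall>x\<in>U \<inter> branch u v. \<not> length x < L"
  have v: "v \<in> tree_ball m L" "v \<notin> U"
    using dart_verts[OF d] *(1) U branch_ends[OF d] by (force simp: tree_ball_def)+
  show "\<exists>E'. ?h E' (insert v U) \<and> (\<forall>e. \<not> e \<subseteq> branch u v \<longrightarrow> (e \<in> E' \<longleftrightarrow> e \<in> E)) \<and>
     ?w E U - tree.iter m (Suc n) (u, v) \<le> ?w E' (insert v U)"
  proof (cases "v \<in> \<Union>E")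
    case False
    note mono = holed_monomer[OF finite_tree_ball v False, of "marked_tree m"]
    have "dart_base (marked_tree m) (u, v) \<le> tree.iter m (Suc n) (u, v)"
      by (rule tree.base_le_iter)
    then show ?thesis
      using mono *(2) by (intro exI[of _ E]) auto
  next
    case True
    then obtain e where e: "e \<in> E" "v \<in> e" by auto
    then have "e \<in> edges (marked_tree m)" using *(2) by (auto simp: holed_md_def)
    then obtain a b where "e = {a, b}" by (auto simp: edges_tree)
    then obtain u' where u': "e = {v, u'}" using e by auto
    have edge: "(v, u') \<in> darts (marked_tree m)" "u' \<noteq> u"
      using \<open>e \<in> edges (marked_tree m)\<close> e *(3) by (auto simp: u' darts_def insert_commute)
    note sub = branch_succ[OF d edge]
    have len: "length u' \<le> Suc (length v)"
      using edge(1) by (auto elim!: dart_cases)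
    have "u' \<notin> U" using e *(2) by (auto simp: holed_md_def u')
    note rem = holed_remove_edge[OF finite_tree_ball *(2) e(1)[unfolded u']]
    \<comment> \<open>Both ends of the removed dimer become holes, but only \<open>u'\<close> lies
      in the branch in which the refilling takes place.\<close>
    have "\<forall>x\<in>insert v (insert u' U) \<inter> branch v u'. length x < L \<longrightarrow> x = u'"
      using U sub branch_ends[OF edge(1)] by blast
    moreover have "length u' + n < L" using len * by simp
    ultimately obtain E1 where E1: "?h E1 (insert v (insert u' U) - {u'})"
      "\<And>e. \<not> e \<subseteq> branch v u' \<Longrightarrow> e \<in> E1 \<longleftrightarrow> e \<in> E - {{v, u'}}"
      "?w (E - {{v, u'}}) (insert v (insert u' U)) + tree.iter m n (v, u')
         \<le> ?w E1 (insert v (insert u' U) - {u'})"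
      using fill[OF edge] rem(1) unfolding fillable_def by blast
    have eq: "insert v (insert u' U) - {u'} = insert v U"
      using \<open>u' \<notin> U\<close> branch_ends[OF edge(1)] by auto
    have le: "ew (marked_tree m) {v, u'} - tree.iter m n (v, u') \<le> tree.iter m (Suc n) (u, v)"
      using tree.step_ge[of "(v, u')" m "(u, v)" "tree.iter m n"] edge
      by (auto simp: in_dart_succ)
    have "{v, u'} \<subseteq> branch u v"
      using sub branch_ends[OF edge(1)] branch_ends[OF d] by auto
    show ?thesis
    proof (intro exI conjI allI impI)
      show "?h E1 (insert v U)" using E1(1) unfolding eq .
      show "e \<in> E1 \<longleftrightarrow> e \<in> E" if "\<not> e \<subseteq> branch u v" for e
        using that E1(2)[of e] sub \<open>{v, u'} \<subseteq> branch u v\<close> by auto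
      show "?w E U - tree.iter m (Suc n) (u, v) \<le> ?w E1 (insert v U)"
        using E1(3) rem(2) le unfolding eq by linarith
    qed
  qed
qed

text \<open>At depth \<open>0\<close> an absent vertex can return as a monomer, gaining its weight;
  removing a vertex has no such bound on its cost, so \<open>freeable\<close> starts at depth
  \<open>1\<close>. The two alternate from there: even iterates bound gains from below, odd iterates
  bound costs from above.\<close>

lemma surgery:
  assumes "(u, v) \<in> darts (marked_tree m)"
  shows "even n \<Longrightarrow> fillable m L n u v" "odd n \<Longrightarrow> freeable m L n u v"
proof -
  have "(even n \<longrightarrow> fillable m L n u v) \<and> (odd n \<longrightarrow> freeable m L n u v)"
    using assms
  proof (induction n arbitrary: u v)
    case 0
    then show ?case by (auto intro!: fillable_monomer)
  next
    case (Suc n)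
    then show ?case by (auto intro!: fillable_Suc freeable_Suc)
  qed
  then show "even n \<Longrightarrow> fillable m L n u v" "odd n \<Longrightarrow> freeable m L n u v" by auto
qed

text \<open>If the edge were absent, freeing both ends and adding it would gain strictly. The
  branches of the two opposite darts are disjoint, so the first removal does not disturb the
  second.\<close>

lemma local_optimum_contains:
  assumes opt: "\<And>E'. holed_md (marked_tree m) (tree_ball m L) E' K \<Longrightarrow>
      holed_weight (marked_tree m) (tree_ball m L) E' K \<le> holed_weight (marked_tree m) (tree_ball m L) E K"
    and E: "holed_md (marked_tree m) (tree_ball m L) E K"
    and K: "\<And>x. x \<in> K \<Longrightarrow> \<not> length x < L"
    and d: "(u, v) \<in> darts (marked_tree m)" and n: "odd n" "length u + n < L" "length v + n < L"
    and less: "tree.iter m n (u, v) + tree.iter m n (v, u) < ew (marked_tree m) {u, v}"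
  shows "{u, v} \<in> E"
proof (rule ccontr)
  assume nE: "{u, v} \<notin> E"
  let ?h = "holed_md (marked_tree m) (tree_ball m L)"
  let ?w = "holed_weight (marked_tree m) (tree_ball m L)"
  have d': "(v, u) \<in> darts (marked_tree m)" using d darts_sym by fast
  obtain E1 where E1: "?h E1 (insert v K)" "\<And>e. \<not> e \<subseteq> branch u v \<Longrightarrow> e \<in> E1 \<longleftrightarrow> e \<in> E"
    "?w E K - tree.iter m n (u, v) \<le> ?w E1 (insert v K)"
    using surgery(2)[OF d n(1), of L] E nE K n(3) unfolding freeable_def by blast
  have "{v, u} \<notin> E1" using E1(1) by (auto simp: holed_md_def)
  moreover have "\<forall>x\<in>insert v K \<inter> branch v u. \<not> length x < L"
    using K branch_ends[OF d'] by blast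
  ultimately obtain E2 where E2: "?h E2 (insert u (insert v K))"
    "?w E1 (insert v K) - tree.iter m n (v, u) \<le> ?w E2 (insert u (insert v K))"
    using surgery(2)[OF d' n(1), of L] E1(1) n(2) unfolding freeable_def by blast
  have "{u, v} \<in> edges (marked_tree m)" "u \<in> tree_ball m L" "v \<in> tree_ball m L" "u \<notin> K" "v \<notin> K"
    using d dart_verts[OF d] K n by (force simp: darts_def tree_ball_def)+
  note add = holed_add_edge[OF finite_tree_ball E2(1) this]
  show False
    using opt[OF add(1)] add(2) E1(3) E2(2) less by linarith
qed

text \<open>If the edge were present, deleting it and refilling both ends, each inside its own
  branch, would gain strictly.\<close>

lemma local_optimum_avoids:
  assumes opt: "\<And>E'. holed_md (marked_tree m) (tree_ball m L) E' K \<Longrightarrow>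
      holed_weight (marked_tree m) (tree_ball m L) E' K \<le> holed_weight (marked_tree m) (tree_ball m L) E K"
    and E: "holed_md (marked_tree m) (tree_ball m L) E K"
    and K: "\<And>x. x \<in> K \<Longrightarrow> \<not> length x < L"
    and d: "(u, v) \<in> darts (marked_tree m)" and n: "even n" "length u + n < L" "length v + n < L"
    and less: "ew (marked_tree m) {u, v} < tree.iter m n (u, v) + tree.iter m n (v, u)"
  shows "{u, v} \<notin> E"
proof
  assume nE: "{u, v} \<in> E"
  let ?h = "holed_md (marked_tree m) (tree_ball m L)"
  let ?w = "holed_weight (marked_tree m) (tree_ball m L)"
  have d': "(v, u) \<in> darts (marked_tree m)" using d darts_sym by fast
  have "u \<noteq> v" using branch_ends[OF d] by auto
  note rem = holed_remove_edge[OF finite_tree_ball E nE]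
  have nK: "u \<notin> K" "v \<notin> K" using K n by force+
  have "\<forall>x\<in>insert u (insert v K) \<inter> branch u v. length x < L \<longrightarrow> x = v"
    using K branch_ends[OF d] by blast
  moreover have "insert u (insert v K) - {v} = insert u K"
    using nK \<open>u \<noteq> v\<close> by auto
  ultimately obtain E1 where E1: "?h E1 (insert u K)"
    "?w (E - {{u, v}}) (insert u (insert v K)) + tree.iter m n (u, v) \<le> ?w E1 (insert u K)"
    using surgery(1)[OF d n(1), of L] rem(1) n(3) unfolding fillable_def by (metis insertI1 insertI2)
  have "\<forall>x\<in>insert u K \<inter> branch v u. length x < L \<longrightarrow> x = u"
    using K by blast
  moreover have "insert u K - {u} = K"
    using nK by auto
  ultimately obtain E2 where E2: "?h E2 K" "?w E1 (insert u K) + tree.iter m n (v, u) \<le> ?w E2 K"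
    using surgery(1)[OF d' n(1), of L] E1(1) n(2) unfolding fillable_def by (metis insertI1)
  show False
    using opt[OF E2(1)] E2(2) E1(2) rem(2) less by linarith
qed

text \<open>Excludes the borderline case: with \<open>lo\<close> and \<open>hi\<close> equal, a tie
  would leave neither surgery with a strict gain at any depth.\<close>

definition untied :: "(nat list \<Rightarrow> nat \<times> real \<times> real) \<Rightarrow> bool" where
  "untied m \<longleftrightarrow> (\<forall>(u, v)\<in>darts (marked_tree m).
     tree.lo m (u, v) + tree.lo m (v, u) \<noteq> ew (marked_tree m) {u, v})"

text \<open>By rigidity the even and the odd iterates have the same limits, so the strict inequality
  between the edge weight and the sum of the limits already holds at some finite depth of the parity
  that the surgery needs.\<close>

lemma local_optimum_eventually:
  assumes "rigid m" "untied m" and d: "(u, v) \<in> darts (marked_tree m)"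
  shows "\<exists>L0. \<forall>L\<ge>L0. \<forall>E K.
    holed_md (marked_tree m) (tree_ball m L) E K \<longrightarrow> (\<forall>x\<in>K. \<not> length x < L) \<longrightarrow>
    (\<forall>E'. holed_md (marked_tree m) (tree_ball m L) E' K \<longrightarrow>
      holed_weight (marked_tree m) (tree_ball m L) E' K \<le> holed_weight (marked_tree m) (tree_ball m L) E K) \<longrightarrow>
    ({u, v} \<in> E \<longleftrightarrow> {u, v} \<in> MD (marked_tree m))"
proof -
  have d': "(v, u) \<in> darts (marked_tree m)" using d darts_sym by fast
  have lohi: "tree.hi m (u, v) = tree.lo m (u, v)" "tree.hi m (v, u) = tree.lo m (v, u)"
    using assms d d' by (auto simp: rigid_def)
  consider (lt) "tree.lo m (u, v) + tree.lo m (v, u) < ew (marked_tree m) {u, v}"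
    | (gt) "ew (marked_tree m) {u, v} < tree.lo m (u, v) + tree.lo m (v, u)"
    using assms(2) d unfolding untied_def by fastforce
  then show ?thesis
  proof cases
    case lt
    have "(\<lambda>n. tree.iter m (Suc (2 * n)) (u, v) + tree.iter m (Suc (2 * n)) (v, u)) \<longlonglongrightarrow>
        tree.lo m (u, v) + tree.lo m (v, u)"
      using tendsto_add[OF tree.tendsto_hi[of m "(u, v)"] tree.tendsto_hi[of m "(v, u)"]] unfolding lohi .
    from order_tendstoD(2)[OF this lt] obtain k
      where k: "tree.iter m (Suc (2 * k)) (u, v) + tree.iter m (Suc (2 * k)) (v, u) < ew (marked_tree m) {u, v}"
      using eventually_happens'[OF sequentially_bot] by blast
    have "{u, v} \<in> MD (marked_tree m)"
      using lt assms d by (simp add: pair_in_MD_tree)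
    with local_optimum_contains[OF _ _ _ d _ _ _ k] show ?thesis
      \<comment> \<open>The depth is \<open>n = Suc (2 * k)\<close>; one more than the lengths plus
        \<open>n\<close> makes \<open>length + n < L\<close> strict at both ends. The other case
        uses \<open>n = 2 * k\<close> in the same way.\<close>
      by (intro exI[of _ "length u + length v + Suc (Suc (2 * k))"]) (force simp del: tree.iter_Suc)
  next
    case gt
    have "(\<lambda>n. tree.iter m (2 * n) (u, v) + tree.iter m (2 * n) (v, u)) \<longlonglongrightarrow>
        tree.lo m (u, v) + tree.lo m (v, u)"
      by (intro tendsto_add tree.tendsto_lo)
    from order_tendstoD(1)[OF this gt] obtain k
      where k: "ew (marked_tree m) {u, v} < tree.iter m (2 * k) (u, v) + tree.iter m (2 * k) (v, u)"
      using eventually_happens'[OF sequentially_bot] by blast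
    have "{u, v} \<notin> MD (marked_tree m)"
      using gt by (simp add: pair_in_MD_tree)
    with local_optimum_avoids[OF _ _ _ d _ _ _ k] show ?thesis
      by (intro exI[of _ "length u + length v + Suc (2 * k)"]) force
  qed
qed

section \<open>Local convergence of the optimal configurations\<close>

lemma gdist_le_iff: "gdist G u v \<le> enat k \<longleftrightarrow> (\<exists>j\<le>k. (u, v) \<in> darts G ^^ j)"
proof
  assume le: "gdist G u v \<le> enat k"
  let ?S = "enat ` {k. (u, v) \<in> darts G ^^ k}"
  have "?S \<noteq> {}"
    using le unfolding gdist_def by (auto simp: Inf_enat_def split: if_splits)
  then have "Inf ?S \<in> ?S"
    by (simp add: Inf_enat_def LeastI_ex ex_in_conv del: image_is_empty) (metis LeastI_ex ex_in_conv)
  then show "\<exists>j\<le>k. (u, v) \<in> darts G ^^ j"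
    using le unfolding gdist_def by auto
next
  assume "\<exists>j\<le>k. (u, v) \<in> darts G ^^ j"
  then obtain j where "j \<le> k" "(u, v) \<in> darts G ^^ j" by blast
  then have "gdist G u v \<le> enat j"
    unfolding gdist_def by (intro INF_lower) auto
  with \<open>j \<le> k\<close> show "gdist G u v \<le> enat k"
    by (meson enat_ord_simps(1) order_trans)
qed

lemma rooted_simps [simp]:
  "verts (rooted G D r) = verts G" "edges (rooted G D r) = edges G"
  "ew (rooted G D r) = ew G" "vw (rooted G D r) = vw G"
  "dimers (rooted G D r) = D" "root (rooted G D r) = r" "darts (rooted G D r) = darts G"
  by (simp_all add: rooted_def darts_def)

lemma graph_ball_simps [simp]:
  "verts (graph_ball H g) = ball_verts H g"
  "edges (graph_ball H g) = {e \<in> edges g. e \<subseteq> ball_verts H g}"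
  "ew (graph_ball H g) = ew g" "vw (graph_ball H g) = vw g"
  "dimers (graph_ball H g) = {e \<in> dimers g. e \<subseteq> ball_verts H g}"
  "root (graph_ball H g) = root g"
  by (simp_all add: graph_ball_def)

lemma in_ball_verts: "v \<in> ball_verts H g \<longleftrightarrow> v \<in> verts g \<and> (\<exists>j\<le>H + 1. (root g, v) \<in> darts g ^^ j)"
  unfolding ball_verts_def gdist_le_iff by simp

lemma ball_verts_rooted: "ball_verts H (rooted G D r) = ball_verts H (rooted G {} r)"
  unfolding set_eq_iff in_ball_verts by simp

lemma ball_verts_mono: "H \<le> H' \<Longrightarrow> ball_verts H g \<subseteq> ball_verts H' g"
proof
  fix v assume "H \<le> H'" "v \<in> ball_verts H g"
  moreover from this have "j \<le> H' + 1" if "j \<le> H + 1" for j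
    using that by simp
  ultimately show "v \<in> ball_verts H' g"
    unfolding in_ball_verts by blast
qed

text \<open>A ball of index \<open>H\<close> reaches distance \<open>H + 1\<close>, hence the
  shift.\<close>

lemma ball_verts_tree: "ball_verts H (rooted (marked_tree m) D []) = tree_ball m (H + 1)"
proof -
  have "v \<in> verts (marked_tree m) \<and> length v \<le> j" if "([], v) \<in> darts (marked_tree m) ^^ j" for v j
    using that
  proof (induction j arbitrary: v)
    case (Suc j)
    then obtain u where u: "([], u) \<in> darts (marked_tree m) ^^ j" "(u, v) \<in> darts (marked_tree m)"
      by auto
    then show ?case using Suc.IH[OF u(1)] by (auto elim!: dart_cases)
  qed auto
  moreover have "([], v) \<in> darts (marked_tree m) ^^ length v" if "v \<in> verts (marked_tree m)" for v
    using that by (induction v rule: rev_induct) auto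
  ultimately show ?thesis
    unfolding set_eq_iff in_ball_verts tree_ball_def
    by (simp add: mem_Collect_eq) (metis dual_order.trans)
qed

lemma dart_in_verts:
  assumes "locally_finite_graph G" "(u, v) \<in> darts G"
  shows "u \<in> verts G" "v \<in> verts G"
  using assms by (auto simp: locally_finite_graph_def darts_def doubleton_eq_iff dest!: bspec)

lemma ball_iso_path:
  assumes g: "locally_finite_graph g" "root g \<in> verts g"
    and f: "f (root g) = root h"
      "\<And>e. e \<in> edges g \<Longrightarrow> e \<subseteq> ball_verts H g \<Longrightarrow> f ` e \<in> edges h"
  shows "j \<le> H + 1 \<Longrightarrow> (root g, v) \<in> darts g ^^ j \<Longrightarrow> (root h, f v) \<in> darts h ^^ j"
proof (induction j arbitrary: v)
  case 0
  then show ?case using f by simp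
next
  case (Suc j)
  then obtain u where u: "(root g, u) \<in> darts g ^^ j" "(u, v) \<in> darts g"
    by auto
  have "u \<in> ball_verts H g"
    unfolding in_ball_verts using Suc.prems u dart_in_verts[OF g(1) u(2)]
    by (auto intro!: exI[of _ j])
  moreover have "v \<in> ball_verts H g"
    unfolding in_ball_verts using Suc.prems dart_in_verts[OF g(1) u(2)] by blast
  ultimately have "f ` {u, v} \<in> edges h"
    using u(2) by (intro f(2)) (auto simp: darts_def)
  then have "(f u, f v) \<in> darts h" by (simp add: darts_def)
  with Suc.IH[OF _ u(1)] Suc.prems show ?case by auto
qed

text \<open>Paths from the root of length at most \<open>H + 1\<close> stay in the ball, so
  \<open>f\<close> and its inverse carry them over. Distances from the root are thus preserved, and
  the isomorphism restricts to smaller balls.\<close>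

lemma ball_iso_ball_verts:
  assumes g: "locally_finite_graph g" "root g \<in> verts g"
    and h: "locally_finite_graph h" "root h \<in> verts h"
    and f: "bij_betw f (ball_verts H g) (ball_verts H h)" "f (root g) = root h"
      "(`) f ` {e \<in> edges g. e \<subseteq> ball_verts H g} = {e \<in> edges h. e \<subseteq> ball_verts H h}"
    and "H' \<le> H" "v \<in> ball_verts H g"
  shows "f v \<in> ball_verts H' h \<longleftrightarrow> v \<in> ball_verts H' g"
proof -
  define f' where "f' = inv_into (ball_verts H g) f"
  have inv: "f' (f x) = x" if "x \<in> ball_verts H g" for x
    unfolding f'_def by (rule bij_betw_inv_into_left[OF f(1) that])
  have root: "root g \<in> ball_verts H g"
    unfolding in_ball_verts by (intro conjI g(2) exI[of _ 0]) simp_all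
  have e: "f ` e \<in> edges h" if "e \<in> edges g" "e \<subseteq> ball_verts H g" for e
  proof -
    have "f ` e \<in> (`) f ` {e \<in> edges g. e \<subseteq> ball_verts H g}" using that by simp
    then show ?thesis unfolding f(3) by simp
  qed
  have e': "f' ` e \<in> edges g" if "e \<in> edges h" "e \<subseteq> ball_verts H h" for e
  proof -
    have "e \<in> (`) f ` {e \<in> edges g. e \<subseteq> ball_verts H g}" unfolding f(3) using that by simp
    then obtain e0 where e0: "e0 \<in> edges g" "e0 \<subseteq> ball_verts H g" "e = f ` e0"
      by auto
    have "(\<lambda>x. f' (f x)) ` e0 = (\<lambda>x. x) ` e0"
      using e0(2) by (intro image_cong inv) auto
    with e0 show ?thesis by (simp add: image_image)
  qed
  have "f' (root h) = root g"
    using inv[OF root] f(2) by simp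
  note root' = this
  have path: "(root h, f v) \<in> darts h ^^ j" if "j \<le> H + 1" "(root g, v) \<in> darts g ^^ j" for j
    by (rule ball_iso_path[where H = H and f = f, OF g f(2)]) (use e that in blast)+
  have path': "(root g, f' (f v)) \<in> darts g ^^ j" if "j \<le> H + 1" "(root h, f v) \<in> darts h ^^ j" for j
    by (rule ball_iso_path[where H = H and f = f', OF h root']) (use e' that in blast)+
  have "f v \<in> verts h" "v \<in> verts g"
    using assms(9) bij_betwE[OF f(1)] by (auto simp: in_ball_verts)
  moreover have "(root g, v) \<in> darts g ^^ j \<longleftrightarrow> (root h, f v) \<in> darts h ^^ j" if "j \<le> H' + 1" for j
    using path[of j] path'[of j] that \<open>H' \<le> H\<close> inv[OF assms(9)] by auto
  ultimately show ?thesis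
    unfolding in_ball_verts by blast
qed

lemma optimal_restrict:
  assumes G: "finite_graph G" and D: "optimal G D" and B: "B \<subseteq> verts G"
  defines "K \<equiv> {v \<in> B. \<exists>e\<in>D. v \<in> e \<and> \<not> e \<subseteq> B}" and "E \<equiv> {e \<in> D. e \<subseteq> B}"
  shows "holed_md G B E K"
    "holed_md G B E' K \<Longrightarrow> holed_weight G B E' K \<le> holed_weight G B E K"
proof -
  have fin: "finite (verts G)" "finite B"
    using G B finite_subset by (auto simp: finite_graph_def)
  have edge: "e \<subseteq> verts G" if "e \<in> edges G" for e
    using G that by (force simp: finite_graph_def locally_finite_graph_def)
  have md: "monomer_dimer G D" using D by (simp add: optimal_def)
  then have De: "D \<subseteq> edges G" by (simp add: monomer_dimer_def)
  have meet: "e = e'" if "e \<in> D" "e' \<in> D" "x \<in> e" "x \<in> e'" for e e' x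
    using md that edge De unfolding monomer_dimer_def by blast
  have finD: "finite D"
    using De edge by (intro finite_subset[OF _ finite_Pow_iff[THEN iffD2, OF fin(1)]]) auto
  define R where "R = {e \<in> D. \<not> e \<subseteq> B}"
  have DR: "D = R \<union> E" by (auto simp: R_def E_def)
  show hE: "holed_md G B E K"
    unfolding holed_md_def
  proof (intro conjI ballI impI)
    show "E \<subseteq> edges G" using De by (auto simp: E_def)
    show "e \<subseteq> B - K" if "e \<in> E" for e
      using that meet unfolding E_def K_def by blast
    show "e = e'" if "e \<in> E" "e' \<in> E" "e \<inter> e' \<noteq> {}" for e e'
      using that meet unfolding E_def by blast
  qed
  have weight: "md_weight G (R \<union> F) = (\<Sum>e\<in>R. ew G e) + (\<Sum>v\<in>verts G - B - \<Union>R. vw G v) + holed_weight G B F K"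
    if F: "holed_md G B F K" for F
  proof -
    have FB: "e \<subseteq> B" if "e \<in> F" for e using F that by (auto simp: holed_md_def)
    have "R \<inter> F = {}" using FB by (auto simp: R_def)
    moreover have "finite R" using finD by (simp add: R_def)
    ultimately have "(\<Sum>e\<in>R \<union> F. ew G e) = (\<Sum>e\<in>R. ew G e) + (\<Sum>e\<in>F. ew G e)"
      using holed_md_finite[OF fin(2) F] by (simp add: sum.union_disjoint)
    moreover have "monomers G (R \<union> F) = (verts G - B - \<Union>R) \<union> (B - K - \<Union>F)"
    proof -
      have "v \<in> K \<longleftrightarrow> v \<in> \<Union>R" if "v \<in> B" for v
        using that by (auto simp: K_def R_def)
      then show ?thesis
        using B FB unfolding monomers_def by (auto; blast)
    qed
    moreover have "(\<Sum>v\<in>(verts G - B - \<Union>R) \<union> (B - K - \<Union>F). vw G v) =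
        (\<Sum>v\<in>verts G - B - \<Union>R. vw G v) + (\<Sum>v\<in>B - K - \<Union>F. vw G v)"
      using fin by (intro sum.union_disjoint) auto
    ultimately show ?thesis
      by (simp add: md_weight_def holed_weight_def)
  qed
  show "holed_weight G B E' K \<le> holed_weight G B E K" if E': "holed_md G B E' K"
  proof -
    have "monomer_dimer G (R \<union> E')"
      unfolding monomer_dimer_def
    proof (intro conjI ballI impI)
      show "R \<union> E' \<subseteq> edges G"
        using De E' by (auto simp: R_def holed_md_def)
      have mixed: False if "e \<in> R" "e' \<in> E'" "v \<in> e" "v \<in> e'" for e e' v
        using that E' unfolding R_def holed_md_def K_def by blast
      show "e = e'" if "e \<in> R \<union> E'" "e' \<in> R \<union> E'" "v \<in> e \<and> v \<in> e'" for v e e'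
        using that mixed[of e e' v] mixed[of e' e v] meet[of e e' v] E'
        unfolding R_def holed_md_def by blast
    qed
    then have "md_weight G (R \<union> E') \<le> md_weight G (R \<union> E)"
      using D DR by (simp add: optimal_def)
    then show ?thesis
      unfolding weight[OF E'] weight[OF hE] by simp
  qed
qed

lemma holed_transfer:
  assumes f: "bij_betw f B B'"
      "\<And>e. e \<subseteq> B \<Longrightarrow> f ` e \<in> edges h \<longleftrightarrow> e \<in> edges g"
      "\<And>e. e \<in> edges g \<Longrightarrow> e \<subseteq> B \<Longrightarrow> ew h (f ` e) = ew g e"
      "\<And>v. v \<in> B \<Longrightarrow> vw h (f v) = vw g v"
    and E: "\<And>e. e \<in> E \<Longrightarrow> e \<subseteq> B" and U: "U \<subseteq> B"
  shows "holed_md h B' ((`) f ` E) (f ` U) \<longleftrightarrow> holed_md g B E U"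
    "holed_md g B E U \<Longrightarrow> holed_weight h B' ((`) f ` E) (f ` U) = holed_weight g B E U"
proof -
  have inj: "inj_on f B" and B': "B' = f ` B"
    using f(1) by (auto simp: bij_betw_def)
  have sub: "f ` e \<subseteq> B' - f ` U \<longleftrightarrow> e \<subseteq> B - U" if "e \<subseteq> B" for e
    using inj that U unfolding B' by (auto simp: inj_on_def) blast+
  have disj: "f ` e \<inter> f ` e' = {} \<longleftrightarrow> e \<inter> e' = {}" if "e \<subseteq> B" "e' \<subseteq> B" for e e'
    using inj_on_image_Int[OF inj that] by auto
  have eq: "f ` e = f ` e' \<longleftrightarrow> e = e'" if "e \<subseteq> B" "e' \<subseteq> B" for e e'
    using inj_on_image_eq_iff[OF inj that] .
  show "holed_md h B' ((`) f ` E) (f ` U) \<longleftrightarrow> holed_md g B E U"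
    unfolding holed_md_def using E by (auto simp: sub disj eq f(2) image_subset_iff[of "(`) f"] subset_iff[of E])
  assume md: "holed_md g B E U"
  have "inj_on ((`) f) E"
    using eq E by (auto simp: inj_on_def)
  then have 1: "(\<Sum>e\<in>(`) f ` E. ew h e) = (\<Sum>e\<in>E. ew g e)"
    using md E by (subst sum.reindex) (auto intro!: sum.cong f(3) simp: holed_md_def)
  have "\<Union>((`) f ` E) = f ` \<Union>E" by auto
  moreover have "f ` B - f ` U - f ` \<Union>E = f ` (B - U - \<Union>E)"
  proof -
    have "f ` (B - U - \<Union>E) = f ` B - f ` (U \<union> \<Union>E)"
      unfolding Diff_eq[symmetric] by (subst inj_on_image_set_diff[OF inj, symmetric]) (use U E in \<open>auto simp: Diff_Un\<close>)
    then show ?thesis by (auto simp: image_Un)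
  qed
  ultimately have "B' - f ` U - \<Union>((`) f ` E) = f ` (B - U - \<Union>E)"
    unfolding B' by simp
  moreover have "(\<Sum>v\<in>f ` (B - U - \<Union>E). vw h v) = (\<Sum>v\<in>B - U - \<Union>E. vw g v)"
    by (subst sum.reindex) (auto intro!: sum.cong f(4) intro: inj_on_subset[OF inj])
  ultimately show "holed_weight h B' ((`) f ` E) (f ` U) = holed_weight g B E U"
    unfolding holed_weight_def 1 by simp
qed

text \<open>The deterministic core: one tree, one root per graph, and any choice of optima.
  Probability only has to supply the two hypotheses on \<open>m\<close>.\<close>

lemma converges_locally_MD:
  assumes m: "rigid m" "untied m"
    and G: "\<And>n. finite_graph (G n)" "\<And>n. r n \<in> verts (G n)" "\<And>n. optimal (G n) (D n)"
    and conv: "converges_locally (\<lambda>n. rooted (G n) {} (r n)) (rooted (marked_tree m) {} [])"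
  shows "converges_locally (\<lambda>n. rooted (G n) (D n) (r n))
    (rooted (marked_tree m) (MD (marked_tree m)) [])"
  unfolding converges_locally_def
proof
  fix H
  let ?T = "marked_tree m"
  \<comment> \<open>\<open>Q L d\<close> is the conclusion of
    \<open>local_optimum_eventually\<close> for one dart; the finitely many darts in the target ball
    share a common threshold \<open>L0\<close>.\<close>
  define Q where "Q L d \<longleftrightarrow> (\<forall>E K. holed_md ?T (tree_ball m L) E K \<longrightarrow> (\<forall>x\<in>K. \<not> length x < L) \<longrightarrow>
    (\<forall>E'. holed_md ?T (tree_ball m L) E' K \<longrightarrow>
      holed_weight ?T (tree_ball m L) E' K \<le> holed_weight ?T (tree_ball m L) E K) \<longrightarrow>
    ({fst d, snd d} \<in> E \<longleftrightarrow> {fst d, snd d} \<in> MD ?T))" for L d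
  define J where "J = darts ?T \<inter> (tree_ball m (H + 1) \<times> tree_ball m (H + 1))"
  have "finite J"
    unfolding J_def using finite_tree_ball by blast
  moreover have "\<forall>d\<in>J. eventually (\<lambda>L. Q L d) sequentially"
    using local_optimum_eventually[OF m] unfolding eventually_sequentially Q_def J_def by auto
  ultimately have "eventually (\<lambda>L. \<forall>d\<in>J. Q L d) sequentially"
    by (rule eventually_ball_finite)
  then obtain L0 where L0: "\<And>L d. L0 \<le> L \<Longrightarrow> d \<in> J \<Longrightarrow> Q L d"
    unfolding eventually_sequentially by blast
  \<comment> \<open>The larger ball must contain the ball to be compared, and its radius
    \<open>H' + 1\<close> must reach the threshold \<open>L0\<close>.\<close>
  define H' where "H' = max H L0"
  have H': "H \<le> H'" "L0 \<le> H' + 1" by (auto simp: H'_def)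
  obtain N where N: "\<And>n. N \<le> n \<Longrightarrow>
      graph_iso (graph_ball H' (rooted (G n) {} (r n))) (graph_ball H' (rooted ?T {} []))"
    using conv unfolding converges_locally_def by blast
  show "\<exists>N. \<forall>n\<ge>N. graph_iso (graph_ball H (rooted (G n) (D n) (r n)))
      (graph_ball H (rooted ?T (MD ?T) []))"
  proof (intro exI[of _ N] allI impI)
    fix n assume "N \<le> n"
    let ?g = "rooted (G n) {} (r n)" and ?h = "rooted ?T {} []"
    obtain f where f: "bij_betw f (ball_verts H' ?g) (ball_verts H' ?h)" "f (r n) = []"
      "(`) f ` {e \<in> edges (G n). e \<subseteq> ball_verts H' ?g} = {e \<in> edges ?T. e \<subseteq> ball_verts H' ?h}"
      "\<And>e. e \<in> edges (G n) \<Longrightarrow> e \<subseteq> ball_verts H' ?g \<Longrightarrow> ew ?T (f ` e) = ew (G n) e"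
      "\<And>v. v \<in> ball_verts H' ?g \<Longrightarrow> vw ?T (f v) = vw (G n) v"
      using N[OF \<open>N \<le> n\<close>] unfolding graph_iso_def by (auto simp del: vw_tree)
    have lf: "locally_finite_graph ?g" "locally_finite_graph ?h"
      using G(1)[of n] locally_finite_tree[of m]
      by (auto simp: finite_graph_def locally_finite_graph_def)
    have ball: "f v \<in> ball_verts k ?h \<longleftrightarrow> v \<in> ball_verts k ?g" if "k \<le> H'" "v \<in> ball_verts H' ?g" for k v
      using ball_iso_ball_verts[OF lf(1) _ lf(2) _ f(1)] f(2,3) G(2) that by simp
    let ?B = "ball_verts H' ?g" and ?L = "H' + 1"
    have Bt: "ball_verts k ?h = tree_ball m (k + 1)" for k
      by (rule ball_verts_tree)
    have inj: "inj_on f ?B" using f(1) by (simp add: bij_betw_def)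
    have fedge: "f ` e \<in> edges ?T \<longleftrightarrow> e \<in> edges (G n)" if "e \<subseteq> ?B" for e
    proof
      assume "e \<in> edges (G n)"
      then have "f ` e \<in> (`) f ` {e \<in> edges (G n). e \<subseteq> ?B}" using that by simp
      then show "f ` e \<in> edges ?T" unfolding f(3) by simp
    next
      assume "f ` e \<in> edges ?T"
      moreover have "f ` e \<subseteq> ball_verts H' ?h" using that bij_betwE[OF f(1)] by auto
      ultimately have "f ` e \<in> (`) f ` {e \<in> edges (G n). e \<subseteq> ?B}" unfolding f(3) by simp
      then obtain e0 where "e0 \<in> edges (G n)" "e0 \<subseteq> ?B" "f ` e = f ` e0" by auto
      then show "e \<in> edges (G n)"
        using inj_on_image_eq_iff[OF inj that] by auto
    qed
    define K where "K = {v \<in> ?B. \<exists>e\<in>D n. v \<in> e \<and> \<not> e \<subseteq> ?B}"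
    define E where "E = {e \<in> D n. e \<subseteq> ?B}"
    have De: "D n \<subseteq> edges (G n)"
      using G(3)[of n] by (simp add: optimal_def monomer_dimer_def)
    have BV: "?B \<subseteq> verts (G n)" by (auto simp: in_ball_verts)
    note opt = optimal_restrict[OF G(1,3) BV, folded K_def E_def]
    have tr: "holed_md ?T (tree_ball m ?L) ((`) f ` F) (f ` U) \<longleftrightarrow> holed_md (G n) ?B F U"
      "holed_md (G n) ?B F U \<Longrightarrow>
        holed_weight ?T (tree_ball m ?L) ((`) f ` F) (f ` U) = holed_weight (G n) ?B F U"
      if "\<And>e. e \<in> F \<Longrightarrow> e \<subseteq> ?B" "U \<subseteq> ?B" for F U
    proof -
      note * = holed_transfer[where E = F and U = U and g = "G n" and h = ?T, OF f(1)[unfolded Bt]]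
      show "holed_md ?T (tree_ball m ?L) ((`) f ` F) (f ` U) \<longleftrightarrow> holed_md (G n) ?B F U"
        by (rule *(1)) (use fedge f(4,5) that in blast)+
      show "holed_weight ?T (tree_ball m ?L) ((`) f ` F) (f ` U) = holed_weight (G n) ?B F U"
        if "holed_md (G n) ?B F U"
        by (rule *(2)[OF _ _ _ _ _ that]) (use fedge f(4,5) \<open>\<And>e. e \<in> F \<Longrightarrow> e \<subseteq> ?B\<close> \<open>U \<subseteq> ?B\<close> in blast)+
    qed
    have EB: "e \<subseteq> ?B" if "e \<in> E" for e using that by (simp add: E_def)
    have KB: "K \<subseteq> ?B" by (auto simp: K_def)
    have 1: "holed_md ?T (tree_ball m ?L) ((`) f ` E) (f ` K)"
      using opt(1) tr(1)[OF EB KB] by simp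
    \<comment> \<open>Holes sit on the boundary sphere: a vertex at distance at most
      \<open>H'\<close> has all its neighbours in the ball, so its dimer cannot leave the
      ball.\<close>
    have 2: "\<not> length x < ?L" if "x \<in> f ` K" for x
    proof
      assume len: "length x < ?L"
      obtain v e where v: "x = f v" "v \<in> ?B" "e \<in> D n" "v \<in> e" "\<not> e \<subseteq> ?B"
        using \<open>x \<in> f ` K\<close> by (auto simp: K_def)
      have xB: "x \<in> tree_ball m ?L" using v bij_betwE[OF f(1)] by (auto simp: Bt)
      obtain y where y: "y \<in> e" "y \<notin> ?B" using v by auto
      have "e \<in> edges (G n)" using v De by auto
      then obtain a b where "e = {a, b}"
        using lf(1) by (auto simp: locally_finite_graph_def)
      then have "e = {v, y}" using y v by auto
      then have vy: "(v, y) \<in> darts (G n)" using \<open>e \<in> edges (G n)\<close> by (simp add: darts_def)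
      have "\<exists>j\<le>H'. (r n, v) \<in> darts (G n) ^^ j"
      \<comment> \<open>Distance at most \<open>H'\<close> is the ball of index
        \<open>H' - 1\<close>, except for \<open>H' = 0\<close>, where truncated subtraction would
        give radius \<open>1\<close> instead of the root alone.\<close>
      proof (cases "H' = 0")
        case True
        then have "x = []" using len by simp
        then have "v = r n"
          using f(2) v inj G(2)[of n] unfolding inj_on_def
          by (metis (no_types, lifting) in_ball_verts relpow_0_I rooted_simps(1,6,7) le0)
        then show ?thesis by (intro exI[of _ 0]) auto
      next
        case False
        then have "x \<in> ball_verts (H' - 1) ?h" using len xB by (auto simp: Bt tree_ball_def)
        then have "v \<in> ball_verts (H' - 1) ?g" using ball[of "H' - 1" v] v by simp
        then show ?thesis using False by (auto simp: in_ball_verts)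
      qed
      then obtain j where "j \<le> H'" "(r n, y) \<in> darts (G n) ^^ Suc j"
        using vy by auto
      then have "y \<in> ?B"
        using dart_in_verts[OF lf(1), of v y] vy by (auto simp: in_ball_verts simp del: relpow.simps)
      with y show False by simp
    qed
    have 3: "holed_weight ?T (tree_ball m ?L) E' (f ` K) \<le> holed_weight ?T (tree_ball m ?L) ((`) f ` E) (f ` K)"
      if E': "holed_md ?T (tree_ball m ?L) E' (f ` K)" for E'
    proof -
      \<comment> \<open>Pulling the competitor back along \<open>f\<close> brings it to
        \<open>G n\<close>, where optimality is available.\<close>
      define F where "F = {e \<in> Pow ?B. f ` e \<in> E'}"
      have "E' \<subseteq> Pow (f ` ?B)"
        using E' f(1) by (auto simp: holed_md_def Bt bij_betw_def)
      have "e \<in> (`) f ` F" if "e \<in> E'" for e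
      proof -
        from that \<open>E' \<subseteq> Pow (f ` ?B)\<close> have "e \<subseteq> f ` ?B" by auto
        then obtain e0 where "e0 \<subseteq> ?B" "e = f ` e0" unfolding subset_image_iff by metis
        with that show ?thesis by (auto simp: F_def)
      qed
      then have E'F: "E' = (`) f ` F"
        by (auto simp: F_def)
      have FB: "e \<subseteq> ?B" if "e \<in> F" for e using that by (auto simp: F_def)
      have F: "holed_md (G n) ?B F K"
        using tr(1)[OF FB KB] E' unfolding E'F by simp
      show ?thesis
        using opt(2)[OF F] tr(2)[OF FB KB F] tr(2)[OF EB KB opt(1)] unfolding E'F by simp
    qed
    have dimer: "f ` e \<in> MD ?T \<longleftrightarrow> e \<in> D n" if e: "e \<in> edges (G n)" "e \<subseteq> ball_verts H ?g" for e
    proof -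
      have eB: "e \<subseteq> ?B" by (rule subset_trans[OF e(2) ball_verts_mono[OF H'(1)]])
      obtain a b where ab: "e = {a, b}"
        using lf(1) e(1) by (auto simp: locally_finite_graph_def)
      have "f a \<in> tree_ball m (H + 1)" "f b \<in> tree_ball m (H + 1)"
        using ball[OF H'(1)] e eB unfolding ab Bt by auto
      moreover have "(f a, f b) \<in> darts ?T"
        using fedge[OF eB] e(1) by (simp add: ab darts_def)
      ultimately have "(f a, f b) \<in> J"
        by (simp add: J_def)
      from L0[OF H'(2) this] have "{f a, f b} \<in> (`) f ` E \<longleftrightarrow> {f a, f b} \<in> MD ?T"
        using 1 2 3 unfolding Q_def by simp
      moreover have "f ` e \<in> (`) f ` E \<longleftrightarrow> e \<in> E"
      proof
        assume "f ` e \<in> (`) f ` E"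
        then obtain e' where "e' \<in> E" "f ` e = f ` e'" by auto
        then show "e \<in> E" using inj_on_image_eq_iff[OF inj eB EB] by simp
      qed simp
      ultimately show ?thesis using eB by (simp add: ab E_def)
    qed
    have sub: "ball_verts H ?g \<subseteq> ?B" using ball_verts_mono[OF H'(1)] .
    have bijH: "f ` ball_verts H ?g = ball_verts H ?h"
    proof
      show "f ` ball_verts H ?g \<subseteq> ball_verts H ?h"
        using ball[OF H'(1)] sub by auto
      show "ball_verts H ?h \<subseteq> f ` ball_verts H ?g"
      proof
        fix x assume x: "x \<in> ball_verts H ?h"
        then have "x \<in> ball_verts H' ?h" using ball_verts_mono[OF H'(1), of ?h] by blast
        then obtain v where "v \<in> ?B" "x = f v"
          using f(1) by (auto simp: bij_betw_def)
        with x ball[OF H'(1)] show "x \<in> f ` ball_verts H ?g" by auto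
      qed
    qed
    have edgesH: "(`) f ` {e \<in> edges (G n). e \<subseteq> ball_verts H ?g} = {e \<in> edges ?T. e \<subseteq> ball_verts H ?h}"
      (is "?l = ?r")
    proof
      show "?l \<subseteq> ?r" using fedge sub bijH by blast
      show "?r \<subseteq> ?l"
      proof
        fix e assume e: "e \<in> ?r"
        then obtain e0 where "e0 \<subseteq> ball_verts H ?g" "e = f ` e0"
          unfolding bijH[symmetric] by (auto simp: subset_image_iff)
        with e fedge[of e0] sub show "e \<in> ?l" by auto
      qed
    qed
    have dimersH: "(`) f ` {e \<in> D n. e \<subseteq> ball_verts H ?g} = {e \<in> MD ?T. e \<subseteq> ball_verts H ?h}"
      (is "?l = ?r")
    proof
      show "?l \<subseteq> ?r" using dimer De bijH by blast
      show "?r \<subseteq> ?l"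
      proof
        fix e assume e: "e \<in> ?r"
        moreover have "MD ?T \<subseteq> edges ?T"
          using monomer_dimer_MD_tree by (simp add: monomer_dimer_def)
        ultimately have "e \<in> (`) f ` {e \<in> edges (G n). e \<subseteq> ball_verts H ?g}"
          unfolding edgesH by auto
        then obtain e0 where "e0 \<in> edges (G n)" "e0 \<subseteq> ball_verts H ?g" "e = f ` e0"
          by auto
        with dimer e show "e \<in> ?l" by auto
      qed
    qed
    have "bij_betw f (ball_verts H ?g) (ball_verts H ?h)"
      using bijH inj_on_subset[OF inj sub] by (simp add: bij_betw_def)
    moreover have "ew ?T (f ` e) = ew (G n) e" if "e \<in> edges (G n)" "e \<subseteq> ball_verts H ?g" for e
      using f(4)[OF that(1)] that sub by blast
    moreover have "vw ?T (f v) = vw (G n) v" if "v \<in> ball_verts H ?g" for v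
      using f(5) that sub by blast
    ultimately show "graph_iso (graph_ball H (rooted (G n) (D n) (r n)))
      (graph_ball H (rooted ?T (MD ?T) []))"
      unfolding graph_iso_def graph_ball_simps rooted_simps ball_verts_rooted[of _ _ "D n"]
        ball_verts_rooted[of _ _ "MD ?T"]
      using f(2) edgesH dimersH by (intro exI[of _ f]) blast
  qed
qed

section \<open>The law of the marks\<close>

abbreviation num_children :: "(nat list \<Rightarrow> nat \<times> real \<times> real) \<Rightarrow> nat list \<Rightarrow> nat" where
  "num_children m u \<equiv> fst (m u)"

abbreviation edge_mark :: "(nat list \<Rightarrow> nat \<times> real \<times> real) \<Rightarrow> nat list \<Rightarrow> real" where
  "edge_mark m u \<equiv> fst (snd (m u))"

abbreviation vertex_mark :: "(nat list \<Rightarrow> nat \<times> real \<times> real) \<Rightarrow> nat list \<Rightarrow> real" where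
  "vertex_mark m u \<equiv> snd (snd (m u))"

text \<open>A reference sigma-algebra shared by all laws of marks, so that measurability is proved
  once, independently of \<pi>, \<omega> and \<xi>.\<close>

definition marks_space :: "(nat list \<Rightarrow> nat \<times> real \<times> real) measure" where
  "marks_space = PiM UNIV (\<lambda>_. count_space UNIV \<Otimes>\<^sub>M (borel \<Otimes>\<^sub>M borel))"

lemma space_marks_space [simp]: "space marks_space = UNIV"
  by (simp add: marks_space_def space_PiM space_pair_measure)

lemma pred_marks_space: "Measurable.pred marks_space P \<Longrightarrow> {m. P m} \<in> sets marks_space"
  by (simp add: pred_def)

lemma measurable_mark:
  "(\<lambda>m. m u) \<in> marks_space \<rightarrow>\<^sub>M count_space UNIV \<Otimes>\<^sub>M (borel \<Otimes>\<^sub>M borel)"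
  unfolding marks_space_def by (rule measurable_component_singleton) simp

lemma measurable_mark_components [measurable (raw)]:
  assumes "f \<in> N \<rightarrow>\<^sub>M marks_space"
  shows "(\<lambda>x. num_children (f x) u) \<in> N \<rightarrow>\<^sub>M count_space UNIV"
    "(\<lambda>x. edge_mark (f x) u) \<in> borel_measurable N"
    "(\<lambda>x. vertex_mark (f x) u) \<in> borel_measurable N"
  using measurable_compose[OF assms measurable_mark[of u]] by simp_all

lemma measurable_marksI:
  assumes "\<And>u. (\<lambda>x. f x u) \<in> N \<rightarrow>\<^sub>M count_space UNIV \<Otimes>\<^sub>M (borel \<Otimes>\<^sub>M borel)"
  shows "f \<in> N \<rightarrow>\<^sub>M marks_space"
  unfolding marks_space_def
  by (rule measurable_PiM_single') (use assms in \<open>auto simp: space_pair_measure\<close>)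

text \<open>The shifted family keeps at \<open>[]\<close> the weight of the edge from
  \<open>v\<close> to its parent: a fringe subtree carries the edge it hangs from.\<close>

definition fringe_at :: "nat list \<Rightarrow> (nat list \<Rightarrow> nat \<times> real \<times> real) \<Rightarrow> nat list \<Rightarrow> nat \<times> real \<times> real" where
  "fringe_at v m = (\<lambda>w. m (v @ w))"

lemma fringe_at_apply [simp]: "fringe_at v m w = m (v @ w)"
  by (simp add: fringe_at_def)

lemma fringe_at_fringe_at [simp]: "fringe_at u (fringe_at v m) = fringe_at (v @ u) m"
  by (simp add: fringe_at_def)

lemma measurable_fringe_at [measurable]: "fringe_at v \<in> marks_space \<rightarrow>\<^sub>M marks_space"
  by (rule measurable_marksI) (simp add: measurable_mark)

definition set_edge_mark ::
  "nat list \<Rightarrow> real \<Rightarrow> (nat list \<Rightarrow> nat \<times> real \<times> real) \<Rightarrow> nat list \<Rightarrow> nat \<times> real \<times> real" where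
  "set_edge_mark v w m = m(v := (num_children m v, w, vertex_mark m v))"

lemma set_edge_mark_simps [simp]:
  "num_children (set_edge_mark v w m) u = num_children m u"
  "edge_mark (set_edge_mark v w m) v = w"
  "u \<noteq> v \<Longrightarrow> edge_mark (set_edge_mark v w m) u = edge_mark m u"
  "vertex_mark (set_edge_mark v w m) u = vertex_mark m u"
  by (simp_all add: set_edge_mark_def)

lemma measurable_fun_upd_marks [measurable (raw)]:
  assumes [measurable]: "f \<in> N \<rightarrow>\<^sub>M marks_space" "g \<in> N \<rightarrow>\<^sub>M count_space UNIV \<Otimes>\<^sub>M (borel \<Otimes>\<^sub>M borel)"
  shows "(\<lambda>x. (f x)(v := g x)) \<in> N \<rightarrow>\<^sub>M marks_space"
proof (rule measurable_marksI)
  have [measurable]: "(\<lambda>x. f x u) \<in> N \<rightarrow>\<^sub>M count_space UNIV \<Otimes>\<^sub>M (borel \<Otimes>\<^sub>M borel)" for u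
    using measurable_compose[OF assms(1) measurable_mark] .
  fix u show "(\<lambda>x. ((f x)(v := g x)) u) \<in> N \<rightarrow>\<^sub>M count_space UNIV \<Otimes>\<^sub>M (borel \<Otimes>\<^sub>M borel)"
    by (cases "u = v") simp_all
qed

lemma measurable_set_edge_mark [measurable (raw)]:
  assumes [measurable]: "f \<in> borel_measurable N" "g \<in> N \<rightarrow>\<^sub>M marks_space"
  shows "(\<lambda>x. set_edge_mark v (f x) (g x)) \<in> N \<rightarrow>\<^sub>M marks_space"
  unfolding set_edge_mark_def by measurable

section \<open>Independence and resampling under the law of the marks\<close>

locale weight_laws = W: real_distribution \<omega> + X: real_distribution \<xi>
  for \<omega> \<xi> :: "real measure"
begin

definition node :: "nat pmf \<Rightarrow> (nat \<times> real \<times> real) measure" where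
  "node p = measure_pmf p \<Otimes>\<^sub>M (\<omega> \<Otimes>\<^sub>M \<xi>)"

text \<open>Two laws of children because fringe subtrees follow \<open>gw q q\<close> while the
  whole tree follows \<open>gw p q\<close>.\<close>

definition gw :: "nat pmf \<Rightarrow> nat pmf \<Rightarrow> (nat list \<Rightarrow> nat \<times> real \<times> real) measure" where
  "gw p q = PiM UNIV (\<lambda>u. node (if u = [] then p else q))"

lemma ubgw_marks_eq_gw: "ubgw_marks p \<omega> \<xi> = gw p (size_biased p)"
  by (simp add: ubgw_marks_def gw_def node_def)

sublocale WX: pair_prob_space \<omega> \<xi> ..

lemma prob_space_node: "prob_space (node p)"
proof -
  interpret A: pair_prob_space "measure_pmf p" "\<omega> \<Otimes>\<^sub>M \<xi>" ..
  show ?thesis unfolding node_def by (rule A.prob_space_axioms)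
qed

lemma sets_node [measurable_cong]: "sets (node p) = sets (count_space UNIV \<Otimes>\<^sub>M (borel \<Otimes>\<^sub>M borel))"
  unfolding node_def by (intro sets_pair_measure_cong) simp_all

lemma sets_gw [measurable_cong]: "sets (gw p q) = sets marks_space"
  unfolding gw_def marks_space_def by (intro sets_PiM_cong sets_node) simp

lemma space_gw [simp]: "space (gw p q) = UNIV"
  using sets_eq_imp_space_eq[OF sets_gw] by simp

lemma prob_space_gw: "prob_space (gw p q)"
  unfolding gw_def by (intro prob_space_PiM prob_space_node)

lemma distr_fringe_at:
  assumes "v \<noteq> []"
  shows "distr (gw p q) marks_space (fringe_at v) = gw q q"
proof -
  let ?M = "\<lambda>u. node (if u = [] then p else q)"
  have "distr (PiM UNIV ?M) (PiM UNIV (\<lambda>u. ?M (v @ u))) (\<lambda>m. \<lambda>u\<in>UNIV. m (v @ u)) = PiM UNIV (\<lambda>u. ?M (v @ u))"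
    by (rule distr_PiM_reindex) (auto intro: prob_space_node injI)
  moreover have "PiM UNIV (\<lambda>u. ?M (v @ u)) = gw q q"
    using assms by (simp add: gw_def)
  ultimately have "distr (gw p q) (gw q q) (\<lambda>m. \<lambda>u\<in>UNIV. m (v @ u)) = gw q q"
    by (simp add: gw_def)
  moreover have "distr (gw p q) marks_space (fringe_at v) = distr (gw p q) (gw q q) (\<lambda>m. \<lambda>u\<in>UNIV. m (v @ u))"
    by (rule distr_cong) (auto simp: sets_gw fringe_at_def restrict_def)
  ultimately show ?thesis by simp
qed

lemma emeasure_node:
  assumes [measurable]: "C \<in> sets borel"
  shows "emeasure (node p) ({n} \<times> UNIV \<times> C) = ennreal (pmf p n) * emeasure \<xi> C"
proof -
  have "emeasure (node p) ({n} \<times> UNIV \<times> C) = emeasure (measure_pmf p) {n} * emeasure (\<omega> \<Otimes>\<^sub>M \<xi>) (UNIV \<times> C)"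
    unfolding node_def by (intro WX.emeasure_pair_measure_Times) auto
  also have "emeasure (\<omega> \<Otimes>\<^sub>M \<xi>) (UNIV \<times> C) = emeasure \<xi> C"
    using W.emeasure_space_1 by (subst X.emeasure_pair_measure_Times) auto
  finally show ?thesis by (simp add: emeasure_pmf_single)
qed

text \<open>The root mark and the branches use disjoint sets of coordinates of a product measure,
  and each branch has law \<open>gw q q\<close>.\<close>

lemma emeasure_gw_branches:
  assumes [measurable]: "C \<in> sets borel" "B \<in> sets marks_space"
  shows "emeasure (gw p q) {m. num_children m [] = n \<and> vertex_mark m [] \<in> C \<and> (\<forall>k<n. fringe_at [k] m \<in> B)} =
    ennreal (pmf p n) * emeasure \<xi> C * emeasure (gw q q) B ^ n"
proof -
  interpret P: prob_space "gw p q" by (rule prob_space_gw)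
  interpret Q: prob_space "gw q q" by (rule prob_space_gw)
  interpret N: prob_space "node p" by (rule prob_space_node)
  let ?M = "\<lambda>u. node (if u = [] then p else q)"
  have comp: "distr (gw p q) (?M u) (\<lambda>m. m u) = ?M u" for u
    unfolding gw_def by (rule distr_PiM_component) (auto intro: prob_space_node)
  have "P.indep_vars ?M (\<lambda>u m. m u) UNIV"
  proof (subst P.indep_vars_iff_distr_eq_PiM)
    have "distr (gw p q) (PiM UNIV ?M) (\<lambda>m. \<lambda>u\<in>UNIV. m u) = distr (gw p q) (gw p q) (\<lambda>m. m)"
      by (rule distr_cong) (auto simp: gw_def)
    then show "distr (gw p q) (PiM UNIV ?M) (\<lambda>m. \<lambda>u\<in>UNIV. m u) =
        PiM UNIV (\<lambda>u. distr (gw p q) (?M u) (\<lambda>m. m u))"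
      unfolding comp by (simp add: gw_def distr_id)
  qed (auto simp: gw_def)
  \<comment> \<open>\<open>None\<close> stands for the root coordinate, \<open>Some k\<close> for
    the coordinates of the \<open>k\<close>-th branch.\<close>
  moreover define K where "K j = (case j of None \<Rightarrow> {[]} | Some k \<Rightarrow> range (Cons k))" for j :: "nat option"
  ultimately have "P.indep_vars (\<lambda>j. PiM (K j) ?M) (\<lambda>j m. restrict (\<lambda>u. m u) (K j)) UNIV"
    by (intro P.indep_vars_restrict) (auto simp: disjoint_family_on_def K_def split: option.splits)
  \<comment> \<open>The root mark is coded as a constant family, so that all blocks take values in
    the same space \<open>marks_space\<close>.\<close>
  moreover define Y where "Y j m = (case j of None \<Rightarrow> (\<lambda>_. m []) | Some k \<Rightarrow> (\<lambda>w. m (k # w)))"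
    for j :: "nat option" and m :: "nat list \<Rightarrow> nat \<times> real \<times> real"
  have "Y j \<in> PiM (K j) ?M \<rightarrow>\<^sub>M marks_space" for j
  proof (rule measurable_marksI)
    fix u
    have *: "(\<lambda>m. m v) \<in> PiM (K j) ?M \<rightarrow>\<^sub>M count_space UNIV \<Otimes>\<^sub>M (borel \<Otimes>\<^sub>M borel)" if "v \<in> K j" for v
      using measurable_component_singleton[OF that, of ?M] sets_node
      by (simp cong: measurable_cong_sets)
    show "(\<lambda>m. Y j m u) \<in> PiM (K j) ?M \<rightarrow>\<^sub>M count_space UNIV \<Otimes>\<^sub>M (borel \<Otimes>\<^sub>M borel)"
      using *[of "[]"] *[of "the j # u"] by (cases j) (auto simp: Y_def K_def)
  qed
  ultimately have ind: "P.indep_vars (\<lambda>_. marks_space) (\<lambda>j m. Y j (restrict (\<lambda>u. m u) (K j))) UNIV"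
    by (rule P.indep_vars_compose2)
  have prob_branch: "P.prob (fringe_at [k] -` B) = Q.prob B" for k
  proof -
    have "Q.prob B = measure (distr (gw p q) marks_space (fringe_at [k])) B"
      by (simp add: distr_fringe_at)
    also have "\<dots> = P.prob (fringe_at [k] -` B)"
      by (subst measure_distr) auto
    finally show ?thesis by simp
  qed
  define A where "A j = (case j of None \<Rightarrow> {m. m [] \<in> {n} \<times> UNIV \<times> C} | Some k \<Rightarrow> B)" for j :: "nat option"
  have A0: "{m. m [] \<in> {n} \<times> UNIV \<times> C} \<in> sets marks_space"
    by (rule pred_marks_space) (simp add: mem_Times_iff)
  define J where "J = insert None (Some ` {..<n})"
  have "P.prob (\<Inter>j\<in>J. (\<lambda>m. Y j (restrict (\<lambda>u. m u) (K j))) -` A j \<inter> space (gw p q)) =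
      (\<Prod>j\<in>J. P.prob ((\<lambda>m. Y j (restrict (\<lambda>u. m u) (K j))) -` A j \<inter> space (gw p q)))"
    using A0 by (intro P.indep_varsD[OF ind]) (auto simp: J_def A_def split: option.splits)
  also have "(\<Inter>j\<in>J. (\<lambda>m. Y j (restrict (\<lambda>u. m u) (K j))) -` A j \<inter> space (gw p q)) =
      {m. num_children m [] = n \<and> vertex_mark m [] \<in> C \<and> (\<forall>k<n. fringe_at [k] m \<in> B)}"
    by (auto simp: J_def A_def Y_def K_def fringe_at_def mem_Times_iff)
  also have "(\<Prod>j\<in>J. P.prob ((\<lambda>m. Y j (restrict (\<lambda>u. m u) (K j))) -` A j \<inter> space (gw p q))) =
      P.prob {m. m [] \<in> {n} \<times> UNIV \<times> C} * (\<Prod>k<n. P.prob (fringe_at [k] -` B))"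
  proof -
    have "(\<lambda>m. Y (Some k) (restrict (\<lambda>u. m u) (K (Some k)))) -` A (Some k) = fringe_at [k] -` B" for k
      by (auto simp: A_def Y_def K_def fringe_at_def)
    moreover have "(\<lambda>m. Y None (restrict (\<lambda>u. m u) (K None))) -` A None = {m. m [] \<in> {n} \<times> UNIV \<times> C}"
      by (auto simp: A_def Y_def K_def)
    ultimately show ?thesis
      by (simp add: J_def prod.insert_if prod.reindex image_iff)
  qed
  also have "P.prob {m. m [] \<in> {n} \<times> UNIV \<times> C} = N.prob ({n} \<times> UNIV \<times> C)"
  proof -
    have "N.prob ({n} \<times> UNIV \<times> C) = measure (distr (gw p q) (node p) (\<lambda>m. m [])) ({n} \<times> UNIV \<times> C)"
      using comp[of "[]"] by simp
    also have "\<dots> = P.prob {m. m [] \<in> {n} \<times> UNIV \<times> C}"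
      by (subst measure_distr, subst measurable_cong_sets[OF sets_gw sets_node])
        (auto simp: sets_node vimage_def measurable_mark)
    finally show ?thesis by simp
  qed
  finally have eq: "P.prob {m. num_children m [] = n \<and> vertex_mark m [] \<in> C \<and> (\<forall>k<n. fringe_at [k] m \<in> B)} =
      N.prob ({n} \<times> UNIV \<times> C) * Q.prob B ^ n"
    by (simp only: prob_branch prod_constant card_lessThan)
  show ?thesis
    unfolding P.emeasure_eq_measure Q.emeasure_eq_measure emeasure_node[OF assms(1), symmetric]
      N.emeasure_eq_measure eq
    by (simp only: ennreal_mult'[OF measure_nonneg] ennreal_power[OF measure_nonneg])
qed

lemma emeasure_gw_root:
  assumes [measurable]: "C \<in> sets borel" "B \<in> sets marks_space"
  shows "emeasure (gw p q) {m. vertex_mark m [] \<in> C \<and> (\<forall>k<num_children m []. fringe_at [k] m \<in> B)} =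
    (\<Sum>n. ennreal (pmf p n) * emeasure \<xi> C * emeasure (gw q q) B ^ n)"
proof -
  let ?E = "\<lambda>n. {m. num_children m [] = n \<and> vertex_mark m [] \<in> C \<and> (\<forall>k<n. fringe_at [k] m \<in> B)}"
  have [measurable]: "?E n \<in> sets marks_space" for n
    by (rule pred_marks_space) measurable
  have "{m. vertex_mark m [] \<in> C \<and> (\<forall>k<num_children m []. fringe_at [k] m \<in> B)} = (\<Union>n. ?E n)"
    by auto
  also have "emeasure (gw p q) (\<Union>n. ?E n) = (\<Sum>n. emeasure (gw p q) (?E n))"
    by (rule suminf_emeasure[symmetric]) (auto simp: disjoint_family_on_def sets_gw)
  finally show ?thesis
    by (simp only: emeasure_gw_branches[OF assms])
qed

lemma nn_integral_node_edge_mark: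
  assumes [measurable]: "f \<in> borel_measurable (count_space UNIV \<Otimes>\<^sub>M (borel \<Otimes>\<^sub>M borel))"
  shows "(\<integral>\<^sup>+w. (\<integral>\<^sup>+y. f (fst y, w, snd (snd y)) \<partial>node p) \<partial>\<omega>) = (\<integral>\<^sup>+y. f y \<partial>node p)"
proof -
  interpret A: pair_prob_space "measure_pmf p" "\<omega> \<Otimes>\<^sub>M \<xi>" ..
  interpret B: pair_prob_space \<omega> "measure_pmf p" ..
  have node: "(\<integral>\<^sup>+y. g y \<partial>node p) = (\<integral>\<^sup>+n. \<integral>\<^sup>+w. \<integral>\<^sup>+x. g (n, w, x) \<partial>\<xi> \<partial>\<omega> \<partial>measure_pmf p)"
    if [measurable]: "g \<in> borel_measurable (count_space UNIV \<Otimes>\<^sub>M (borel \<Otimes>\<^sub>M borel))" for g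
  proof -
    have "(\<integral>\<^sup>+y. g y \<partial>node p) = (\<integral>\<^sup>+n. \<integral>\<^sup>+z. g (n, z) \<partial>(\<omega> \<Otimes>\<^sub>M \<xi>) \<partial>measure_pmf p)"
      unfolding node_def by (rule WX.nn_integral_fst[symmetric]) measurable
    also have "\<dots> = (\<integral>\<^sup>+n. \<integral>\<^sup>+w. \<integral>\<^sup>+x. g (n, w, x) \<partial>\<xi> \<partial>\<omega> \<partial>measure_pmf p)"
      by (intro nn_integral_cong, rule X.nn_integral_fst[symmetric]) measurable
    finally show ?thesis .
  qed
  have "(\<integral>\<^sup>+w. (\<integral>\<^sup>+y. f (fst y, w, snd (snd y)) \<partial>node p) \<partial>\<omega>) =
      (\<integral>\<^sup>+w. \<integral>\<^sup>+n. \<integral>\<^sup>+x. f (n, w, x) \<partial>\<xi> \<partial>measure_pmf p \<partial>\<omega>)"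
    using W.emeasure_space_1 by (subst node) simp_all
  also have "\<dots> = (\<integral>\<^sup>+n. \<integral>\<^sup>+w. \<integral>\<^sup>+x. f (n, w, x) \<partial>\<xi> \<partial>\<omega> \<partial>measure_pmf p)"
    by (rule B.Fubini'[symmetric]) measurable
  also have "\<dots> = (\<integral>\<^sup>+y. f y \<partial>node p)"
    by (rule node[symmetric]) measurable
  finally show ?thesis .
qed

lemma nn_integral_gw_mark:
  assumes [measurable]: "f \<in> borel_measurable marks_space"
  shows "(\<integral>\<^sup>+m. f m \<partial>gw p q) =
    (\<integral>\<^sup>+m. (\<integral>\<^sup>+y. f (m(v := y)) \<partial>node (if v = [] then p else q)) \<partial>gw p q)"
proof -
  let ?N = "node (if v = [] then p else q)"
  interpret N: prob_space ?N by (rule prob_space_node)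
  interpret P: prob_space "gw p q" by (rule prob_space_gw)
  interpret NP: pair_prob_space ?N "gw p q" ..
  have "gw p q = distr (?N \<Otimes>\<^sub>M gw p q) (gw p q) (\<lambda>(x, m). m(v := x))"
    using distr_pair_PiM_eq_PiM[of UNIV "\<lambda>u. node (if u = [] then p else q)" v] prob_space_node
    by (simp add: gw_def)
  then have "(\<integral>\<^sup>+m. f m \<partial>gw p q) = (\<integral>\<^sup>+m. f m \<partial>distr (?N \<Otimes>\<^sub>M gw p q) (gw p q) (\<lambda>(x, m). m(v := x)))"
    by simp
  also have "\<dots> = (\<integral>\<^sup>+z. f (case z of (x, m) \<Rightarrow> m(v := x)) \<partial>(?N \<Otimes>\<^sub>M gw p q))"
    by (subst nn_integral_distr) auto
  also have "\<dots> = (\<integral>\<^sup>+m. (\<integral>\<^sup>+y. f (m(v := y)) \<partial>?N) \<partial>gw p q)"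
    by (subst NP.nn_integral_snd[symmetric]) auto
  finally show ?thesis .
qed

text \<open>The edge mark at \<open>v\<close> has law \<omega> and is independent of all other
  marks, so a fresh copy may replace it. This turns invariance under \<open>set_edge_mark\<close>
  into independence.\<close>

lemma nn_integral_resample:
  assumes [measurable]: "f \<in> borel_measurable marks_space"
  shows "(\<integral>\<^sup>+m. f m \<partial>gw p q) = (\<integral>\<^sup>+w. (\<integral>\<^sup>+m. f (set_edge_mark v w m) \<partial>gw p q) \<partial>\<omega>)"
proof -
  let ?N = "node (if v = [] then p else q)"
  interpret P: prob_space "gw p q" by (rule prob_space_gw)
  interpret N: prob_space ?N by (rule prob_space_node)
  interpret WP: pair_prob_space \<omega> "gw p q" ..
  have "(\<integral>\<^sup>+w. (\<integral>\<^sup>+m. f (set_edge_mark v w m) \<partial>gw p q) \<partial>\<omega>) =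
      (\<integral>\<^sup>+w. (\<integral>\<^sup>+m. (\<integral>\<^sup>+y. f (m(v := (fst y, w, snd (snd y)))) \<partial>?N) \<partial>gw p q) \<partial>\<omega>)"
    by (subst nn_integral_gw_mark[where v = v]) (auto simp: set_edge_mark_def)
  also have "\<dots> = (\<integral>\<^sup>+m. (\<integral>\<^sup>+w. (\<integral>\<^sup>+y. f (m(v := (fst y, w, snd (snd y)))) \<partial>?N) \<partial>\<omega>) \<partial>gw p q)"
    by (rule WP.Fubini'[symmetric]) measurable
  also have "\<dots> = (\<integral>\<^sup>+m. (\<integral>\<^sup>+y. f (m(v := y)) \<partial>?N) \<partial>gw p q)"
    by (subst nn_integral_node_edge_mark) auto
  also have "\<dots> = (\<integral>\<^sup>+m. f m \<partial>gw p q)"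
    by (rule nn_integral_gw_mark[symmetric]) measurable
  finally show ?thesis by simp
qed

text \<open>After resampling, the threshold \<open>T\<close> is fixed when the fresh weight is
  integrated, and \<omega> gives no mass to a point.\<close>

lemma AE_edge_mark_neq:
  assumes "atoms \<omega> = {}" and [measurable]: "T \<in> borel_measurable marks_space"
    and T: "\<And>w m. T (set_edge_mark v w m) = T m"
  shows "AE m in gw p q. edge_mark m v \<noteq> T m"
proof -
  interpret P: prob_space "gw p q" by (rule prob_space_gw)
  interpret WP: pair_prob_space \<omega> "gw p q" ..
  have atom: "emeasure \<omega> {a} = 0" for a
    using assms(1) measure_nonneg[of \<omega> "{a}"] unfolding atoms_def W.emeasure_eq_measure
    by (metis (mono_tags, lifting) empty_Collect_eq ennreal_0 less_eq_real_def)
  have "{m \<in> space marks_space. edge_mark m v = T m} \<in> sets marks_space"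
    by (rule borel_measurable_eq) measurable
  then have [measurable]: "{m. edge_mark m v = T m} \<in> sets marks_space" by simp
  have "(\<integral>\<^sup>+m. indicator {m. edge_mark m v = T m} m \<partial>gw p q) =
      (\<integral>\<^sup>+w. (\<integral>\<^sup>+m. indicator {m. edge_mark m v = T m} (set_edge_mark v w m) \<partial>gw p q) \<partial>\<omega>)"
    by (rule nn_integral_resample) simp
  also have "\<dots> = (\<integral>\<^sup>+w. (\<integral>\<^sup>+m. indicator {T m} w \<partial>gw p q) \<partial>\<omega>)"
    by (intro nn_integral_cong) (auto simp: T split: split_indicator)
  also have "\<dots> = (\<integral>\<^sup>+m. (\<integral>\<^sup>+w. indicator {T m} w \<partial>\<omega>) \<partial>gw p q)"
    by (rule WP.Fubini'[symmetric]) (simp add: indicator_def)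
  also have "\<dots> = 0"
    by (simp add: atom)
  finally have "(\<integral>\<^sup>+m. indicator {m. edge_mark m v = T m} m \<partial>gw p q) = 0" .
  then have "AE m in gw p q. indicator {m. edge_mark m v = T m} m = (0::ennreal)"
    by (subst (asm) nn_integral_0_iff_AE) simp_all
  then show ?thesis
    by eventually_elim (auto split: split_indicator_asm)
qed

end

section \<open>Messages along fringe subtrees\<close>

definition mark_base :: "(nat list \<Rightarrow> nat \<times> real \<times> real) \<Rightarrow> real" where
  "mark_base m = vertex_mark m []"

definition mark_weight :: "(nat list \<Rightarrow> nat \<times> real \<times> real) \<Rightarrow> real" where
  "mark_weight m = edge_mark m []"

text \<open>The mark families themselves are the indices, so a message becomes a function on
  \<open>marks_space\<close>. Children with identical branches merge into one successor, which a
  maximum does not notice.\<close>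

definition mark_succ ::
  "(nat list \<Rightarrow> nat \<times> real \<times> real) \<Rightarrow> (nat list \<Rightarrow> nat \<times> real \<times> real) set" where
  "mark_succ m = (\<lambda>k. fringe_at [k] m) ` {..<num_children m []}"

interpretation fringe: max_minus mark_base mark_weight mark_succ
  by standard (simp add: mark_succ_def)

lemma fringe_step_le_iff: "fringe.step Z m \<le> t \<longleftrightarrow> vertex_mark m [] \<le> t \<and>
    (\<forall>k<num_children m []. edge_mark m [k] - Z (fringe_at [k] m) \<le> t)"
  by (auto simp: fringe.step_le_iff mark_base_def mark_weight_def mark_succ_def)

lemma fringe_step_less_iff: "fringe.step Z m < t \<longleftrightarrow> vertex_mark m [] < t \<and>
    (\<forall>k<num_children m []. edge_mark m [k] - Z (fringe_at [k] m) < t)"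
  by (auto simp: fringe.step_less_iff mark_base_def mark_weight_def mark_succ_def)

text \<open>The edge mark at the root enters only in the step of the parent.\<close>

lemma fringe_step_set_edge_mark: "fringe.step Z (set_edge_mark [] w m) = fringe.step Z m"
proof -
  have "fringe_at [k] (set_edge_mark [] w m) = fringe_at [k] m" for k
    by (auto simp: fringe_at_def set_edge_mark_def)
  then show ?thesis
    by (simp add: fringe.step_def mark_base_def mark_succ_def)
qed

lemma fringe_set_edge_mark [simp]:
  "fringe.lo (set_edge_mark [] w m) = fringe.lo m"
  "fringe.hi (set_edge_mark [] w m) = fringe.hi m"
  by (simp_all flip: fringe.step_lo fringe.step_hi add: fringe_step_set_edge_mark)

lemma measurable_fringe_iter: "fringe.iter n \<in> borel_measurable marks_space"
proof (induction n)
  case 0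
  have "mark_base \<in> borel_measurable marks_space" unfolding mark_base_def[abs_def] by measurable
  then show ?case by (simp only: fringe.iter_0)
next
  case (Suc n)
  note [measurable] = Suc
  have "{m \<in> space marks_space. fringe.step (fringe.iter n) m \<le> t} \<in> sets marks_space" for t
    unfolding fringe_step_le_iff by measurable
  then show ?case
    by (simp add: borel_measurable_iff_le)
qed

lemma measurable_fringe [measurable]:
  "fringe.lo \<in> borel_measurable marks_space" "fringe.hi \<in> borel_measurable marks_space"
proof -
  show "fringe.lo \<in> borel_measurable marks_space"
    by (rule borel_measurable_LIMSEQ_real[OF fringe.tendsto_lo measurable_fringe_iter])
  show "fringe.hi \<in> borel_measurable marks_space"
    by (rule borel_measurable_LIMSEQ_real[OF fringe.tendsto_hi measurable_fringe_iter])
qed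

text \<open>This is the integral of \<open>F ^ n\<close> against \<open>dF\<close> for a continuous
  distribution function \<open>F\<close>. The quantile map \<open>I\<close> turns it into the
  integral of \<open>u ^ n\<close> from \<open>F x\<close> to \<open>1\<close>.\<close>

lemma (in cdf_distribution) nn_integral_cdf_power:
  assumes atomless: "\<And>x. measure M {x} = 0"
  shows "(\<integral>\<^sup>+a. ennreal (cdf M a ^ n) * indicator {x<..} a \<partial>M) =
    ennreal ((1 - cdf M x ^ Suc n) / real (Suc n))"
proof -
  have isCont: "isCont (cdf M) x" for x
    by (simp add: isCont_cdf atomless)
  \<comment> \<open>To the left of \<open>I u\<close> the distribution function stays at most
    \<open>u\<close>; continuity carries this bound to \<open>I u\<close> itself.\<close>
  have CI: "cdf M (I u) = u" if u: "0 < u" "u < 1" for u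
  proof (rule antisym)
    show "u \<le> cdf M (I u)" using pseudoinverse[OF u] by blast
    have "eventually (\<lambda>y. cdf M y \<le> u) (at_left (I u))"
    proof (rule eventually_mono)
      show "eventually (\<lambda>y. y < I u) (at_left (I u))"
        by (simp add: eventually_at_filter)
      show "cdf M y \<le> u" if "y < I u" for y
        using pseudoinverse[OF u, of y] that by linarith
    qed
    moreover have "((cdf M) \<longlongrightarrow> cdf M (I u)) (at_left (I u))"
      using isCont[of "I u"] by (auto simp: isCont_def intro: tendsto_within_subset)
    ultimately show "cdf M (I u) \<le> u"
      by (intro tendsto_upperbound[where F = "at_left (I u)"]) auto
  qed
  have "(\<integral>\<^sup>+a. ennreal (cdf M a ^ n) * indicator {x<..} a \<partial>M) =
      (\<integral>\<^sup>+a. ennreal (cdf M a ^ n) * indicator {x<..} a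
        \<partial>distr (restrict_space lborel {0<..<1::real}) borel I)"
    by (simp only: distr_I_eq_M)
  also have "\<dots> = (\<integral>\<^sup>+u. ennreal (cdf M (I u) ^ n) * indicator {x<..} (I u) \<partial>restrict_space lborel {0<..<1::real})"
    by (rule nn_integral_distr) (auto intro: measurable_CI)
  also have "\<dots> = (\<integral>\<^sup>+u. ennreal (cdf M (I u) ^ n) * indicator {x<..} (I u) * indicator {0<..<1} u \<partial>lborel)"
    by (rule nn_integral_restrict_space) simp
  also have "\<dots> = (\<integral>\<^sup>+u. ennreal (u ^ n) * indicator {cdf M x..1} u \<partial>lborel)"
  proof (rule nn_integral_cong_AE)
    have "AE u in lborel. u \<noteq> 0 \<and> u \<noteq> 1 \<and> u \<noteq> cdf M x"
      using AE_lborel_singleton[of "0::real"] AE_lborel_singleton[of "1::real"] AE_lborel_singleton[of "cdf M x"]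
      by eventually_elim auto
    then show "AE u in lborel. ennreal (cdf M (I u) ^ n) * indicator {x<..} (I u) * indicator {0<..<1} u =
        ennreal (u ^ n) * indicator {cdf M x..1} u"
    proof eventually_elim
      case (elim u)
      have "0 \<le> cdf M x" by (rule cdf_nonneg)
      show ?case
      proof (cases "0 < u \<and> u < 1")
        case True
        then have "x < I u \<longleftrightarrow> cdf M x < u"
          using pseudoinverse[of u x] by auto
        then show ?thesis
          using True elim CI[of u] by (auto simp: indicator_def)
      next
        case False
        then show ?thesis
          using elim \<open>0 \<le> cdf M x\<close> by (auto simp: indicator_def)
      qed
    qed
  qed
  also have "\<dots> = ennreal (1 ^ Suc n / real (Suc n) - cdf M x ^ Suc n / real (Suc n))"
  proof (rule nn_integral_FTC_Icc)
    fix u :: real assume "u \<in> {cdf M x..1}"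
    then have "0 \<le> u" using cdf_nonneg[of x] by auto
    then show "0 \<le> u ^ n" by simp
    show "((\<lambda>u. u ^ Suc n / real (Suc n)) has_real_derivative u ^ n) (at u)"
      using DERIV_cdivide[OF DERIV_pow[of "Suc n" u], of "real (Suc n)"]
      by (simp del: of_nat_Suc power_Suc)
  qed (auto simp: cdf_bounded_prob)
  finally show ?thesis
    by (simp add: diff_divide_distrib)
qed

text \<open>The formula defines a probability because shifting the index in the series of the mean
  leaves its sum unchanged: the term at \<open>0\<close> vanishes.\<close>

lemma pmf_size_biased:
  assumes "integrable (measure_pmf \<pi>) real" "measure_pmf.expectation \<pi> real > 0"
  shows "pmf (size_biased \<pi>) k = real (k + 1) * pmf \<pi> (k + 1) / measure_pmf.expectation \<pi> real"
proof -
  let ?E = "measure_pmf.expectation \<pi> real"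
  have "(\<Sum>k. ennreal (real k * pmf \<pi> k)) = (\<integral>\<^sup>+k. ennreal (real k) \<partial>measure_pmf \<pi>)"
    by (simp add: nn_integral_measure_pmf nn_integral_count_space_nat ennreal_mult' mult.commute)
  also have "\<dots> = ennreal ?E"
    by (rule nn_integral_eq_integral) (use assms in auto)
  finally have sum: "(\<Sum>k. ennreal (real k * pmf \<pi> k)) = ennreal ?E" .
  have "(\<Sum>k. ennreal (real (k + 1) * pmf \<pi> (k + 1))) = (\<Sum>k. ennreal (real k * pmf \<pi> k))"
    by (subst (2) suminf_offset[where i = 1]) (simp_all add: summableI)
  then have "(\<Sum>k. ennreal (real (k + 1) * pmf \<pi> (k + 1)) / ennreal ?E) = ennreal ?E / ennreal ?E"
    by (simp only: ennreal_suminf_divide sum)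
  then have "(\<integral>\<^sup>+k. ennreal (real (k + 1) * pmf \<pi> (k + 1) / ?E) \<partial>count_space UNIV) = ennreal ?E / ennreal ?E"
    using assms(2) by (simp only: nn_integral_count_space_nat divide_ennreal mult_nonneg_nonneg of_nat_0_le_iff pmf_nonneg)
  also have "\<dots> = 1"
    using assms(2) by (simp add: divide_ennreal)
  finally show ?thesis
    unfolding size_biased_def using assms(2) by (subst pmf_embed_pmf) auto
qed

section \<open>Balance of the two solutions\<close>

locale ubgw_laws = weight_laws +
  fixes \<pi> :: "nat pmf"
  assumes integrable_offspring: "integrable (measure_pmf \<pi>) real"
    and mean_pos: "measure_pmf.expectation \<pi> real > 0"
    and atomless: "atoms \<omega> = {}"
begin

abbreviation "Q \<equiv> gw (size_biased \<pi>) (size_biased \<pi>)"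

sublocale Q: prob_space Q by (rule prob_space_gw)

text \<open>The law of the net gain from matching a vertex with a child: edge weight minus the
  message of the child.\<close>

definition surplus :: "((nat list \<Rightarrow> nat \<times> real \<times> real) \<Rightarrow> real) \<Rightarrow> real measure" where
  "surplus Z = distr Q borel (\<lambda>m. edge_mark m [] - Z m)"

text \<open>Under \<open>Q\<close> such a message is independent of the edge weight at the root of
  its subtree, by \<open>nn_integral_resample\<close>.\<close>

definition edge_free :: "((nat list \<Rightarrow> nat \<times> real \<times> real) \<Rightarrow> real) \<Rightarrow> bool" where
  "edge_free Z \<longleftrightarrow> Z \<in> borel_measurable marks_space \<and> (\<forall>w m. Z (set_edge_mark [] w m) = Z m)"

lemma edge_free_fringe: "edge_free fringe.lo" "edge_free fringe.hi"
  by (simp_all add: edge_free_def measurable_fringe)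

context
  fixes Z Z' :: "(nat list \<Rightarrow> nat \<times> real \<times> real) \<Rightarrow> real"
  assumes Z: "edge_free Z" and Z': "edge_free Z'"
begin

lemma edge_free_measurable [measurable]: "Z \<in> borel_measurable marks_space"
  using Z by (simp add: edge_free_def)

lemma edge_free_measurable' [measurable]: "Z' \<in> borel_measurable marks_space"
  using Z' by (simp add: edge_free_def)

lemma real_distribution_surplus: "real_distribution (surplus Z)"
  unfolding surplus_def by (rule Q.real_distribution_distr) measurable

lemma surplus_atomless: "measure (surplus Z) {t} = 0"
proof -
  interpret S: real_distribution "surplus Z" by (rule real_distribution_surplus)
  have "AE m in Q. edge_mark m [] \<noteq> Z m + t"
    using Z by (intro AE_edge_mark_neq[OF atomless]) (auto simp: edge_free_def)
  then have "AE a in surplus Z. a \<noteq> t"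
    unfolding surplus_def by (subst AE_distr_iff) (auto simp: algebra_simps)
  then show ?thesis
    by (subst S.prob_eq_0) (auto elim: eventually_mono)
qed

text \<open>A step stays below \<open>t\<close> when the root weight and the surpluses of all
  children do, and these are independent. Since the surplus has no atoms, its distribution function
  may stand for strict inequalities.\<close>

lemma emeasure_step_less:
  assumes step: "Z' = fringe.step Z"
  shows "emeasure Q {m. Z' m < t} =
    (\<Sum>n. ennreal (pmf (size_biased \<pi>) n) * emeasure \<xi> {..<t} * ennreal (cdf (surplus Z) t ^ n))"
proof -
  interpret S: real_distribution "surplus Z" by (rule real_distribution_surplus)
  have [measurable]: "{m. edge_mark m [] - Z m < t} \<in> sets marks_space"
    by (rule pred_marks_space) measurable
  have "emeasure Q {m. edge_mark m [] - Z m < t} = emeasure (surplus Z) {..<t}"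
    unfolding surplus_def by (subst emeasure_distr) (auto intro!: arg_cong[where f = "emeasure Q"])
  also have "\<dots> = emeasure (surplus Z) {..t}"
  proof -
    have "{..t} = {..<t} \<union> {t}" by auto
    then have "S.prob {..t} = S.prob {..<t} + S.prob {t}"
      by (simp only:) (rule S.finite_measure_Union, auto)
    then show ?thesis
      by (simp add: S.emeasure_eq_measure surplus_atomless)
  qed
  finally have less: "emeasure Q {m. edge_mark m [] - Z m < t} = ennreal (cdf (surplus Z) t)"
    by (simp add: cdf_def S.emeasure_eq_measure)
  have "{m. Z' m < t} = {m. vertex_mark m [] \<in> {..<t} \<and>
      (\<forall>k<num_children m []. fringe_at [k] m \<in> {m. edge_mark m [] - Z m < t})}"
    by (simp add: step fringe_step_less_iff)
  then show ?thesis
    by (simp only: emeasure_gw_root[of "{..<t}" "{m. edge_mark m [] - Z m < t}"]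
        lessThan_borel less ennreal_power[OF S.cdf_nonneg] \<open>{m. edge_mark m [] - Z m < t} \<in> sets marks_space\<close>)
qed

text \<open>The left side is the probability that a root with offspring law \<pi> is matched, some
  surplus exceeding its weight. Isolating the child with the largest surplus \<open>a\<close> leaves
  a root with size-biased offspring whose message \<open>Z'\<close> must lie below
  \<open>a\<close>.\<close>

lemma matched_integral:
  assumes step: "Z' = fringe.step Z"
  shows "(\<integral>\<^sup>+x. (\<Sum>n. ennreal (pmf \<pi> (Suc n) * (1 - cdf (surplus Z) x ^ Suc n))) \<partial>\<xi>) =
    ennreal (measure_pmf.expectation \<pi> real) * (\<integral>\<^sup>+a. emeasure Q {m. Z' m < a} \<partial>surplus Z)"
proof -
  interpret S: cdf_distribution "surplus Z"
    unfolding cdf_distribution_def by (rule real_distribution_surplus)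
  interpret XS: pair_prob_space \<xi> "surplus Z" ..
  let ?E = "measure_pmf.expectation \<pi> real" and ?c = "cdf (surplus Z)"
  \<comment> \<open>The largest of \<open>n + 1\<close> surpluses has law
    \<open>(n + 1) * c ^ n dc\<close>, and \<open>(n + 1) * pmf \<pi> (n + 1)\<close> is the mean
    times the size-biased weight of \<open>n\<close>.\<close>
  have pmf: "ennreal (pmf \<pi> (Suc n) * (1 - ?c x ^ Suc n)) =
      ennreal (?E * pmf (size_biased \<pi>) n) * (\<integral>\<^sup>+a. ennreal (?c a ^ n) * indicator {0<..} (a - x) \<partial>surplus Z)" for n x
  proof -
    have "?c x ^ Suc n \<le> 1"
      by (intro power_le_one S.cdf_nonneg S.cdf_bounded_prob)
    then have "ennreal (?E * pmf (size_biased \<pi>) n) * ennreal ((1 - ?c x ^ Suc n) / real (Suc n)) =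
        ennreal (?E * pmf (size_biased \<pi>) n * ((1 - ?c x ^ Suc n) / real (Suc n)))"
      using mean_pos by (intro ennreal_mult[symmetric]) auto
    moreover have "?E * pmf (size_biased \<pi>) n = real (Suc n) * pmf \<pi> (Suc n)"
      using mean_pos by (simp add: pmf_size_biased[OF integrable_offspring mean_pos])
    ultimately show ?thesis
      using S.nn_integral_cdf_power[OF surplus_atomless, of n x]
      by (simp add: indicator_def del: power_Suc of_nat_Suc)
  qed
  have [measurable]: "?c \<in> borel_measurable borel" by (rule S.measurable_C)
  have [measurable]: "(\<lambda>a. emeasure \<xi> {..<a}) \<in> borel_measurable borel"
  proof -
    have "emeasure \<xi> {..<a} = (\<integral>\<^sup>+x. indicator {0<..} (a - x) \<partial>\<xi>)" for a
    proof -
      have "(\<integral>\<^sup>+x. indicator {0<..} (a - x) \<partial>\<xi>) = (\<integral>\<^sup>+x. indicator {..<a} x \<partial>\<xi>)"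
        by (intro nn_integral_cong) (auto simp: indicator_def)
      then show ?thesis by simp
    qed
    then show ?thesis by simp
  qed
  have "(\<integral>\<^sup>+x. (\<Sum>n. ennreal (pmf \<pi> (Suc n) * (1 - ?c x ^ Suc n))) \<partial>\<xi>) =
      (\<Sum>n. \<integral>\<^sup>+x. ennreal (pmf \<pi> (Suc n) * (1 - ?c x ^ Suc n)) \<partial>\<xi>)"
    by (rule nn_integral_suminf) measurable
  also have "\<dots> = (\<Sum>n. \<integral>\<^sup>+a. ennreal ?E * (ennreal (pmf (size_biased \<pi>) n) * emeasure \<xi> {..<a} * ennreal (?c a ^ n)) \<partial>surplus Z)"
  proof (intro suminf_cong)
    fix n
    have "(\<integral>\<^sup>+x. ennreal (pmf \<pi> (Suc n) * (1 - ?c x ^ Suc n)) \<partial>\<xi>) =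
        (\<integral>\<^sup>+x. \<integral>\<^sup>+a. ennreal (?E * pmf (size_biased \<pi>) n) * (ennreal (?c a ^ n) * indicator {0<..} (a - x)) \<partial>surplus Z \<partial>\<xi>)"
      unfolding pmf by (intro nn_integral_cong nn_integral_cmult[symmetric]) measurable
    also have "\<dots> = (\<integral>\<^sup>+a. \<integral>\<^sup>+x. ennreal (?E * pmf (size_biased \<pi>) n) * (ennreal (?c a ^ n) * indicator {0<..} (a - x)) \<partial>\<xi> \<partial>surplus Z)"
      by (rule XS.Fubini'[symmetric]) measurable
    also have "\<dots> = (\<integral>\<^sup>+a. ennreal (?E * pmf (size_biased \<pi>) n) * (ennreal (?c a ^ n) * emeasure \<xi> {..<a}) \<partial>surplus Z)"
    proof (intro nn_integral_cong)
      fix a :: real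
      have "(\<integral>\<^sup>+x. indicator {0<..} (a - x) \<partial>\<xi>) = (\<integral>\<^sup>+x. indicator {..<a} x \<partial>\<xi>)"
        by (intro nn_integral_cong) (auto simp: indicator_def)
      then show "(\<integral>\<^sup>+x. ennreal (?E * pmf (size_biased \<pi>) n) * (ennreal (?c a ^ n) * indicator {0<..} (a - x)) \<partial>\<xi>) =
          ennreal (?E * pmf (size_biased \<pi>) n) * (ennreal (?c a ^ n) * emeasure \<xi> {..<a})"
        by (simp add: nn_integral_cmult)
    qed
    also have "\<dots> = (\<integral>\<^sup>+a. ennreal ?E * (ennreal (pmf (size_biased \<pi>) n) * emeasure \<xi> {..<a} * ennreal (?c a ^ n)) \<partial>surplus Z)"
      using mean_pos by (simp add: ennreal_mult' ac_simps)
    finally show "(\<integral>\<^sup>+x. ennreal (pmf \<pi> (Suc n) * (1 - ?c x ^ Suc n)) \<partial>\<xi>) = \<dots>" .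
  qed
  also have "\<dots> = (\<integral>\<^sup>+a. (\<Sum>n. ennreal ?E * (ennreal (pmf (size_biased \<pi>) n) * emeasure \<xi> {..<a} * ennreal (?c a ^ n))) \<partial>surplus Z)"
    by (rule nn_integral_suminf[symmetric]) measurable
  also have "\<dots> = (\<integral>\<^sup>+a. ennreal ?E * emeasure Q {m. Z' m < a} \<partial>surplus Z)"
    by (simp only: ennreal_suminf_cmult emeasure_step_less[OF step])
  also have "\<dots> = ennreal ?E * (\<integral>\<^sup>+a. emeasure Q {m. Z' m < a} \<partial>surplus Z)"
    unfolding emeasure_step_less[OF step] by (intro nn_integral_cmult borel_measurable_suminf) measurable
  finally show ?thesis .
qed

text \<open>Resampling exposes the edge weight \<open>w\<close>: the quantity is the probability
  that \<open>w\<close> exceeds the messages of two independent subtrees at its ends.\<close>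

lemma surplus_integral:
  "(\<integral>\<^sup>+a. emeasure Q {m. Z' m < a} \<partial>surplus Z) =
    (\<integral>\<^sup>+w. (\<integral>\<^sup>+m. (\<integral>\<^sup>+m'. indicator {0<..} (w - (Z m + Z' m')) \<partial>Q) \<partial>Q) \<partial>\<omega>)"
proof -
  have "emeasure Q {m. Z' m < a} = (\<integral>\<^sup>+m'. indicator {0<..} (a - Z' m') \<partial>Q)" for a
  proof -
    have "(\<integral>\<^sup>+m'. indicator {0<..} (a - Z' m') \<partial>Q) = (\<integral>\<^sup>+m'. indicator {m. Z' m < a} m' \<partial>Q)"
      by (intro nn_integral_cong) (auto simp: indicator_def)
    then show ?thesis
      by (simp add: sets_gw pred_marks_space)
  qed
  then have "(\<integral>\<^sup>+a. emeasure Q {m. Z' m < a} \<partial>surplus Z) =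
      (\<integral>\<^sup>+a. (\<integral>\<^sup>+m'. indicator {0<..} (a - Z' m') \<partial>Q) \<partial>surplus Z)" by simp
  also have "\<dots> = (\<integral>\<^sup>+m. (\<integral>\<^sup>+m'. indicator {0<..} (edge_mark m [] - Z m - Z' m') \<partial>Q) \<partial>Q)"
    unfolding surplus_def by (rule nn_integral_distr) measurable
  also have "\<dots> = (\<integral>\<^sup>+w. (\<integral>\<^sup>+m. (\<integral>\<^sup>+m'. indicator {0<..} (w - (Z m + Z' m')) \<partial>Q) \<partial>Q) \<partial>\<omega>)"
    using Z by (subst nn_integral_resample[where v = "[]"]) (auto simp: edge_free_def algebra_simps)
  finally show ?thesis .
qed

end

text \<open>Both ends of the edge carry subtrees of the same law \<open>Q\<close>, so exchanging the
  messages only exchanges the order of integration.\<close>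

lemma surplus_integral_sym:
  assumes "edge_free Z" "edge_free Z'"
  shows "(\<integral>\<^sup>+a. emeasure Q {m. Z' m < a} \<partial>surplus Z) = (\<integral>\<^sup>+a. emeasure Q {m. Z m < a} \<partial>surplus Z')"
proof -
  interpret QQ: pair_prob_space Q Q ..
  have [measurable]: "Z \<in> borel_measurable marks_space" "Z' \<in> borel_measurable marks_space"
    using assms unfolding edge_free_def by blast+
  have "(\<integral>\<^sup>+m. (\<integral>\<^sup>+m'. indicator {0<..} (w - (Z m + Z' m')) \<partial>Q) \<partial>Q) =
      ((\<integral>\<^sup>+m. (\<integral>\<^sup>+m'. indicator {0<..} (w - (Z' m + Z m')) \<partial>Q) \<partial>Q) :: ennreal)" for w
  proof -
    have "(\<integral>\<^sup>+m. (\<integral>\<^sup>+m'. indicator {0<..} (w - (Z m + Z' m')) \<partial>Q) \<partial>Q) =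
        (\<integral>\<^sup>+m'. (\<integral>\<^sup>+m. indicator {0<..} (w - (Z m + Z' m')) \<partial>Q) \<partial>Q)"
      by (rule QQ.Fubini') measurable
    then show ?thesis by (simp add: add.commute)
  qed
  then show ?thesis
    unfolding surplus_integral[OF assms] surplus_integral[OF assms(2,1)] by simp
qed

text \<open>The two choices of solution give the same matching probability. As \<open>lo\<close>
  lies below \<open>hi\<close>, their distribution functions are ordered pointwise, so the
  difference of the integrands is non-negative with integral zero.\<close>

lemma AE_surplus_eq: "AE x in \<xi>. cdf (surplus fringe.lo) x = cdf (surplus fringe.hi) x"
proof -
  interpret L: cdf_distribution "surplus fringe.lo"
    unfolding cdf_distribution_def by (rule real_distribution_surplus[OF edge_free_fringe])
  interpret H: cdf_distribution "surplus fringe.hi"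
    unfolding cdf_distribution_def by (rule real_distribution_surplus[OF edge_free_fringe(2,1)])
  let ?l = "cdf (surplus fringe.lo)" and ?h = "cdf (surplus fringe.hi)"
  have [measurable]: "?l \<in> borel_measurable borel" "?h \<in> borel_measurable borel"
    by (rule L.measurable_C H.measurable_C)+
  have le: "?l x \<le> ?h x" for x
  proof -
    have "?l x = measure Q {m. edge_mark m [] - fringe.lo m \<le> x}"
      "?h x = measure Q {m. edge_mark m [] - fringe.hi m \<le> x}"
      unfolding cdf_def surplus_def by (simp_all add: measure_distr vimage_def)
    moreover have "measure Q {m. edge_mark m [] - fringe.lo m \<le> x} \<le> measure Q {m. edge_mark m [] - fringe.hi m \<le> x}"
    proof (rule Q.finite_measure_mono)
      show "{m. edge_mark m [] - fringe.lo m \<le> x} \<subseteq> {m. edge_mark m [] - fringe.hi m \<le> x}"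
        using fringe.lo_le_hi by (auto intro: order_trans[OF diff_left_mono])
      show "{m. edge_mark m [] - fringe.hi m \<le> x} \<in> Q.events"
        unfolding sets_gw by (rule pred_marks_space) measurable
    qed
    ultimately show ?thesis by simp
  qed
  define d where "d n x = ennreal (pmf \<pi> (Suc n) * (?h x ^ Suc n - ?l x ^ Suc n))" for n x
  let ?g = "\<lambda>c x. \<Sum>n. ennreal (pmf \<pi> (Suc n) * (1 - c x ^ Suc n))"
  have [measurable]: "d n \<in> borel_measurable borel" for n
    unfolding d_def by measurable
  have split: "?g ?l x = ?g ?h x + (\<Sum>n. d n x)" for x
  proof -
    have "ennreal (pmf \<pi> (Suc n) * (1 - ?l x ^ Suc n)) =
        ennreal (pmf \<pi> (Suc n) * (1 - ?h x ^ Suc n)) + d n x" for n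
    proof -
      have "?h x ^ Suc n \<le> 1" "?l x ^ Suc n \<le> ?h x ^ Suc n"
        by (intro power_le_one power_mono le H.cdf_nonneg L.cdf_nonneg H.cdf_bounded_prob)+
      then show ?thesis
        unfolding d_def by (simp only: ennreal_plus[symmetric] mult_nonneg_nonneg pmf_nonneg diff_ge_0_iff_ge
          distrib_left[symmetric] diff_add_cancel add_diff_eq add.commute[of "1 - _"])
    qed
    then show ?thesis
      by (simp add: suminf_add)
  qed
  have eq: "(\<integral>\<^sup>+x. ?g ?l x \<partial>\<xi>) = (\<integral>\<^sup>+x. ?g ?h x \<partial>\<xi>)"
    unfolding matched_integral[OF edge_free_fringe ext[OF fringe.step_lo, symmetric]]
      matched_integral[OF edge_free_fringe(2,1) ext[OF fringe.step_hi, symmetric]]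
    by (simp add: surplus_integral_sym[OF edge_free_fringe])
  \<comment> \<open>Finiteness is what permits cancellation in \<open>ennreal\<close>.\<close>
  have "(\<integral>\<^sup>+x. ?g ?h x \<partial>\<xi>) \<le> (\<integral>\<^sup>+x. 1 \<partial>\<xi>)"
  proof (intro nn_integral_mono)
    fix x
    have "?g ?h x \<le> (\<Sum>n. ennreal (pmf \<pi> (Suc n)))"
      using H.cdf_nonneg[of x] by (intro suminf_le ennreal_leI mult_left_le summableI) auto
    also have "\<dots> \<le> (\<Sum>n. ennreal (pmf \<pi> n))"
      by (subst (2) suminf_offset[where i = 1]) (simp_all add: summableI)
    also have "\<dots> = 1"
      using nn_integral_measure_pmf[of \<pi> "\<lambda>_. 1"]
      by (simp add: nn_integral_count_space_nat measure_pmf.emeasure_space_1[of \<pi>, simplified])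
    finally show "?g ?h x \<le> 1" .
  qed
  also have "\<dots> = 1" using X.emeasure_space_1 by simp
  finally have fin: "(\<integral>\<^sup>+x. ?g ?h x \<partial>\<xi>) \<noteq> \<infinity>" by (auto simp: top_unique)
  have "(\<integral>\<^sup>+x. ?g ?l x \<partial>\<xi>) = (\<integral>\<^sup>+x. ?g ?h x \<partial>\<xi>) + (\<integral>\<^sup>+x. (\<Sum>n. d n x) \<partial>\<xi>)"
    unfolding split by (rule nn_integral_add) measurable
  then have "(\<integral>\<^sup>+x. ?g ?h x \<partial>\<xi>) + (\<integral>\<^sup>+x. (\<Sum>n. d n x) \<partial>\<xi>) = (\<integral>\<^sup>+x. ?g ?h x \<partial>\<xi>) + 0"
    using eq by simp
  with fin have "(\<integral>\<^sup>+x. (\<Sum>n. d n x) \<partial>\<xi>) = 0"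
    by (simp only: ennreal_add_left_cancel) simp
  then have "AE x in \<xi>. (\<Sum>n. d n x) = 0"
    by (subst (asm) nn_integral_0_iff_AE) (auto intro: borel_measurable_suminf)
  then show ?thesis
  proof (rule AE_mp, intro AE_I2 impI)
    fix x assume sum0: "(\<Sum>n. d n x) = 0"
    \<comment> \<open>The mean is positive, so some positive degree is charged; that single term
      already forces equality of the two distribution functions at \<open>x\<close>.\<close>
    obtain n where n: "pmf \<pi> (Suc n) > 0"
    proof -
      have "\<not> (\<forall>k\<in>set_pmf \<pi>. real k = 0)"
      proof
        assume "\<forall>k\<in>set_pmf \<pi>. real k = 0"
        then have "measure_pmf.expectation \<pi> real = 0"
          by (intro integral_eq_zero_AE) (simp add: AE_measure_pmf_iff)
        with mean_pos show False by simp
      qed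
      then obtain k where "k \<in> set_pmf \<pi>" "k \<noteq> 0" by auto
      then show ?thesis
        by (intro that[of "k - 1"]) (simp add: pmf_positive)
    qed
    have "d n x = 0" using sum0 by (simp add: suminf_eq_zero_iff)
    then have "?h x ^ Suc n \<le> ?l x ^ Suc n"
      using n unfolding d_def by (simp add: ennreal_eq_0_iff mult_le_0_iff not_le del: power_Suc)
    then have "?h x \<le> ?l x"
      using L.cdf_nonneg[of x] by (rule power_le_imp_le_base)
    with le[of x] show "?l x = ?h x" by simp
  qed
qed

end

section \<open>The two solutions agree\<close>

lemma AE_in_support:
  fixes \<mu> :: "'b::second_countable_topology measure"
  assumes "sets \<mu> = sets borel"
  shows "AE x in \<mu>. \<forall>U. open U \<longrightarrow> x \<in> U \<longrightarrow> emeasure \<mu> U \<noteq> 0"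
proof -
  define F where "F = {U. open U \<and> emeasure \<mu> U = 0}"
  obtain F' where F': "F' \<subseteq> F" "countable F'" "\<Union>F' = \<Union>F"
    using Lindelof[of F] by (auto simp: F_def)
  have "(\<Union>U\<in>F'. U) \<in> null_sets \<mu>"
    using F'(1,2) assms by (intro null_sets_UN') (auto simp: F_def null_sets_def)
  then have "\<Union>F \<in> null_sets \<mu>" using F'(3) by simp
  then show ?thesis
    by (rule AE_I') (auto simp: F_def)
qed

lemma (in real_distribution) AE_in_msupport: "AE x in M. x \<in> msupport M"
  using AE_in_support[OF events_eq_borel]
proof eventually_elim
  case (elim x)
  then show ?case
    by (auto simp: msupport_def emeasure_eq_measure less_le)
qed

lemma (in real_distribution) msupport_nonempty: "msupport M \<noteq> {}"
proof
  assume "msupport M = {}"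
  with AE_in_msupport have "AE x in M. False" by simp
  then show False by simp
qed

lemma Inf_in_msupport:
  assumes "bdd_below (msupport \<mu>)" "msupport \<mu> \<noteq> {}"
  shows "Inf (msupport \<mu>) \<in> msupport \<mu>"
proof (rule closed_contains_Inf[OF assms(2,1)])
  have "- msupport \<mu> = \<Union>{U. open U \<and> \<not> measure \<mu> U > 0}"
    by (auto simp: msupport_def)
  then show "closed (msupport \<mu>)"
    unfolding closed_def by auto
qed

lemma (in real_distribution) msupport_ball:
  assumes "a \<in> msupport M" "\<delta> > 0"
  shows "emeasure M {a - \<delta><..<a + \<delta>} \<noteq> 0"
proof -
  have "measure M {a - \<delta><..<a + \<delta>} > 0"
    using assms unfolding msupport_def by auto
  then show ?thesis by (simp add: emeasure_eq_measure)
qed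

text \<open>
  Here \<open>S\<close> stands for the support of the pair of the lower and the upper solution, and \<open>W\<close> for the
  support of the edge weights. For bounded \<open>W\<close>, intervals \<open>(\<alpha>, \<beta>)\<close> are pushed away alternately
  from the two ends of \<open>[m, Sup W - m]\<close>, by \<open>\<epsilon>\<close> in each round.
\<close>

lemma no_gap_interval:
  fixes S :: "(real \<times> real) set" and W :: "real set"
  assumes step: "\<And>\<alpha> \<beta> w. (\<alpha>, \<beta>) \<in> S \<Longrightarrow> w \<in> W \<Longrightarrow> (max m (w - \<beta>), max m (w - \<alpha>)) \<in> S"
    and gap: "\<And>\<alpha> \<beta> w. (\<alpha>, \<beta>) \<in> S \<Longrightarrow> w \<in> W \<Longrightarrow> \<not> (\<alpha> < w - m \<and> w - m < \<beta>)"
    and low: "\<And>\<alpha> \<beta>. (\<alpha>, \<beta>) \<in> S \<Longrightarrow> m \<le> \<alpha>"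
    and up: "\<And>\<alpha> \<beta>. bdd_above W \<Longrightarrow> (\<alpha>, \<beta>) \<in> S \<Longrightarrow> \<alpha> < \<beta> \<Longrightarrow> \<beta> \<le> Sup W - m"
    and W: "locally_convex_under_max W"
    and "(\<alpha>, \<beta>) \<in> S"
  shows "\<not> \<alpha> < \<beta>"
proof
  assume "\<alpha> < \<beta>"
  show False
  proof (cases "bdd_above W")
    case False
    then obtain A where "{A<..} \<subseteq> W"
      using W by (auto simp: locally_convex_under_max_def)
    then have A: "w \<in> W" if "A < w" for w using that by auto
    \<comment> \<open>The forbidden values \<open>w - m\<close> fill the whole half-line above
      \<open>A - m\<close>, so no interval may reach into it.\<close>
    have le: "\<beta> \<le> A - m" if "(\<alpha>, \<beta>) \<in> S" "\<alpha> < \<beta>" for \<alpha> \<beta>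
    proof (rule ccontr)
      assume "\<not> \<beta> \<le> A - m"
      with that(2) obtain t where "max \<alpha> (A - m) < t" "t < \<beta>"
        using dense[of "max \<alpha> (A - m)" \<beta>] by auto
      then show False
        using gap[OF that(1) A[of "t + m"]] by auto
    qed
    \<comment> \<open>Large enough that the new upper end \<open>w - \<alpha>\<close> exceeds both
      \<open>m\<close> and \<open>A - m\<close>, which contradicts \<open>le\<close> for the new
      pair.\<close>
    define w where "w = max A (\<alpha> + max m (A - m)) + 1"
    have "w \<in> W" by (rule A) (simp add: w_def)
    have "max m (w - \<beta>) < max m (w - \<alpha>)" and less: "A - m < max m (w - \<alpha>)"
      using \<open>\<alpha> < \<beta>\<close> by (auto simp: w_def)
    from le[OF step[OF \<open>(\<alpha>, \<beta>) \<in> S\<close> \<open>w \<in> W\<close>] this(1)] less show False by linarith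
  next
    case True
    then obtain \<epsilon> where \<epsilon>: "\<epsilon> > 0" "\<And>w. Sup W - \<epsilon> < w \<Longrightarrow> w < Sup W \<Longrightarrow> w \<in> W"
      using W by (auto simp: locally_convex_under_max_def subset_eq)
    define c where "c = Sup W"
    note \<epsilon> = \<epsilon>[folded c_def] and up = up[OF True, folded c_def]
    \<comment> \<open>The forbidden values fill the interval from \<open>c - m - \<epsilon>\<close>
      to \<open>c - m\<close>, and \<open>up\<close> keeps \<beta> from lying beyond it.\<close>
    have first: "\<beta> \<le> c - m - \<epsilon>" if "(\<alpha>, \<beta>) \<in> S" "\<alpha> < \<beta>" for \<alpha> \<beta>
    proof (rule ccontr)
      assume "\<not> \<beta> \<le> c - m - \<epsilon>"
      with that(2) obtain t where "max \<alpha> (c - m - \<epsilon>) < t" "t < \<beta>"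
        using dense[of "max \<alpha> (c - m - \<epsilon>)" \<beta>] by auto
      then show False
        using gap[OF that(1) \<epsilon>(2)[of "t + m"]] up[OF that] by auto
    qed
    \<comment> \<open>By \<open>first\<close>, \<alpha> lies below
      \<open>c - m - \<epsilon>\<close>, so \<open>w - \<alpha>\<close> exceeds \<open>m\<close> and
      the maximum at the upper end resolves.\<close>
    have step': "(max m (w - \<beta>), w - \<alpha>) \<in> S \<and> max m (w - \<beta>) < w - \<alpha>"
      if "(\<alpha>, \<beta>) \<in> S" "\<alpha> < \<beta>" "c - \<epsilon> < w" "w < c" for \<alpha> \<beta> w
      using step[OF that(1) \<epsilon>(2)[OF that(3,4)]] first[OF that(1,2)] that
      by (auto simp: max_def split: if_splits)
    have bound: "\<beta> \<le> c - m - real (Suc k) * \<epsilon>" if "(\<alpha>, \<beta>) \<in> S" "\<alpha> < \<beta>" for \<alpha> \<beta> k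
      using that
    proof (induction k arbitrary: \<alpha> \<beta>)
      case 0
      then show ?case using first by simp
    next
      case (Suc k)
      \<comment> \<open>Letting \<open>w\<close> tend to \<open>c\<close> reflects the current bound
        on upper ends into one on lower ends, without loss.\<close>
      have low': "m + real (Suc k) * \<epsilon> \<le> \<alpha>'" if "(\<alpha>', \<beta>') \<in> S" "\<alpha>' < \<beta>'" for \<alpha>' \<beta>'
      proof (rule field_le_epsilon)
        fix e :: real assume "e > 0"
        define w where "w = max (c - \<epsilon> / 2) (c - e)"
        have "c - \<epsilon> < w" "w < c" "c - e \<le> w"
          using \<epsilon>(1) \<open>e > 0\<close> by (auto simp: w_def)
        with step'[OF that this(1,2)] Suc.IH[of "max m (w - \<beta>')" "w - \<alpha>'"]
        show "m + real (Suc k) * \<epsilon> \<le> \<alpha>' + e" by linarith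
      qed
      show ?case
      proof (rule field_le_epsilon)
        fix e :: real assume "e > 0"
        \<comment> \<open>Letting \<open>w\<close> tend to \<open>c - \<epsilon>\<close> reflects
          the bound back to upper ends and gains \<epsilon>. The reflected lower end is above
          \<open>m\<close>, hence it is \<open>w - \<beta>\<close>.\<close>
        define w where "w = min (c - \<epsilon> / 2) (c - \<epsilon> + e)"
        have w: "c - \<epsilon> < w" "w < c" "w \<le> c - \<epsilon> + e"
          using \<epsilon>(1) \<open>e > 0\<close> by (auto simp: w_def)
        have "m < m + real (Suc k) * \<epsilon>" using \<epsilon>(1) by simp
        moreover have "m + real (Suc k) * \<epsilon> \<le> max m (w - \<beta>)"
          using step'[OF Suc.prems w(1,2)] low' by blast
        ultimately have "m + real (Suc k) * \<epsilon> \<le> w - \<beta>" by linarith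
        with w(3) show "\<beta> \<le> c - m - real (Suc (Suc k)) * \<epsilon> + e"
          by (simp add: algebra_simps)
      qed
    qed
    obtain k where "c - 2 * m < real k * \<epsilon>"
      using reals_Archimedean3[OF \<epsilon>(1)] by blast
    moreover have "real k * \<epsilon> < real (Suc k) * \<epsilon>" using \<epsilon>(1) by simp
    ultimately show False
      using bound[OF \<open>(\<alpha>, \<beta>) \<in> S\<close> \<open>\<alpha> < \<beta>\<close>, of k] low[OF \<open>(\<alpha>, \<beta>) \<in> S\<close>] \<open>\<alpha> < \<beta>\<close> by linarith
  qed
qed

section \<open>The support of the pair of solutions under the recursion\<close>

context ubgw_laws
begin

definition pair_support :: "(real \<times> real) set" where
  "pair_support = {z. \<forall>U. open U \<longrightarrow> z \<in> U \<longrightarrow> emeasure Q {m. (fringe.lo m, fringe.hi m) \<in> U} \<noteq> 0}"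

lemma sets_lo_hi_in: "open U \<Longrightarrow> {m. (fringe.lo m, fringe.hi m) \<in> U} \<in> sets marks_space"
  using measurable_sets[OF borel_measurable_Pair[OF measurable_fringe] borel_open, of U]
  by (simp add: vimage_def)

lemma AE_pair_support: "AE m in Q. (fringe.lo m, fringe.hi m) \<in> pair_support"
proof -
  let ?\<mu> = "distr Q borel (\<lambda>m. (fringe.lo m, fringe.hi m))"
  have em: "emeasure ?\<mu> U = emeasure Q {m. (fringe.lo m, fringe.hi m) \<in> U}" if "open U" for U
    using that by (subst emeasure_distr) (auto simp: vimage_def)
  have "AE z in ?\<mu>. \<forall>U. open U \<longrightarrow> z \<in> U \<longrightarrow> emeasure ?\<mu> U \<noteq> 0"
    by (rule AE_in_support) simp
  then have "AE m in Q. \<forall>U. open U \<longrightarrow> (fringe.lo m, fringe.hi m) \<in> U \<longrightarrow> emeasure ?\<mu> U \<noteq> 0"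
    by (rule AE_distrD[rotated]) measurable
  then show ?thesis
    by eventually_elim (simp add: pair_support_def em)
qed

lemma pair_support_AE:
  assumes "AE m in Q. (fringe.lo m, fringe.hi m) \<notin> U" "open U" "z \<in> pair_support"
  shows "z \<notin> U"
proof
  assume "z \<in> U"
  with assms(2,3) have "emeasure Q {m. (fringe.lo m, fringe.hi m) \<in> U} \<noteq> 0"
    by (auto simp: pair_support_def)
  moreover have "{m. (fringe.lo m, fringe.hi m) \<in> U} \<in> sets Q"
    unfolding sets_gw using assms(2) by (rule sets_lo_hi_in)
  ultimately show False
    using assms(1) by (subst (asm) AE_iff_measurable[OF _ refl]) auto
qed

definition edge_pair_near :: "real \<Rightarrow> real \<Rightarrow> real \<Rightarrow> real \<Rightarrow> (nat list \<Rightarrow> nat \<times> real \<times> real) set" where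
  "edge_pair_near \<delta> w \<alpha> \<beta> = {m. edge_mark m [] \<in> {w - \<delta><..<w + \<delta>} \<and>
     fringe.lo m \<in> {\<alpha> - \<delta><..<\<alpha> + \<delta>} \<and> fringe.hi m \<in> {\<beta> - \<delta><..<\<beta> + \<delta>}}"

lemma sets_edge_pair_near [measurable]: "edge_pair_near \<delta> w \<alpha> \<beta> \<in> sets marks_space"
  unfolding edge_pair_near_def by (rule pred_marks_space) measurable

text \<open>Both solutions ignore the edge mark at the root, so the probability is a product of two
  positive factors.\<close>

lemma edge_pair_near_pos:
  assumes "w \<in> msupport \<omega>" "(\<alpha>, \<beta>) \<in> pair_support" "\<delta> > 0"
  shows "emeasure Q (edge_pair_near \<delta> w \<alpha> \<beta>) \<noteq> 0"
proof -
  let ?I = "{w - \<delta><..<w + \<delta>}"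
  let ?B = "{m. fringe.lo m \<in> {\<alpha> - \<delta><..<\<alpha> + \<delta>} \<and> fringe.hi m \<in> {\<beta> - \<delta><..<\<beta> + \<delta>}}"
  have [measurable]: "?B \<in> sets marks_space" by (rule pred_marks_space) measurable
  then have B: "?B \<in> sets Q" by (simp only: sets_gw)
  have "emeasure Q (edge_pair_near \<delta> w \<alpha> \<beta>) = (\<integral>\<^sup>+m. indicator (edge_pair_near \<delta> w \<alpha> \<beta>) m \<partial>Q)"
    by (simp add: sets_gw)
  also have "\<dots> = (\<integral>\<^sup>+v. (\<integral>\<^sup>+m. indicator (edge_pair_near \<delta> w \<alpha> \<beta>) (set_edge_mark [] v m) \<partial>Q) \<partial>\<omega>)"
    by (rule nn_integral_resample) measurable
  also have "\<dots> = (\<integral>\<^sup>+v. (\<integral>\<^sup>+m. indicator ?I v * indicator ?B m \<partial>Q) \<partial>\<omega>)"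
    by (intro nn_integral_cong) (auto simp: edge_pair_near_def indicator_def)
  also have "\<dots> = emeasure \<omega> ?I * emeasure Q ?B"
    using B by (simp add: nn_integral_cmult nn_integral_multc del: greaterThanLessThan_iff)
  finally have "emeasure Q (edge_pair_near \<delta> w \<alpha> \<beta>) = emeasure \<omega> ?I * emeasure Q ?B" .
  moreover have "emeasure Q ?B \<noteq> 0"
  proof -
    have "open ({\<alpha> - \<delta><..<\<alpha> + \<delta>} \<times> {\<beta> - \<delta><..<\<beta> + \<delta>})" by (intro open_Times) auto
    then have "emeasure Q {m. (fringe.lo m, fringe.hi m) \<in> {\<alpha> - \<delta><..<\<alpha> + \<delta>} \<times> {\<beta> - \<delta><..<\<beta> + \<delta>}} \<noteq> 0"
      using assms(2,3) unfolding pair_support_def by auto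
    then show ?thesis by (simp only: mem_Times_iff fst_conv snd_conv not_False_eq_True)
  qed
  ultimately show ?thesis
    using W.msupport_ball[OF assms(1,3)] by simp
qed

text \<open>With positive probability the root has exactly \<open>k\<close> children, all with edge
  weight and solutions near the prescribed values, and its own weight is near \<open>x\<close>. The
  condition \<open>k > 0\<close> ensures that the maximum contains an edge term.\<close>

lemma pair_support_step:
  assumes k: "pmf (size_biased \<pi>) k > 0" "k > 0"
    and "(\<alpha>, \<beta>) \<in> pair_support" "w \<in> msupport \<omega>" "x \<in> msupport \<xi>"
  shows "(max x (w - \<beta>), max x (w - \<alpha>)) \<in> pair_support"
  unfolding pair_support_def
proof (intro CollectI allI impI)
  fix U :: "(real \<times> real) set" assume U: "open U" "(max x (w - \<beta>), max x (w - \<alpha>)) \<in> U"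
  obtain U1 U2 where U12: "open U1" "open U2" "max x (w - \<beta>) \<in> U1" "max x (w - \<alpha>) \<in> U2" "U1 \<times> U2 \<subseteq> U"
    using open_prod_elim[OF U] by (metis mem_Sigma_iff)
  obtain \<delta>1 where \<delta>1: "\<delta>1 > 0" "\<And>y. \<bar>y - max x (w - \<beta>)\<bar> < \<delta>1 \<Longrightarrow> y \<in> U1"
    using U12(1,3) unfolding open_dist dist_real_def by blast
  obtain \<delta>2 where \<delta>2: "\<delta>2 > 0" "\<And>y. \<bar>y - max x (w - \<alpha>)\<bar> < \<delta>2 \<Longrightarrow> y \<in> U2"
    using U12(2,4) unfolding open_dist dist_real_def by blast
  \<comment> \<open>Halved because the errors of the edge weight and of the message add up in the
    surplus.\<close>
  define \<delta> where "\<delta> = min \<delta>1 \<delta>2 / 2"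
  have \<delta>: "\<delta> > 0" "2 * \<delta> \<le> \<delta>1" "2 * \<delta> \<le> \<delta>2" using \<delta>1(1) \<delta>2(1) by (auto simp: \<delta>_def)
  let ?B = "edge_pair_near \<delta> w \<alpha> \<beta>" and ?C = "{x - \<delta><..<x + \<delta>}"
  let ?E = "{m. num_children m [] = k \<and> vertex_mark m [] \<in> ?C \<and> (\<forall>i<k. fringe_at [i] m \<in> ?B)}"
  have "emeasure Q ?E = ennreal (pmf (size_biased \<pi>) k) * emeasure \<xi> ?C * emeasure Q ?B ^ k"
    by (rule emeasure_gw_branches) auto
  also have "\<dots> \<noteq> 0"
    using edge_pair_near_pos[OF assms(4,3) \<delta>(1)] X.msupport_ball[OF assms(5) \<delta>(1)] k(1) by simp
  finally have pos: "emeasure Q ?E \<noteq> 0" .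
  have near: "max x (w - \<gamma>) - \<delta>' < fringe.step Z m \<and> fringe.step Z m < max x (w - \<gamma>) + \<delta>'"
    if m: "m \<in> ?E" and Z: "\<And>i. i < k \<Longrightarrow> Z (fringe_at [i] m) \<in> {\<gamma> - \<delta><..<\<gamma> + \<delta>}" and \<delta>': "2 * \<delta> \<le> \<delta>'"
    for Z m \<gamma> \<delta>'
  proof -
    have edge: "w - \<gamma> - 2 * \<delta> < edge_mark m [i] - Z (fringe_at [i] m)"
      "edge_mark m [i] - Z (fringe_at [i] m) < w - \<gamma> + 2 * \<delta>" if "i < k" for i
      using m Z[OF that] that by (auto simp: edge_pair_near_def algebra_simps)
    have "vertex_mark m [] \<le> fringe.step Z m" "edge_mark m [0] - Z (fringe_at [0] m) \<le> fringe.step Z m"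
      using fringe_step_le_iff[of Z m "fringe.step Z m"] m k(2) by auto
    then have "max x (w - \<gamma>) - \<delta>' < fringe.step Z m"
      using edge(1)[OF k(2)] m \<delta> \<delta>' by auto
    moreover have "fringe.step Z m < max x (w - \<gamma>) + \<delta>'"
      unfolding fringe_step_less_iff using edge(2) m \<delta> \<delta>' by fastforce
    ultimately show ?thesis by simp
  qed
  have "?E \<subseteq> {m. (fringe.lo m, fringe.hi m) \<in> U}"
  proof
    fix m assume m: "m \<in> ?E"
    have "fringe.lo m \<in> U1"
      using near[OF m, of fringe.hi \<beta> \<delta>1] m \<delta>(2)
      by (intro \<delta>1(2)) (auto simp: edge_pair_near_def fringe.step_hi abs_less_iff)
    moreover have "fringe.hi m \<in> U2"
      using near[OF m, of fringe.lo \<alpha> \<delta>2] m \<delta>(3)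
      by (intro \<delta>2(2)) (auto simp: edge_pair_near_def fringe.step_lo abs_less_iff)
    ultimately show "m \<in> {m. (fringe.lo m, fringe.hi m) \<in> U}" using U12(5) by auto
  qed
  then have "emeasure Q ?E \<le> emeasure Q {m. (fringe.lo m, fringe.hi m) \<in> U}"
  proof (rule emeasure_mono)
    show "{m. (fringe.lo m, fringe.hi m) \<in> U} \<in> Q.events"
      unfolding sets_gw using U(1) by (rule sets_lo_hi_in)
  qed
  with pos show "emeasure Q {m. (fringe.lo m, fringe.hi m) \<in> U} \<noteq> 0" by auto
qed

text \<open>For \<open>y\<close> near \<open>x\<close>, an event of positive probability has
  \<open>w - hi\<close> at most \<open>y\<close> but \<open>w - lo\<close> above it. The two
  distribution functions then differ on a neighbourhood of \<open>x\<close>, which \<xi> charges,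
  against \<open>AE_surplus_eq\<close>.\<close>

lemma pair_support_gap:
  assumes "(\<alpha>, \<beta>) \<in> pair_support" "w \<in> msupport \<omega>" "x \<in> msupport \<xi>"
  shows "\<not> (\<alpha> < w - x \<and> w - x < \<beta>)"
proof
  assume gap: "\<alpha> < w - x \<and> w - x < \<beta>"
  \<comment> \<open>A third each for the errors of the edge weight, of the message and of
    \<open>y\<close>.\<close>
  define \<delta> where "\<delta> = min (w - x - \<alpha>) (\<beta> - (w - x)) / 3"
  have \<delta>: "\<delta> > 0" "3 * \<delta> \<le> w - x - \<alpha>" "3 * \<delta> \<le> \<beta> - (w - x)"
    using gap by (auto simp: \<delta>_def)
  let ?B = "edge_pair_near \<delta> w \<alpha> \<beta>"
  have neq: "cdf (surplus fringe.lo) y \<noteq> cdf (surplus fringe.hi) y" if y: "y \<in> {x - \<delta><..<x + \<delta>}" for y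
  proof -
    let ?L = "{m. edge_mark m [] - fringe.lo m \<le> y}" and ?H = "{m. edge_mark m [] - fringe.hi m \<le> y}"
    have [measurable]: "?L \<in> sets marks_space" "?H \<in> sets marks_space"
      by (rule pred_marks_space, measurable)+
    have "?L \<inter> ?B = {}"
      using y \<delta> by (auto simp: edge_pair_near_def)
    then have "Q.prob ?L + Q.prob ?B = Q.prob (?L \<union> ?B)"
      by (intro Q.finite_measure_Union[symmetric]) (auto simp: sets_gw)
    also have "\<dots> \<le> Q.prob ?H"
    proof (rule Q.finite_measure_mono)
      show "?L \<union> ?B \<subseteq> ?H"
        using y \<delta> fringe.lo_le_hi by (auto simp: edge_pair_near_def intro: order_trans[OF diff_left_mono])
    qed (auto simp: sets_gw)
    finally have "Q.prob ?L + Q.prob ?B \<le> Q.prob ?H" .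
    moreover have "Q.prob ?B \<noteq> 0"
      using edge_pair_near_pos[OF assms(2,1) \<delta>(1)] by (auto simp: Q.emeasure_eq_measure)
    moreover have "cdf (surplus fringe.lo) y = Q.prob ?L" "cdf (surplus fringe.hi) y = Q.prob ?H"
      unfolding cdf_def surplus_def by (simp_all add: measure_distr vimage_def)
    ultimately show ?thesis
      using measure_nonneg[of Q ?B] by linarith
  qed
  have "AE y in \<xi>. y \<notin> {x - \<delta><..<x + \<delta>}"
    using AE_surplus_eq by eventually_elim (use neq in blast)
  then have "{x - \<delta><..<x + \<delta>} \<in> null_sets \<xi>"
    by (subst AE_iff_null_sets) (auto simp del: greaterThanLessThan_iff)
  then have "emeasure \<xi> {x - \<delta><..<x + \<delta>} = 0" by blast
  with X.msupport_ball[OF assms(3) \<delta>(1)] show False by simp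
qed

lemma AE_vertex_mark_root:
  assumes "AE x in \<xi>. x \<in> C" "C \<in> sets borel"
  shows "AE m in gw p q. vertex_mark m [] \<in> C"
proof -
  note [measurable] = assms(2)
  have "emeasure \<xi> (- C) = 0"
    using assms by (subst (asm) AE_iff_measurable[OF _ refl]) (auto simp: Compl_eq)
  then have "emeasure (gw p q) {m. vertex_mark m [] \<in> - C} = 0"
    using emeasure_gw_root[of "- C" UNIV p q] assms(2) sets.top[of marks_space] by simp
  moreover have "{m. vertex_mark m [] \<in> - C} \<in> sets (gw p q)"
    unfolding sets_gw by (rule pred_marks_space) measurable
  ultimately show ?thesis
    by (intro AE_I[of _ _ "{m. vertex_mark m [] \<in> - C}"]) auto
qed

lemma AE_edge_mark:
  assumes "AE x in \<omega>. x \<in> C" "C \<in> sets borel"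
  shows "AE m in gw p q. edge_mark m v \<in> C"
proof -
  interpret P: prob_space "gw p q" by (rule prob_space_gw)
  have [measurable]: "- C \<in> sets borel" using assms(2) by auto
  have "emeasure \<omega> (- C) = 0"
    using assms by (subst (asm) AE_iff_measurable[OF _ refl]) (auto simp: Compl_eq)
  have "(\<integral>\<^sup>+m. indicator (- C) (edge_mark m v) \<partial>gw p q) =
      (\<integral>\<^sup>+w. (\<integral>\<^sup>+m. indicator (- C) (edge_mark (set_edge_mark v w m) v) \<partial>gw p q) \<partial>\<omega>)"
    by (rule nn_integral_resample) measurable
  also have "\<dots> = 0"
    using \<open>emeasure \<omega> (- C) = 0\<close> P.emeasure_space_1 by simp
  finally have "AE m in gw p q. indicator (- C) (edge_mark m v) = (0 :: ennreal)"
    by (subst (asm) nn_integral_0_iff_AE) measurable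
  then show ?thesis
    by eventually_elim (auto simp: indicator_def split: if_splits)
qed

lemma AE_fringe_at:
  assumes "AE m in gw q q. R m" "v \<noteq> []"
  shows "AE m in gw p q. R (fringe_at v m)"
proof -
  have "AE m in distr (gw p q) marks_space (fringe_at v). R m"
    unfolding distr_fringe_at[OF assms(2)] by (rule assms(1))
  then show ?thesis
    by (rule AE_distrD[rotated]) measurable
qed

text \<open>If size-biased offspring is almost surely zero, the recursion ends at once and
  \<open>step\<close> is constant. Otherwise the support of the pair meets the assumptions of
  \<open>no_gap_interval\<close>, with \<open>m\<close> the least support point of \<xi>.\<close>

lemma AE_lo_eq_hi:
  assumes "bdd_below (msupport \<xi>)" "locally_convex_under_max (msupport \<omega>)"
  shows "AE m in Q. fringe.lo m = fringe.hi m"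
proof (cases "\<exists>k>0. pmf (size_biased \<pi>) k > 0")
  case False
  have "AE m in Q. num_children m [] \<noteq> Suc k" for k
  proof -
    have "emeasure Q {m. num_children m [] = Suc k} = 0"
    proof -
      have "emeasure Q {m. num_children m [] = Suc k} =
          ennreal (pmf (size_biased \<pi>) (Suc k)) * emeasure \<xi> UNIV * emeasure Q UNIV ^ Suc k"
        using emeasure_gw_branches[of UNIV UNIV "size_biased \<pi>" "size_biased \<pi>" "Suc k"]
          sets.top[of marks_space] by simp
      moreover have "pmf (size_biased \<pi>) (Suc k) = 0"
        using False pmf_nonneg[of "size_biased \<pi>" "Suc k"] by (metis less_le zero_less_Suc)
      ultimately show ?thesis by simp
    qed
    moreover have "{m. num_children m [] = Suc k} \<in> sets Q"
      unfolding sets_gw by (rule pred_marks_space) measurable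
    ultimately show ?thesis
      by (intro AE_I[of _ _ "{m. num_children m [] = Suc k}"]) auto
  qed
  then have "AE m in Q. \<forall>k. num_children m [] \<noteq> Suc k"
    by (simp add: AE_all_countable)
  then show ?thesis
  proof eventually_elim
    case (elim m)
    then have "num_children m [] = 0" by (cases "num_children m []") auto
    then have "fringe.step Z m = fringe.step Z' m" for Z Z'
      by (intro fringe.step_cong) (simp add: mark_succ_def)
    then show ?case
      by (metis fringe.step_hi fringe.step_lo)
  qed
next
  case True
  then obtain k where k: "k > 0" "pmf (size_biased \<pi>) k > 0" by blast
  define x where "x = Inf (msupport \<xi>)"
  have x: "x \<in> msupport \<xi>"
    unfolding x_def using assms(1) X.msupport_nonempty by (rule Inf_in_msupport)
  have "AE y in \<xi>. y \<in> {x..}"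
    using X.AE_in_msupport by eventually_elim (auto simp: x_def intro: cInf_lower assms(1))
  then have lo: "AE m in Q. x \<le> fringe.lo m"
    using AE_vertex_mark_root[of "{x..}" "size_biased \<pi>" "size_biased \<pi>"] fringe.base_le_lo
    by (auto simp: mark_base_def elim!: eventually_mono intro: order_trans)
  have low: "x \<le> \<alpha>" if "(\<alpha>, \<beta>) \<in> pair_support" for \<alpha> \<beta>
  proof -
    have "AE m in Q. (fringe.lo m, fringe.hi m) \<notin> {..<x} \<times> UNIV"
      using lo by eventually_elim auto
    from pair_support_AE[OF this _ that] show ?thesis by (auto simp: open_Times not_less)
  qed
  have up: "\<beta> \<le> Sup (msupport \<omega>) - x"
    if "bdd_above (msupport \<omega>)" "(\<alpha>, \<beta>) \<in> pair_support" "\<alpha> < \<beta>" for \<alpha> \<beta>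
  proof -
    let ?M = "Sup (msupport \<omega>)"
    have "AE y in \<omega>. y \<in> {..?M}"
      using W.AE_in_msupport by eventually_elim (auto intro: cSup_upper that(1))
    then have "AE m in Q. edge_mark m v \<in> {..?M}" for v
      by (rule AE_edge_mark) simp
    then have "AE m in Q. \<forall>k. edge_mark m [k] \<in> {..?M}"
      by (simp add: AE_all_countable)
    moreover have "AE m in Q. \<forall>k. x \<le> fringe.lo (fringe_at [k] m)"
      using AE_fringe_at[OF lo] by (simp add: AE_all_countable)
    \<comment> \<open>A non-trivial interval excludes that \<open>hi\<close> is the vertex weight,
      since \<open>lo\<close> is at least that weight; so \<open>hi\<close> is an edge weight minus
      a child's \<open>lo\<close>. Stating this as avoidance of an open set lets it pass to the
      support.\<close>
    ultimately have "AE m in Q. (fringe.lo m, fringe.hi m) \<notin> {z. fst z < snd z \<and> ?M - x < snd z}"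
    proof eventually_elim
      case (elim m)
      have "fringe.hi m = vertex_mark m [] \<or> (\<exists>k. fringe.hi m = edge_mark m [k] - fringe.lo (fringe_at [k] m))"
        using fringe.step_cases[of fringe.lo m]
        by (auto simp: fringe.step_lo mark_base_def mark_weight_def mark_succ_def)
      then show ?case
      proof
        assume "fringe.hi m = vertex_mark m []"
        then show ?thesis using fringe.base_le_lo[of m] by (simp add: mark_base_def)
      next
        assume "\<exists>k. fringe.hi m = edge_mark m [k] - fringe.lo (fringe_at [k] m)"
        then obtain k where "fringe.hi m = edge_mark m [k] - fringe.lo (fringe_at [k] m)" by blast
        moreover have "edge_mark m [k] \<le> ?M" "x \<le> fringe.lo (fringe_at [k] m)"
          using elim by auto
        ultimately show ?thesis by simp
      qed
    qed
    moreover have "open {z :: real \<times> real. fst z < snd z \<and> ?M - x < snd z}"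
      by (intro open_Collect_conj open_Collect_less continuous_intros)
    ultimately have "(\<alpha>, \<beta>) \<notin> {z. fst z < snd z \<and> ?M - x < snd z}"
      using that(2) by (rule pair_support_AE)
    with that(3) show ?thesis by auto
  qed
  have no_gap: "\<not> \<alpha> < \<beta>" if "(\<alpha>, \<beta>) \<in> pair_support" for \<alpha> \<beta>
    by (rule no_gap_interval[OF _ _ low up assms(2) that])
      (use pair_support_step[OF k(2,1)] pair_support_gap x in auto)
  show ?thesis
    using AE_pair_support
    by eventually_elim (use no_gap fringe.lo_le_hi in \<open>auto intro: antisym simp: not_less\<close>)
qed

end

section \<open>Messages of the tree\<close>

lemma dart_succ_down:
  assumes "b \<in> verts (marked_tree m)" "b \<noteq> []"
  shows "dart_succ (marked_tree m) (butlast b, b) = (\<lambda>i. (b, b @ [i])) ` {..<num_children m b}"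
proof -
  have "b @ [i] \<noteq> butlast b" for i
    by (auto dest: arg_cong[of _ _ length])
  then show ?thesis
    using assms by (auto simp: in_dart_succ darts_tree)
qed

text \<open>Darts pointing away from the root are closed under succession, and sending such a dart
  to the fringe at its end identifies the two recursions.\<close>

lemma tree_fringe:
  assumes "u \<in> verts (marked_tree m)" "k < num_children m u"
  shows "tree.lo m (u, u @ [k]) = fringe.lo (fringe_at (u @ [k]) m)"
    "tree.hi m (u, u @ [k]) = fringe.hi (fringe_at (u @ [k]) m)"
proof -
  let ?J = "{(u, u @ [k]) | u k. u @ [k] \<in> verts (marked_tree m)}"
  have iter: "tree.iter m n (u, u @ [k]) = fringe.iter n (fringe_at (u @ [k]) m)" for n
  proof -
    have succ: "dart_succ (marked_tree m) (a, a @ [j]) = (\<lambda>i. (a @ [j], (a @ [j]) @ [i])) ` {..<num_children m (a @ [j])}"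
      if "a @ [j] \<in> verts (marked_tree m)" for a j
      using dart_succ_down[OF that] by simp
    have "fringe.iter n (fringe_at (snd (u, u @ [k])) m) = tree.iter m n (u, u @ [k])"
    proof (rule max_minus_iter_transfer[where J = ?J])
      fix i assume "i \<in> ?J"
      then obtain a j where i: "i = (a, a @ [j])" "a @ [j] \<in> verts (marked_tree m)" by blast
      show "mark_base (fringe_at (snd i) m) = dart_base (marked_tree m) i"
        by (simp add: i mark_base_def)
      show "mark_succ (fringe_at (snd i) m) = (\<lambda>d. fringe_at (snd d) m) ` dart_succ (marked_tree m) i"
        unfolding i(1) succ[OF i(2)] by (simp add: mark_succ_def image_image)
      show "dart_succ (marked_tree m) i \<subseteq> ?J"
      proof
        fix d assume "d \<in> dart_succ (marked_tree m) i"
        then obtain l where "d = (a @ [j], (a @ [j]) @ [l])" "l < num_children m (a @ [j])"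
          unfolding i(1) succ[OF i(2)] by auto
        then show "d \<in> ?J" using i(2) snoc_in_tree[of "a @ [j]" l m] by blast
      qed
      fix d assume "d \<in> dart_succ (marked_tree m) i"
      then obtain l where "d = (a @ [j], (a @ [j]) @ [l])"
        unfolding i(1) succ[OF i(2)] by auto
      then show "mark_weight (fringe_at (snd d) m) = dart_weight (marked_tree m) d"
        using ew_tree[of m "a @ [j]" l] by (simp add: mark_weight_def)
    qed (use assms tree.max_minus_axioms fringe.max_minus_axioms in auto)
    then show ?thesis by simp
  qed
  show "tree.lo m (u, u @ [k]) = fringe.lo (fringe_at (u @ [k]) m)"
    unfolding tree.lo_def fringe.lo_def iter ..
  show "tree.hi m (u, u @ [k]) = fringe.hi (fringe_at (u @ [k]) m)"
    unfolding tree.hi_def fringe.hi_def iter ..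
qed

text \<open>Fringe subtrees settle the darts pointing away from the root. A dart towards the root
  has as successors such darts and at most one dart towards the root that ends one level higher, so
  induction on depth settles the rest.\<close>

lemma rigidI:
  assumes "\<And>v. v \<noteq> [] \<Longrightarrow> fringe.lo (fringe_at v m) = fringe.hi (fringe_at v m)"
  shows "rigid m"
proof -
  have down_eq: "tree.lo m (u, u @ [k]) = tree.hi m (u, u @ [k])"
    if "u \<in> verts (marked_tree m)" "k < num_children m u" for u k
    using tree_fringe[OF that] assms[of "u @ [k]"] by simp
  have up: "tree.lo m (u @ [k], u) = tree.hi m (u @ [k], u)"
    if "u \<in> verts (marked_tree m)" "k < num_children m u" for u k
    using that
  proof (induction u arbitrary: k rule: rev_induct)
    case Nil
    have "tree.step m (tree.hi m) ([k], []) = tree.step m (tree.lo m) ([k], [])"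
    proof (rule tree.step_cong)
      fix d assume "d \<in> dart_succ (marked_tree m) ([k], [])"
      then obtain j where "d = ([], [] @ [j])" "j < num_children m []"
        using snoc_in_tree[of "[]" _ m] by (cases d) (auto simp: in_dart_succ darts_tree)
      then show "tree.hi m d = tree.lo m d" using down_eq[of "[]" j] by simp
    qed
    then show ?case by (simp add: tree.step_lo tree.step_hi)
  next
    case (snoc i u)
    have "tree.step m (tree.hi m) ((u @ [i]) @ [k], u @ [i]) = tree.step m (tree.lo m) ((u @ [i]) @ [k], u @ [i])"
    proof (rule tree.step_cong)
      fix d assume d: "d \<in> dart_succ (marked_tree m) ((u @ [i]) @ [k], u @ [i])"
      then obtain v where v: "d = (u @ [i], v)" "(u @ [i], v) \<in> darts (marked_tree m)"
        by (cases d) (auto simp: in_dart_succ)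
      from v(2) show "tree.hi m d = tree.lo m d"
      proof (cases rule: dart_cases)
        case (down j)
        then show ?thesis using down_eq[of "u @ [i]" j] v by simp
      next
        case (up j)
        then show ?thesis using snoc.IH[of i] v by simp
      qed
    qed
    then show ?case by (simp add: tree.step_lo tree.step_hi)
  qed
  show ?thesis
    unfolding rigid_def
  proof
    fix d assume "d \<in> darts (marked_tree m)"
    then show "tree.lo m d = tree.hi m d"
      using up down_eq by (cases d) (auto elim!: dart_cases)
  qed
qed

lemma verts_set_edge_mark [simp]: "verts (marked_tree (set_edge_mark v w m)) = verts (marked_tree m)"
  by (simp add: marked_tree_def)

lemma darts_set_edge_mark [simp]: "darts (marked_tree (set_edge_mark v w m)) = darts (marked_tree m)"
  by (auto simp: darts_tree)

lemma dart_succ_set_edge_mark [simp]: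
  "dart_succ (marked_tree (set_edge_mark v w m)) = dart_succ (marked_tree m)"
  by (simp add: dart_succ_def)

text \<open>A message along a dart depends only on the branch behind it, never on the edge of the
  dart itself. The threshold for a dimer is therefore independent of the weight it is compared
  with.\<close>

lemma tree_lo_set_edge_mark:
  assumes "(u, v) \<in> darts (marked_tree m)" and x: "{u, v} = {y, y @ [k]}"
  shows "tree.lo (set_edge_mark (y @ [k]) w m) (u, v) = tree.lo m (u, v)"
proof -
  let ?m = "set_edge_mark (y @ [k]) w m"
  let ?J = "{(a, b). (a, b) \<in> darts (marked_tree m) \<and> branch a b \<subseteq> branch u v}"
  have "tree.iter ?m n (id (u, v)) = tree.iter m n (u, v)" for n
  proof (rule max_minus_iter_transfer[where J = ?J])
    fix i assume "i \<in> ?J"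
    then obtain a b where i: "i = (a, b)" "(a, b) \<in> darts (marked_tree m)" "branch a b \<subseteq> branch u v" by auto
    show "dart_base (marked_tree ?m) (id i) = dart_base (marked_tree m) i"
      by (simp add: i)
    show "dart_succ (marked_tree m) i \<subseteq> ?J"
      using branch_succ[OF i(2)] i(3) by (auto simp: i(1) in_dart_succ) blast
    fix d assume "d \<in> dart_succ (marked_tree m) i"
    then obtain c where d: "d = (b, c)" "(b, c) \<in> darts (marked_tree m)" "c \<noteq> a"
      by (cases d) (auto simp: i(1) in_dart_succ)
    have "{b, c} \<noteq> {u, v}"
      using i(3) branch_succ[OF i(2) d(2,3)] branch_ends[OF i(2)] branch_ends[OF d(2)] branch_ends[OF assms(1)]
      by (auto simp: doubleton_eq_iff)
    then have neq: "{b, c} \<noteq> {y, y @ [k]}" unfolding x .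
    from d(2) show "dart_weight (marked_tree ?m) (id d) = dart_weight (marked_tree m) d"
    proof (cases rule: dart_cases)
      case (down j)
      then have "c \<noteq> y @ [k]" using neq by auto
      then show ?thesis by (simp add: d(1) down(1))
    next
      case (up j)
      then have "b \<noteq> y @ [k]" using neq by (auto simp: insert_commute)
      then show ?thesis by (simp add: d(1) up(1))
    qed
  qed (use assms tree.max_minus_axioms in auto)
  then show ?thesis
    unfolding tree.lo_def by simp
qed

section \<open>Measurability of the messages and of the configuration\<close>

lemma pred_tree [measurable (raw)]:
  assumes [measurable]: "f \<in> N \<rightarrow>\<^sub>M marks_space"
  shows "Measurable.pred N (\<lambda>x. u \<in> verts (marked_tree (f x)))"
    "Measurable.pred N (\<lambda>x. (u, v) \<in> darts (marked_tree (f x)))"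
proof -
  show verts [measurable]: "Measurable.pred N (\<lambda>x. u \<in> verts (marked_tree (f x)))" for u
    unfolding marked_tree_def by (simp add: Let_def)
  show "Measurable.pred N (\<lambda>x. (u, v) \<in> darts (marked_tree (f x)))"
    unfolding darts_tree by measurable
qed

lemma measurable_ew_tree: "(\<lambda>m. ew (marked_tree m) e) \<in> borel_measurable marks_space"
  by (simp add: marked_tree_def Let_def)

lemma measurable_tree_iter: "(\<lambda>m. tree.iter m n d) \<in> borel_measurable marks_space"
proof (induction n arbitrary: d)
  case 0
  then show ?case by (cases d) simp
next
  case (Suc n)
  note [measurable] = Suc measurable_ew_tree
  obtain u v where d: "d = (u, v)" by (cases d)
  have iff: "tree.step m (tree.iter m n) (u, v) \<le> t \<longleftrightarrow> vertex_mark m v \<le> t \<and>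
    (\<forall>u'. (v, u') \<in> darts (marked_tree m) \<and> u' \<noteq> u \<longrightarrow>
      ew (marked_tree m) {v, u'} - tree.iter m n (v, u') \<le> t)" for m t
    unfolding tree.step_le_iff by (auto simp: in_dart_succ Ball_def split_paired_All)
  have "{m \<in> space marks_space. tree.step m (tree.iter m n) (u, v) \<le> t} \<in> sets marks_space" for t
    unfolding iff by measurable
  then show ?case
    by (simp add: borel_measurable_iff_le d)
qed

lemma measurable_tree_lo_hi [measurable]:
  "(\<lambda>m. tree.lo m d) \<in> borel_measurable marks_space"
  "(\<lambda>m. tree.hi m d) \<in> borel_measurable marks_space"
proof -
  show "(\<lambda>m. tree.lo m d) \<in> borel_measurable marks_space"
    by (rule borel_measurable_LIMSEQ_real[OF tree.tendsto_lo measurable_tree_iter])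
  show "(\<lambda>m. tree.hi m d) \<in> borel_measurable marks_space"
    by (rule borel_measurable_LIMSEQ_real[OF tree.tendsto_hi measurable_tree_iter])
qed

lemma pred_rigid [measurable]: "Measurable.pred marks_space rigid"
proof -
  have eq: "rigid = (\<lambda>m. \<forall>u v. (u, v) \<in> darts (marked_tree m) \<longrightarrow>
      \<not> tree.lo m (u, v) < tree.hi m (u, v) \<and> \<not> tree.hi m (u, v) < tree.lo m (u, v))"
    by (auto simp: rigid_def fun_eq_iff not_less intro: antisym)
  show ?thesis by (subst eq) measurable
qed

lemma pred_untied [measurable]: "Measurable.pred marks_space untied"
proof -
  note [measurable] = measurable_ew_tree
  have eq: "untied = (\<lambda>m. \<forall>u v. (u, v) \<in> darts (marked_tree m) \<longrightarrow>
      tree.lo m (u, v) + tree.lo m (v, u) < ew (marked_tree m) {u, v} \<or>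
      ew (marked_tree m) {u, v} < tree.lo m (u, v) + tree.lo m (v, u))"
    by (auto simp: untied_def fun_eq_iff neq_iff)
  show ?thesis by (subst eq) measurable
qed

lemma pred_MD [measurable]: "Measurable.pred marks_space (\<lambda>m. e \<in> MD (marked_tree m))"
proof (cases "\<exists>u v. e = {u, v}")
  case True
  then obtain u v where e: "e = {u, v}" by blast
  note [measurable] = measurable_ew_tree
  show ?thesis unfolding e pair_in_MD_tree by measurable
next
  case False
  then have "e \<notin> MD (marked_tree m)" for m
    by (auto simp: MD_tree)
  then show ?thesis by simp
qed

context ubgw_laws
begin

text \<open>Both properties are conjunctions over countably many words. The first uses the law of
  fringe subtrees, the second that an atomless edge weight almost surely misses a threshold that
  ignores it.\<close>

lemma AE_rigid_untied:
  assumes "bdd_below (msupport \<xi>)" "locally_convex_under_max (msupport \<omega>)"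
  shows "AE m in ubgw_marks \<pi> \<omega> \<xi>. rigid m \<and> untied m"
  unfolding ubgw_marks_eq_gw
proof -
  let ?P = "gw \<pi> (size_biased \<pi>)"
  have "AE m in ?P. v \<noteq> [] \<longrightarrow> fringe.lo (fringe_at v m) = fringe.hi (fringe_at v m)" for v
    by (cases "v = []") (auto intro: AE_fringe_at[OF AE_lo_eq_hi[OF assms]])
  then have "AE m in ?P. \<forall>v. v \<noteq> [] \<longrightarrow> fringe.lo (fringe_at v m) = fringe.hi (fringe_at v m)"
    by (simp only: AE_all_countable simp_thms)
  then have "AE m in ?P. rigid m"
    by eventually_elim (blast intro: rigidI)
  moreover have "AE m in ?P. u @ [k] \<in> verts (marked_tree m) \<longrightarrow>
      tree.lo m (u, u @ [k]) + tree.lo m (u @ [k], u) \<noteq> edge_mark m (u @ [k])" for u k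
  proof -
    \<comment> \<open>The default \<open>0\<close> off the tree makes \<open>T\<close> insensitive
      to the edge mark everywhere; \<open>tree_lo_set_edge_mark\<close> speaks of darts
      only.\<close>
    define T where "T m = (if u @ [k] \<in> verts (marked_tree m)
      then tree.lo m (u, u @ [k]) + tree.lo m (u @ [k], u) else 0)" for m
    have "AE m in ?P. edge_mark m (u @ [k]) \<noteq> T m"
    proof (rule AE_edge_mark_neq[OF atomless])
      show "T \<in> borel_measurable marks_space" unfolding T_def by measurable
      show "T (set_edge_mark (u @ [k]) w m) = T m" for w m
        unfolding T_def
        using tree_lo_set_edge_mark[of u "u @ [k]" m u k w] tree_lo_set_edge_mark[of "u @ [k]" u m u k w]
        by (auto simp: insert_commute)
    qed
    then show ?thesis
      by eventually_elim (auto simp: T_def)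
  qed
  then have "AE m in ?P. \<forall>u k. u @ [k] \<in> verts (marked_tree m) \<longrightarrow>
      tree.lo m (u, u @ [k]) + tree.lo m (u @ [k], u) \<noteq> edge_mark m (u @ [k])"
    by (simp only: AE_all_countable simp_thms)
  then have "AE m in ?P. untied m"
  proof eventually_elim
    case (elim m)
    show ?case
      unfolding untied_def
    proof (intro ballI, clarify)
      fix u v assume "(u, v) \<in> darts (marked_tree m)"
        and eq: "tree.lo m (u, v) + tree.lo m (v, u) = ew (marked_tree m) {u, v}"
      then show False
        using elim by (cases rule: dart_cases) (auto simp: add.commute)
    qed
  qed
  ultimately show "AE m in ?P. rigid m \<and> untied m" by simp
qed

end

section \<open>Reading the marks off a random graph\<close>

lemma measurable_graph_spaceI:
  fixes f :: "'a \<Rightarrow> 'v rgraph"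
  assumes "\<And>v B. B \<in> sets borel \<Longrightarrow> {x \<in> space N. v \<in> verts (f x) \<and> vw (f x) v \<in> B} \<in> sets N"
    and "\<And>e B. B \<in> sets borel \<Longrightarrow> {x \<in> space N. e \<in> edges (f x) \<and> ew (f x) e \<in> B} \<in> sets N"
    and "\<And>e. {x \<in> space N. e \<in> dimers (f x)} \<in> sets N"
    and "\<And>v. {x \<in> space N. root (f x) = v} \<in> sets N"
  shows "f \<in> N \<rightarrow>\<^sub>M graph_space"
  unfolding graph_space_def
proof (rule measurable_measure_of)
  fix A :: "'v rgraph set"
  assume "A \<in> {{g. v \<in> verts g \<and> vw g v \<in> B} | v B. B \<in> sets borel} \<union>
      {{g. e \<in> edges g \<and> ew g e \<in> B} | e B. B \<in> sets borel} \<union>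
      {{g. e \<in> dimers g} | e. True} \<union> {{g. root g = v} | v. True}"
  then show "f -` A \<inter> space N \<in> sets N"
    using assms by (auto simp: vimage_def Int_def conj_commute)
qed auto

lemma space_graph_space [simp]: "space graph_space = UNIV"
  by (simp add: graph_space_def)

lemma pred_graph_space_sets: "Measurable.pred graph_space P \<Longrightarrow> {g. P g} \<in> sets graph_space"
  by (simp add: pred_def)

lemma sets_graph_space_basic:
  "B \<in> sets borel \<Longrightarrow> {g. v \<in> verts g \<and> vw g v \<in> B} \<in> sets graph_space"
  "B \<in> sets borel \<Longrightarrow> {g. e \<in> edges g \<and> ew g e \<in> B} \<in> sets graph_space"
  "{g. e \<in> dimers g} \<in> sets graph_space"
  "{g. root g = v} \<in> sets graph_space"
  by (auto simp: graph_space_def intro!: sigma_sets.Basic)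

lemma pred_graph_space [measurable]:
  "Measurable.pred graph_space (\<lambda>g. v \<in> verts g)"
  "Measurable.pred graph_space (\<lambda>g. e \<in> edges g)"
  "Measurable.pred graph_space (\<lambda>g. e \<in> dimers g)"
  "Measurable.pred graph_space (\<lambda>g. root g = v)"
  using sets_graph_space_basic(1)[of UNIV v] sets_graph_space_basic(2)[of UNIV e]
    sets_graph_space_basic(3)[of e] sets_graph_space_basic(4)[of v]
  by (simp_all add: pred_def)

text \<open>Two graphs that differ only in the meaningless values of the weights off edges and vertices.\<close>

definition same_graph :: "'v rgraph \<Rightarrow> 'v rgraph \<Rightarrow> bool" where
  "same_graph g h \<longleftrightarrow> verts g = verts h \<and> edges g = edges h \<and> dimers g = dimers h \<and> root g = root h \<and>
     (\<forall>e\<in>edges h. ew g e = ew h e) \<and> (\<forall>v\<in>verts h. vw g v = vw h v)"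

text \<open>The generators look at weights only on edges and vertices that are present, and this
  blindness survives the sigma-algebra operations.\<close>

lemma same_graph_sets:
  assumes "same_graph g h" "A \<in> sets graph_space"
  shows "g \<in> A \<longleftrightarrow> h \<in> A"
proof -
  have "A \<in> sigma_sets UNIV
     ({{g. v \<in> verts g \<and> vw g v \<in> B} | v B. B \<in> sets borel} \<union>
      {{g. e \<in> edges g \<and> ew g e \<in> B} | e B. B \<in> sets borel} \<union>
      {{g. e \<in> dimers g} | e. True} \<union> {{g. root g = v} | v. True})"
    using assms(2) by (simp add: graph_space_def)
  then show ?thesis
  proof induction
    case (Basic a)
    then show ?case using assms(1) by (auto simp: same_graph_def)
  qed auto
qed

lemma converges_locally_same_graph:
  fixes A :: "nat \<Rightarrow> 'u rgraph" and g h :: "'v rgraph"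
  assumes "converges_locally A g" "same_graph g h"
  shows "converges_locally A h"
proof -
  have "darts g = darts h" using assms(2) by (simp add: darts_def same_graph_def)
  then have ball: "ball_verts H g = ball_verts H h" for H
    using assms(2) by (intro set_eqI) (simp add: in_ball_verts same_graph_def)
  have iso: "graph_iso a (graph_ball H h)" if iso: "graph_iso a (graph_ball H g)" for a :: "'u rgraph" and H
  proof -
    obtain f where f: "bij_betw f (verts a) (ball_verts H g)" "f (root a) = root g"
      "(`) f ` edges a = {e \<in> edges g. e \<subseteq> ball_verts H g}"
      "(`) f ` dimers a = {e \<in> dimers g. e \<subseteq> ball_verts H g}"
      "\<And>e. e \<in> edges a \<Longrightarrow> ew g (f ` e) = ew a e" "\<And>v. v \<in> verts a \<Longrightarrow> vw g (f v) = vw a v"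
      using iso unfolding graph_iso_def graph_ball_simps by auto
    have "ew h (f ` e) = ew a e" if "e \<in> edges a" for e
    proof -
      have "f ` e \<in> {e \<in> edges g. e \<subseteq> ball_verts H g}"
        unfolding f(3)[symmetric] using that by simp
      then show ?thesis using f(5)[OF that] assms(2) by (simp add: same_graph_def)
    qed
    moreover have "vw h (f v) = vw a v" if "v \<in> verts a" for v
      using bij_betwE[OF f(1)] f(6)[OF that] that assms(2) by (auto simp: same_graph_def in_ball_verts)
    ultimately show ?thesis
      unfolding graph_iso_def graph_ball_simps using f(1-4) assms(2)
      by (intro exI[of _ f]) (simp add: same_graph_def ball)
  qed
  then show ?thesis
    using assms(1) iso unfolding converges_locally_def by blast
qed

text \<open>A measurable left inverse of the tree construction, up to marks invisible in the tree:
  the number of children is the first missing child index, and absent weights default to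
  \<open>0\<close>.\<close>

definition marks_of :: "nat list rgraph \<Rightarrow> nat list \<Rightarrow> nat \<times> real \<times> real" where
  "marks_of g u = (LEAST k. u @ [k] \<notin> verts g,
     if {butlast u, u} \<in> edges g then ew g {butlast u, u} else 0,
     if u \<in> verts g then vw g u else 0)"

lemma measurable_marks_of [measurable]: "marks_of \<in> graph_space \<rightarrow>\<^sub>M marks_space"
proof (rule measurable_marksI)
  fix u :: "nat list"
  have [measurable]: "(\<lambda>g. if e \<in> edges g then ew g e else 0) \<in> borel_measurable graph_space"
    for e :: "nat list set"
  proof (rule measurableI)
    fix B :: "real set" assume B: "B \<in> sets borel"
    have "(\<lambda>g. if e \<in> edges g then ew g e else 0) -` B =
        {g. e \<in> edges g \<and> ew g e \<in> B} \<union> (if 0 \<in> B then {g \<in> space graph_space. e \<notin> edges g} else {})"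
      by (auto split: if_splits)
    moreover have "{g \<in> space graph_space. e \<notin> edges g} \<in> sets graph_space"
      by measurable
    ultimately show "(\<lambda>g. if e \<in> edges g then ew g e else 0) -` B \<inter> space graph_space \<in> sets graph_space"
      using sets_graph_space_basic(2)[OF B, of e] by auto
  qed simp
  have [measurable]: "(\<lambda>g. if u \<in> verts g then vw g u else 0) \<in> borel_measurable graph_space"
  proof (rule measurableI)
    fix B :: "real set" assume B: "B \<in> sets borel"
    have "(\<lambda>g. if u \<in> verts g then vw g u else 0) -` B =
        {g. u \<in> verts g \<and> vw g u \<in> B} \<union> (if 0 \<in> B then {g \<in> space graph_space. u \<notin> verts g} else {})"
      by (auto split: if_splits)
    moreover have "{g \<in> space graph_space. u \<notin> verts g} \<in> sets graph_space"
      by measurable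
    ultimately show "(\<lambda>g. if u \<in> verts g then vw g u else 0) -` B \<inter> space graph_space \<in> sets graph_space"
      using sets_graph_space_basic(1)[OF B, of u] by auto
  qed simp
  show "(\<lambda>g. marks_of g u) \<in> graph_space \<rightarrow>\<^sub>M count_space UNIV \<Otimes>\<^sub>M (borel \<Otimes>\<^sub>M borel)"
    unfolding marks_of_def by measurable
qed

abbreviation decorated :: "(nat list \<Rightarrow> nat \<times> real \<times> real) \<Rightarrow> nat list rgraph" where
  "decorated m \<equiv> rooted (marked_tree m) (MD (marked_tree m)) []"

abbreviation undecorated :: "(nat list \<Rightarrow> nat \<times> real \<times> real) \<Rightarrow> nat list rgraph" where
  "undecorated m \<equiv> rooted (marked_tree m) {} []"

lemma pred_edges_tree [measurable]: "Measurable.pred marks_space (\<lambda>m. e \<in> edges (marked_tree m))"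
proof (cases "\<exists>u k. e = {u, u @ [k]}")
  case True
  then obtain u k where e: "e = {u, u @ [k]}" by blast
  have "e \<in> edges (marked_tree m) \<longleftrightarrow> (u, u @ [k]) \<in> darts (marked_tree m)" for m
    by (simp only: darts_def e mem_Collect_eq case_prod_conv)
  then show ?thesis by simp
next
  case False
  then have "e \<notin> edges (marked_tree m)" for m
    by (auto simp: edges_tree)
  then show ?thesis by simp
qed

lemma measurable_decorate:
  assumes "\<And>e. Measurable.pred marks_space (\<lambda>m. e \<in> D m)"
  shows "(\<lambda>m. rooted (marked_tree m) (D m) []) \<in> marks_space \<rightarrow>\<^sub>M graph_space"
proof (rule measurable_graph_spaceI)
  note [measurable] = assms measurable_ew_tree
  fix B :: "real set" assume [measurable]: "B \<in> sets borel"
  show "{m \<in> space marks_space. v \<in> verts (rooted (marked_tree m) (D m) []) \<and>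
      vw (rooted (marked_tree m) (D m) []) v \<in> B} \<in> sets marks_space" for v
    unfolding rooted_simps vw_tree by measurable
  show "{m \<in> space marks_space. e \<in> edges (rooted (marked_tree m) (D m) []) \<and>
      ew (rooted (marked_tree m) (D m) []) e \<in> B} \<in> sets marks_space" for e
    unfolding rooted_simps by measurable
qed (use assms sets.top[of marks_space] in \<open>auto simp: pred_def\<close>)

lemma measurable_decorated [measurable]: "decorated \<in> marks_space \<rightarrow>\<^sub>M graph_space"
  by (rule measurable_decorate) measurable

lemma measurable_undecorated [measurable]: "undecorated \<in> marks_space \<rightarrow>\<^sub>M graph_space"
  by (rule measurable_decorate) simp

text \<open>Agreement of the marks that the tree can see: those at its vertices, apart from the edge
  mark of the root, which has no parent edge.\<close>

definition same_marks :: "(nat list \<Rightarrow> nat \<times> real \<times> real) \<Rightarrow> (nat list \<Rightarrow> nat \<times> real \<times> real) \<Rightarrow> bool" where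
  "same_marks m m' \<longleftrightarrow> (\<forall>u\<in>verts (marked_tree m). num_children m' u = num_children m u \<and>
     vertex_mark m' u = vertex_mark m u \<and> (u \<noteq> [] \<longrightarrow> edge_mark m' u = edge_mark m u))"

lemma same_marks_verts:
  assumes "same_marks m m'"
  shows "verts (marked_tree m') = verts (marked_tree m)"
proof -
  have "u \<in> verts (marked_tree m') \<longleftrightarrow> u \<in> verts (marked_tree m)" for u
    using assms by (induction u rule: rev_induct) (auto simp: same_marks_def)
  then show ?thesis by blast
qed

lemma same_marks_edges:
  assumes "same_marks m m'"
  shows "edges (marked_tree m') = edges (marked_tree m)" "darts (marked_tree m') = darts (marked_tree m)"
  using same_marks_verts[OF assms] by (simp_all add: edges_tree darts_def)

lemma same_marks_ew:
  assumes "same_marks m m'" "(u, v) \<in> darts (marked_tree m)"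
  shows "ew (marked_tree m') {u, v} = ew (marked_tree m) {u, v}"
  using assms(2)
  by (cases rule: dart_cases) (use assms(1) in \<open>auto simp: same_marks_def\<close>)

lemma same_marks_messages:
  assumes "same_marks m m'" "d \<in> darts (marked_tree m)"
  shows "tree.lo m' d = tree.lo m d" "tree.hi m' d = tree.hi m d"
proof -
  have iter: "tree.iter m' n (id d) = tree.iter m n d" for n
  proof (rule max_minus_iter_transfer[where J = "darts (marked_tree m)"])
    fix i assume i: "i \<in> darts (marked_tree m)"
    show "dart_base (marked_tree m') (id i) = dart_base (marked_tree m) i"
      using assms(1) dart_verts[of "fst i" "snd i" m] i by (cases i) (simp add: same_marks_def)
    show "dart_succ (marked_tree m') (id i) = id ` dart_succ (marked_tree m) i"
      using same_marks_edges[OF assms(1)] by (simp add: dart_succ_def)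
    show "dart_succ (marked_tree m) i \<subseteq> darts (marked_tree m)" by (rule dart_succ_subset)
    fix j assume "j \<in> dart_succ (marked_tree m) i"
    then have "j \<in> darts (marked_tree m)" using dart_succ_subset by blast
    then show "dart_weight (marked_tree m') (id j) = dart_weight (marked_tree m) j"
      using same_marks_ew[OF assms(1)] by (cases j) simp
  qed (use assms(2) tree.max_minus_axioms in auto)
  then show "tree.lo m' d = tree.lo m d" "tree.hi m' d = tree.hi m d"
    unfolding tree.lo_def tree.hi_def by (simp_all only: iter[unfolded id_apply])
qed

lemma same_marks_rigid: "same_marks m m' \<Longrightarrow> rigid m' \<longleftrightarrow> rigid m"
  by (simp add: rigid_def same_marks_edges same_marks_messages)

lemma same_marks_untied: "same_marks m m' \<Longrightarrow> untied m' \<longleftrightarrow> untied m"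
  using same_marks_edges[of m m'] same_marks_messages[of m m'] same_marks_ew[of m m'] darts_sym[of _ _ "marked_tree m"]
  unfolding untied_def by fastforce

lemma same_marks_MD:
  assumes "same_marks m m'"
  shows "MD (marked_tree m') = MD (marked_tree m)"
proof -
  have "e \<in> MD (marked_tree m') \<longleftrightarrow> e \<in> MD (marked_tree m)" for e
  proof (cases "\<exists>u v. e = {u, v}")
    case True
    then obtain u v where e: "e = {u, v}" by blast
    show ?thesis
      unfolding e pair_in_MD_tree same_marks_rigid[OF assms] same_marks_edges[OF assms]
      using same_marks_messages[OF assms] same_marks_ew[OF assms] darts_sym[of u v "marked_tree m"]
      by auto
  next
    case False
    then show ?thesis by (auto simp: MD_tree)
  qed
  then show ?thesis by blast
qed

lemma same_graph_rooted:
  assumes "same_marks m m'"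
  shows "same_graph (rooted (marked_tree m') D []) (rooted (marked_tree m) D [])"
proof -
  have "ew (marked_tree m') e = ew (marked_tree m) e" if e_in: "e \<in> edges (marked_tree m)" for e
  proof -
    obtain u k where e: "e = {u, u @ [k]}" using e_in by (auto simp: edges_tree)
    show ?thesis
      using same_marks_ew[OF assms, of u "u @ [k]"] e_in unfolding e by (simp only: darts_def mem_Collect_eq case_prod_conv)
  qed
  moreover have "vw (marked_tree m') v = vw (marked_tree m) v" if "v \<in> verts (marked_tree m)" for v
    using assms that by (simp add: same_marks_def)
  ultimately show ?thesis
    using same_marks_verts[OF assms] same_marks_edges[OF assms] by (simp add: same_graph_def)
qed

lemma same_marks_marks_of: "same_marks m (marks_of (rooted (marked_tree m) D []))"
  unfolding same_marks_def
proof (intro ballI conjI impI)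
  fix u assume u: "u \<in> verts (marked_tree m)"
  have "(LEAST k. \<not> k < num_children m u) = num_children m u"
    by (rule Least_equality) auto
  then show "num_children (marks_of (rooted (marked_tree m) D [])) u = num_children m u"
    using u by (simp add: marks_of_def)
  show "vertex_mark (marks_of (rooted (marked_tree m) D [])) u = vertex_mark m u"
    using u by (simp add: marks_of_def)
  assume "u \<noteq> []"
  then obtain v k where uv: "u = v @ [k]" by (cases u rule: rev_cases) auto
  have "{v, u} \<in> edges (marked_tree m)"
    using u unfolding uv edges_tree by blast
  then show "edge_mark (marks_of (rooted (marked_tree m) D [])) u = edge_mark m u"
    by (simp add: marks_of_def uv)
qed

text \<open>Quantifies over pairs of words, which are countable, instead of over sets of words; that
  every edge is a pair comes from \<open>rooted_graph\<close>. A measurable property is wanted since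
  the limit is known only in law.\<close>

definition tree_shaped :: "nat list rgraph \<Rightarrow> bool" where
  "tree_shaped g \<longleftrightarrow> root g = [] \<and>
     (\<forall>u. u \<in> verts g \<longleftrightarrow> u \<in> verts (marked_tree (marks_of g))) \<and>
     (\<forall>u v. {u, v} \<in> edges g \<longleftrightarrow> {u, v} \<in> edges (marked_tree (marks_of g))) \<and>
     (\<forall>u v. {u, v} \<notin> dimers g)"

lemma pred_tree_shaped [measurable]: "Measurable.pred graph_space tree_shaped"
proof -
  have [measurable]: "Measurable.pred graph_space (\<lambda>g. e \<in> edges (marked_tree (marks_of g)))" for e
    by (rule measurable_compose[OF measurable_marks_of pred_edges_tree])
  show ?thesis
    unfolding tree_shaped_def[abs_def] by measurable
qed

lemma tree_shaped_undecorated: "tree_shaped (undecorated m)"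
  using same_marks_verts[OF same_marks_marks_of[of m "{}"]] same_marks_edges[OF same_marks_marks_of[of m "{}"]]
  by (simp add: tree_shaped_def)

lemma tree_shaped_same_graph:
  assumes "rooted_graph g" "tree_shaped g"
  shows "same_graph g (undecorated (marks_of g))"
proof -
  have pair: "\<exists>u v. e = {u, v}" if "e \<in> edges g" for e
    using that assms(1) unfolding rooted_graph_def locally_finite_graph_def by blast
  have pair': "\<exists>u v. e = {u, v}" if "e \<in> edges (marked_tree (marks_of g))" for e
    using that by (auto simp: edges_tree)
  have edges: "edges g = edges (marked_tree (marks_of g))"
  proof (intro set_eqI iffI)
    show "e \<in> edges (marked_tree (marks_of g))" if "e \<in> edges g" for e
      using pair[OF that] that assms(2) by (auto simp: tree_shaped_def)
    show "e \<in> edges g" if "e \<in> edges (marked_tree (marks_of g))" for e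
      using pair'[OF that] that assms(2) by (auto simp: tree_shaped_def)
  qed
  have "dimers g \<subseteq> edges g"
    using assms(1) by (simp add: rooted_graph_def monomer_dimer_def)
  then have "dimers g = {}"
    using pair assms(2) by (fastforce simp: tree_shaped_def)
  moreover have "ew g e = ew (marked_tree (marks_of g)) e" if "e \<in> edges g" for e
  proof -
    obtain u k where e: "e = {u, u @ [k]}"
      using \<open>e \<in> edges g\<close> unfolding edges edges_tree by blast
    show ?thesis
      using that unfolding e ew_tree by (simp add: marks_of_def)
  qed
  moreover have "verts g = verts (marked_tree (marks_of g))"
    using assms(2) by (auto simp: tree_shaped_def)
  moreover have "vw g v = vw (marked_tree (marks_of g)) v" if "v \<in> verts g" for v
    using that by (simp add: marks_of_def)
  ultimately show ?thesis
    using assms(2) edges by (simp add: same_graph_def tree_shaped_def)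
qed

section \<open>Decorating the two limits\<close>

context ubgw_laws
begin

text \<open>The configuration is computed from the recovered marks and not from the graph itself,
  which yields a measurable map defined on all rooted graphs.\<close>

definition decorate :: "nat list rgraph \<Rightarrow> nat list rgraph" where
  "decorate g = decorated (marks_of g)"

lemma measurable_decorate_graph [measurable]: "decorate \<in> graph_space \<rightarrow>\<^sub>M graph_space"
  unfolding decorate_def[abs_def] by measurable

lemma rooted_graph_decorate: "rooted_graph (decorate g)"
  using locally_finite_tree[of "marks_of g"] monomer_dimer_MD_tree[of "marks_of g"]
  by (simp add: rooted_graph_def decorate_def locally_finite_graph_def monomer_dimer_def)

lemma sets_ubgw_marks [measurable_cong]: "sets (ubgw_marks \<pi> \<omega> \<xi>) = sets marks_space"
  by (simp only: ubgw_marks_eq_gw sets_gw)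

text \<open>Reading off the marks and rebuilding the tree may change weights off edges and vertices,
  but no measurable set detects that.\<close>

lemma distr_decorate: "distr (ubgw_law \<pi> \<omega> \<xi>) graph_space decorate = ubgw_MD_law \<pi> \<omega> \<xi>"
proof -
  let ?P = "ubgw_marks \<pi> \<omega> \<xi>"
  have "distr (ubgw_law \<pi> \<omega> \<xi>) graph_space decorate = distr ?P graph_space (decorate \<circ> undecorated)"
    unfolding ubgw_law_def by (rule distr_distr) measurable
  also have "\<dots> = distr ?P graph_space decorated"
  proof (rule measure_eqI)
    fix A assume A: "A \<in> sets (distr ?P graph_space (decorate \<circ> undecorated))"
    have "(decorate \<circ> undecorated) m \<in> A \<longleftrightarrow> decorated m \<in> A" for m
      using same_graph_sets[OF same_graph_rooted[OF same_marks_marks_of[of m "{}"]], of A "MD (marked_tree m)"] A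
        same_marks_MD[OF same_marks_marks_of[of m "{}"]]
      by (simp add: decorate_def)
    then have "(decorate \<circ> undecorated) -` A = decorated -` A" by auto
    moreover have "decorate \<circ> undecorated \<in> ?P \<rightarrow>\<^sub>M graph_space" unfolding comp_def by measurable
    ultimately show "emeasure (distr ?P graph_space (decorate \<circ> undecorated)) A = emeasure (distr ?P graph_space decorated) A"
      using A by (subst (1 2) emeasure_distr) (auto)
  qed simp
  finally show ?thesis by (simp add: ubgw_MD_law_def)
qed

text \<open>Being tree-shaped, rigid and untied are measurable properties of the graph, so they pass
  from the law of the tree to \<open>S\<close>. On each such outcome the deterministic convergence
  result applies.\<close>

lemma limit_decorate:
  assumes "bdd_below (msupport \<xi>)" "locally_convex_under_max (msupport \<omega>)"
    and S: "random_graph M S" "distr M graph_space S = ubgw_law \<pi> \<omega> \<xi>"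
    and G: "\<And>n p. p \<in> space M \<Longrightarrow> finite_graph (G n p)"
      "\<And>n p. p \<in> space M \<Longrightarrow> r n p \<in> verts (G n p)"
      "\<And>n p. p \<in> space M \<Longrightarrow> optimal (G n p) (D n p)"
    and conv: "AE p in M. converges_locally (\<lambda>n. rooted (G n p) {} (r n p)) (S p)"
  shows "random_graph M (decorate \<circ> S)"
    "distr M graph_space (decorate \<circ> S) = ubgw_MD_law \<pi> \<omega> \<xi>"
    "AE p in M. converges_locally (\<lambda>n. rooted (G n p) (D n p) (r n p)) ((decorate \<circ> S) p)"
proof -
  have [measurable]: "S \<in> M \<rightarrow>\<^sub>M graph_space"
    using S(1) by (simp add: random_graph_def)
  show "random_graph M (decorate \<circ> S)"
    unfolding random_graph_def using rooted_graph_decorate by (simp add: comp_def)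
  show "distr M graph_space (decorate \<circ> S) = ubgw_MD_law \<pi> \<omega> \<xi>"
    unfolding distr_decorate[symmetric] S(2)[symmetric] by (rule distr_distr[symmetric]) measurable
  let ?good = "\<lambda>g. rigid (marks_of g) \<and> untied (marks_of g) \<and> tree_shaped g"
  have [measurable]: "Measurable.pred graph_space (\<lambda>g. rigid (marks_of g))"
    "Measurable.pred graph_space (\<lambda>g. untied (marks_of g))"
    by (rule measurable_compose[OF measurable_marks_of] pred_rigid pred_untied)+
  have good: "Measurable.pred graph_space ?good" by measurable
  have "AE m in ubgw_marks \<pi> \<omega> \<xi>. ?good (undecorated m)"
    using AE_rigid_untied[OF assms(1,2)]
    by eventually_elim
      (simp add: same_marks_rigid[OF same_marks_marks_of] same_marks_untied[OF same_marks_marks_of] tree_shaped_undecorated)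
  then have "AE g in ubgw_law \<pi> \<omega> \<xi>. ?good g"
    unfolding ubgw_law_def by (subst AE_distr_iff) (simp_all add: pred_graph_space_sets[OF good])
  then have "AE p in M. ?good (S p)"
    unfolding S(2)[symmetric] by (rule AE_distrD[rotated]) measurable
  with conv AE_space[of M]
  show "AE p in M. converges_locally (\<lambda>n. rooted (G n p) (D n p) (r n p)) ((decorate \<circ> S) p)"
  proof eventually_elim
    case (elim p)
    have "same_graph (S p) (undecorated (marks_of (S p)))"
      using S(1) elim by (intro tree_shaped_same_graph) (auto simp: random_graph_def)
    with elim(1) have "converges_locally (\<lambda>n. rooted (G n p) {} (r n p)) (undecorated (marks_of (S p)))"
      by (rule converges_locally_same_graph)
    then show ?case
      unfolding comp_def decorate_def using elim G by (intro converges_locally_MD) auto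
  qed
qed

end

theorem theorem2:
  fixes \<pi> :: "nat pmf" and \<omega> \<xi> :: "real measure"
    and M :: "'a measure"
    and G :: "nat \<Rightarrow> 'a \<Rightarrow> 'v wgraph"
    and D :: "nat \<Rightarrow> 'a \<Rightarrow> 'v set set"
    and r r' :: "nat \<Rightarrow> 'a \<Rightarrow> 'v"
  assumes "integrable (measure_pmf \<pi>) real"
    and "measure_pmf.expectation \<pi> real > 0"
    and "real_distribution \<omega>" and "real_distribution \<xi>"
    and "bdd_below (msupport \<xi>)"
    and "atoms \<xi> = {} \<or> atoms \<xi> = {Inf (msupport \<xi>)}"
    and "atoms \<omega> = {}"
    and "locally_convex_under_max (msupport \<omega>)"
    and "integrable (measure_pmf \<pi>) (\<lambda>k. (real k)\<^sup>2)"
    and "prob_space M"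
    and "\<And>n p. p \<in> space M \<Longrightarrow> finite_graph (G n p)"
    and "\<And>n. random_graph M (\<lambda>p. rooted (G n p) {} (r n p))"
    and "\<And>n. random_graph M (\<lambda>p. rooted (G n p) {} (r' n p))"
    and "\<And>n p. p \<in> space M \<Longrightarrow> optimal (G n p) (D n p)"
    and "AE p in M. (\<lambda>n. gdist (G n p) (r n p) (r' n p)) \<longlonglongrightarrow> \<infinity>"
    and "jointly_converge_to_independent_copies M
           (\<lambda>n p. rooted (G n p) {} (r n p))
           (\<lambda>n p. rooted (G n p) {} (r' n p))
           (ubgw_law \<pi> \<omega> \<xi>)"
  shows "jointly_converge_to_independent_copies M
           (\<lambda>n p. rooted (G n p) (D n p) (r n p))
           (\<lambda>n p. rooted (G n p) (D n p) (r' n p))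
           (ubgw_MD_law \<pi> \<omega> \<xi>)"
proof -
  interpret W: real_distribution \<omega> by fact
  interpret X: real_distribution \<xi> by fact
  interpret M: prob_space M by fact
  interpret ubgw_laws \<omega> \<xi> \<pi>
    by unfold_locales (use assms in auto)
  have root: "r n p \<in> verts (G n p)" "r' n p \<in> verts (G n p)" if "p \<in> space M" for n p
    using assms(12,13)[of n] that by (auto simp: random_graph_def rooted_graph_def)
  obtain S T where S: "random_graph M S" "distr M graph_space S = ubgw_law \<pi> \<omega> \<xi>"
    and T: "random_graph M T" "distr M graph_space T = ubgw_law \<pi> \<omega> \<xi>"
    and ind: "M.indep_var graph_space S graph_space T"
    and conv: "AE p in M. converges_locally (\<lambda>n. rooted (G n p) {} (r n p)) (S p)"
      "AE p in M. converges_locally (\<lambda>n. rooted (G n p) {} (r' n p)) (T p)"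
    using assms(16) unfolding jointly_converge_to_independent_copies_def by auto
  note S' = limit_decorate[OF assms(5,8) S assms(11) root(1) assms(14) conv(1)]
  note T' = limit_decorate[OF assms(5,8) T assms(11) root(2) assms(14) conv(2)]
  \<comment> \<open>Each decorated limit is a measurable function of its own undecorated limit,
    which preserves independence.\<close>
  have "M.indep_var graph_space (decorate \<circ> S) graph_space (decorate \<circ> T)"
    by (rule M.indep_var_compose[OF ind]) measurable
  then show ?thesis
    unfolding jointly_converge_to_independent_copies_def using S' T'
    by (intro exI[of _ "decorate \<circ> S"] exI[of _ "decorate \<circ> T"]) simp
qed

end
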